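(* Let $(M,\Omega_\gamma)$ be a $\gamma$-dependent presymplectic manifold, and let $F:M\times\Gamma\rightarrow M$ be a non-resonant presymplectic nearly-periodic map on $(M,\Omega_\gamma)$ with roto-rate $R_\gamma$. Then $\mathcal{L}_{R_\gamma}\Omega_\gamma = 0$ in the sense of formal power series in $\gamma$.
   Context: Smooth means $C^\infty$. $M$ is a smooth manifold and $\Gamma$ is a finite-dimensional real vector space. A nearly-periodic map on $M$ with parameter space $\Gamma$ is a smooth map $F:M\times\Gamma\rightarrow M$ such that, writing $F_\gamma(m)=F(m,\gamma)$: (i) $F_\gamma:M\rightarrow M$ is a diffeomorphism for each $\gamma\in\Gamma$; (ii) there exist a (smooth) $U(1)$-action $\Phi_\theta:M\rightarrow M$ and a constant $\theta_0\in U(1)=\mathbb{R}/2\pi\mathbb{Z}$ such that $F_0=\Phi_{\theta_0}$. $F$ is called resonant if $\theta_0$ is a rational multiple of $2\pi$, and non-resonant otherwise. The infinitesimal generator $R_0$ of $\Phi_\theta$ is called the limiting roto-rate. A roto-rate for $F$ is a formal power series $R_\gamma = R_0+R_1[\gamma]+R_2[\gamma,\gamma]+\dots$, whose coefficients are homogeneous polynomial maps from $\Gamma$ into vector fields on $M$, such that $R_0$ is the limiting roto-rate, $F_\gamma^*R_\gamma=R_\gamma$, and $\exp(2\pi\mathcal{L}_{R_\gamma})=1$, the last two in the sense of formal power series in $\gamma$. Each non-resonant nearly-periodic map has a unique roto-rate. $\mathcal{L}$ denotes the Lie derivative. $F_\gamma^*$ and $\Omega_\gamma$ are understood, in formal identities,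 through their formal Taylor series in $\gamma$ at $\gamma=0$. For a formal power series of vector fields $R_\gamma$ with leading term $R_0$, $\exp(\theta\mathcal{L}_{R_\gamma})$ denotes the formal pullback flow of $R_\gamma$: the formal power series in $\gamma$ of operators on tensor fields, with leading term $\Phi_\theta^*$, solving $\frac{d}{d\theta}\exp(\theta\mathcal{L}_{R_\gamma})=\exp(\theta\mathcal{L}_{R_\gamma})\mathcal{L}_{R_\gamma}$ with value $1$ at $\theta=0$. A $\gamma$-dependent presymplectic manifold $(M,\Omega_\gamma)$ is a manifold $M$ with a $2$-form $\Omega_\gamma$ depending smoothly on $\gamma\in\Gamma$ such that $\mathbf{d}\Omega_\gamma=0$ for each $\gamma\in\Gamma$ ($\Omega_\gamma$ may be degenerate). A presymplectic nearly-periodic map on $(M,\Omega_\gamma)$ is a nearly-periodic map $F$ on $M$ with $F_\gamma^*\Omega_\gamma=\Omega_\gamma$ for each $\gamma\in\Gamma$. *)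

theory Defs
  imports "HOL-Analysis.Analysis"
begin

section \<open>Smooth maps between finite-dimensional spaces\<close>

definition finite_dim :: "'a::real_vector set \<Rightarrow> bool" where
  "finite_dim S \<longleftrightarrow> (\<exists>B. finite B \<and> span B = S)"

text \<open>The two definitions below are used only for open \<open>S\<close> in finite-dimensional spaces; there,
  continuity of all iterated directional derivatives is the usual notion of class \<open>C\<close>-infinity.\<close>

primrec Ck_on :: "nat \<Rightarrow> 'a::real_normed_vector set \<Rightarrow> ('a \<Rightarrow> 'b::real_normed_vector) \<Rightarrow> bool" where
  "Ck_on 0 S f \<longleftrightarrow> continuous_on S f"
| "Ck_on (Suc k) S f \<longleftrightarrow> (\<forall>x\<in>S. f differentiable (at x)) \<and>
     (\<forall>v. Ck_on k S (\<lambda>x. frechet_derivative f (at x) v))"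

definition smooth_on :: "'a::real_normed_vector set \<Rightarrow> ('a \<Rightarrow> 'b::real_normed_vector) \<Rightarrow> bool" where
  "smooth_on S f \<longleftrightarrow> (\<forall>k. Ck_on k S f)"

definition multilinear :: "nat \<Rightarrow> ('a::real_vector list \<Rightarrow> 'b::real_vector) \<Rightarrow> bool" where
  "multilinear k B \<longleftrightarrow> (\<forall>xs i. length xs = k \<longrightarrow> i < k \<longrightarrow> linear (\<lambda>x. B (xs[i := x])))"

definition homogeneous_poly :: "nat \<Rightarrow> ('a::real_vector \<Rightarrow> 'b::real_vector) \<Rightarrow> bool" where
  "homogeneous_poly k f \<longleftrightarrow> (\<exists>B. multilinear k B \<and> (\<forall>x. f x = B (replicate k x)))"

text \<open>The homogeneous term of degree \<open>n\<close> of the Taylor series at \<open>0\<close> of a smooth function \<open>f\<close>,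
  evaluated at \<open>\<gamma>\<close>; it is obtained by differentiating \<open>f\<close> along the line \<open>t \<mapsto> t \<gamma>\<close>.\<close>

definition taylor_term ::
    "nat \<Rightarrow> ('g::real_normed_vector \<Rightarrow> 'b::real_normed_vector) \<Rightarrow> 'g \<Rightarrow> 'b" where
  "taylor_term n f \<gamma> =
     ((\<lambda>h t. vector_derivative h (at t)) ^^ n) (\<lambda>t::real. f (t *\<^sub>R \<gamma>)) 0 /\<^sub>R fact n"


section \<open>Smooth manifolds\<close>

text \<open>The manifold is the whole type \<open>'m\<close>, with the topology of its type class; \<open>'e\<close> is the
  model space of the charts, and a chart is a domain together with its coordinate map.\<close>

type_synonym ('m, 'e) chart = "'m set \<times> ('m \<Rightarrow> 'e)"

abbreviation chart_dom :: "('m, 'e) chart \<Rightarrow> 'm set" where "chart_dom c \<equiv> fst c"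
abbreviation coord :: "('m, 'e) chart \<Rightarrow> 'm \<Rightarrow> 'e" where "coord c \<equiv> snd c"
abbreviation coord_inv :: "('m, 'e) chart \<Rightarrow> 'e \<Rightarrow> 'm" where
  "coord_inv c \<equiv> inv_into (chart_dom c) (coord c)"

definition is_chart :: "('m::topological_space, 'e::real_normed_vector) chart \<Rightarrow> bool" where
  "is_chart c \<longleftrightarrow> open (chart_dom c) \<and> open (coord c ` chart_dom c) \<and>
     homeomorphism (chart_dom c) (coord c ` chart_dom c) (coord c) (coord_inv c)"

definition smooth_manifold ::
    "('m::{t2_space, second_countable_topology}, 'e::real_normed_vector) chart set \<Rightarrow> bool" where
  "smooth_manifold A \<longleftrightarrow> finite_dim (UNIV :: 'e set) \<and>
     (\<forall>c\<in>A. is_chart c) \<and> (\<Union>c\<in>A. chart_dom c) = UNIV \<and>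
     (\<forall>c\<in>A. \<forall>c'\<in>A. smooth_on (coord c ` (chart_dom c \<inter> chart_dom c')) (coord c' \<circ> coord_inv c))"

definition smooth_map ::
    "('m::topological_space, 'e::real_normed_vector) chart set \<Rightarrow> ('m \<Rightarrow> 'm) \<Rightarrow> bool" where
  "smooth_map A f \<longleftrightarrow> continuous_on UNIV f \<and>
     (\<forall>c\<in>A. \<forall>c'\<in>A. smooth_on (coord c ` (chart_dom c \<inter> f -` chart_dom c')) (coord c' \<circ> f \<circ> coord_inv c))"

definition diffeomorphism ::
    "('m::topological_space, 'e::real_normed_vector) chart set \<Rightarrow> ('m \<Rightarrow> 'm) \<Rightarrow> bool" where
  "diffeomorphism A f \<longleftrightarrow> bij f \<and> smooth_map A f \<and> smooth_map A (inv f)"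

text \<open>Joint smoothness of \<open>(s, m) \<mapsto> f s m\<close> as a map from the product of the parameter space and
  the manifold to the manifold.\<close>

definition smooth_map_family ::
    "('m::topological_space, 'e::real_normed_vector) chart set \<Rightarrow>
     ('p::real_normed_vector \<Rightarrow> 'm \<Rightarrow> 'm) \<Rightarrow> bool" where
  "smooth_map_family A f \<longleftrightarrow> continuous_on UNIV (\<lambda>(s, m). f s m) \<and>
     (\<forall>c\<in>A. \<forall>c'\<in>A. smooth_on {(s, x). x \<in> coord c ` chart_dom c \<and> f s (coord_inv c x) \<in> chart_dom c'}
        (\<lambda>(s, x). coord c' (f s (coord_inv c x))))"


section \<open>Tangent vectors and tensor fields\<close>

text \<open>Each point gets a preferred chart, and the tangent space at the point is identified with the
  model space \<open>'e\<close> through that chart. All smoothness conditions refer to the components in the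
  charts of the atlas, so no continuity of the choice of preferred charts is involved.\<close>

definition chart_at :: "('m, 'e) chart set \<Rightarrow> 'm \<Rightarrow> ('m, 'e) chart" where
  "chart_at A p = (SOME c. c \<in> A \<and> p \<in> chart_dom c)"

definition transition_deriv ::
    "('m, 'e::real_normed_vector) chart \<Rightarrow> ('m, 'e) chart \<Rightarrow> 'm \<Rightarrow> 'e \<Rightarrow> 'e" where
  "transition_deriv c c' p = frechet_derivative (coord c' \<circ> coord_inv c) (at (coord c p))"

definition tangent_map ::
    "('m, 'e::real_normed_vector) chart set \<Rightarrow> ('m \<Rightarrow> 'm) \<Rightarrow> 'm \<Rightarrow> 'e \<Rightarrow> 'e" where
  "tangent_map A f p =
     frechet_derivative (coord (chart_at A (f p)) \<circ> f \<circ> coord_inv (chart_at A p))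
       (at (coord (chart_at A p) p))"

type_synonym ('m, 'e) vfield = "'m \<Rightarrow> 'e"

definition vfield_comp ::
    "('m, 'e::real_normed_vector) chart set \<Rightarrow> ('m, 'e) chart \<Rightarrow> ('m, 'e) vfield \<Rightarrow> 'e \<Rightarrow> 'e" where
  "vfield_comp A c X x =
     (let p = coord_inv c x in transition_deriv (chart_at A p) c p (X p))"

definition vector_field ::
    "('m, 'e::real_normed_vector) chart set \<Rightarrow> ('m, 'e) vfield \<Rightarrow> bool" where
  "vector_field A X \<longleftrightarrow> (\<forall>c\<in>A. smooth_on (coord c ` chart_dom c) (vfield_comp A c X))"

definition pullback_vfield ::
    "('m, 'e::real_normed_vector) chart set \<Rightarrow> ('m \<Rightarrow> 'm) \<Rightarrow> ('m, 'e) vfield \<Rightarrow> ('m, 'e) vfield"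
  where
  "pullback_vfield A f X p = inv (tangent_map A f p) (X (f p))"

text \<open>The value of a tensor field of type \<open>(r, s)\<close> at a point takes \<open>r\<close> covectors and \<open>s\<close>
  vectors; it is normalised to \<open>0\<close> on argument lists of any other length, so that equality of
  tensor fields is equality of functions.\<close>

type_synonym ('m, 'e) tensor = "'m \<Rightarrow> ('e \<Rightarrow>\<^sub>L real) list \<Rightarrow> 'e list \<Rightarrow> real"

definition tensor_at ::
    "nat \<Rightarrow> nat \<Rightarrow> (('e::real_normed_vector \<Rightarrow>\<^sub>L real) list \<Rightarrow> 'e list \<Rightarrow> real) \<Rightarrow> bool" where
  "tensor_at r s t \<longleftrightarrow>
     (\<forall>\<alpha>s vs. length \<alpha>s \<noteq> r \<or> length vs \<noteq> s \<longrightarrow> t \<alpha>s vs = 0) \<and>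
     (\<forall>vs. multilinear r (\<lambda>\<alpha>s. t \<alpha>s vs)) \<and> (\<forall>\<alpha>s. multilinear s (t \<alpha>s))"

definition tensor_comp ::
    "('m, 'e::real_normed_vector) chart set \<Rightarrow> ('m, 'e) chart \<Rightarrow> ('m, 'e) tensor \<Rightarrow>
     'e \<Rightarrow> ('e \<Rightarrow>\<^sub>L real) list \<Rightarrow> 'e list \<Rightarrow> real" where
  "tensor_comp A c T x \<alpha>s vs =
     (let p = coord_inv c x in
      T p (map (\<lambda>\<alpha>. \<alpha> o\<^sub>L Blinfun (transition_deriv (chart_at A p) c p)) \<alpha>s)
          (map (transition_deriv c (chart_at A p) p) vs))"

definition tensor_field ::
    "('m, 'e::real_normed_vector) chart set \<Rightarrow> nat \<Rightarrow> nat \<Rightarrow> ('m, 'e) tensor \<Rightarrow> bool" where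
  "tensor_field A r s T \<longleftrightarrow> (\<forall>p. tensor_at r s (T p)) \<and>
     (\<forall>c\<in>A. \<forall>\<alpha>s vs. smooth_on (coord c ` chart_dom c) (\<lambda>x. tensor_comp A c T x \<alpha>s vs))"

definition smooth_tensor_family ::
    "('m, 'e::real_normed_vector) chart set \<Rightarrow> nat \<Rightarrow> nat \<Rightarrow>
     ('p::real_normed_vector \<Rightarrow> ('m, 'e) tensor) \<Rightarrow> bool" where
  "smooth_tensor_family A r s T \<longleftrightarrow> (\<forall>u p. tensor_at r s (T u p)) \<and>
     (\<forall>c\<in>A. \<forall>\<alpha>s vs. smooth_on (UNIV \<times> coord c ` chart_dom c)
        (\<lambda>(u, x). tensor_comp A c (T u) x \<alpha>s vs))"

text \<open>Pullback by a diffeomorphism: vectors are pushed forward by the tangent map, covectors by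
  composition with its inverse.\<close>

definition pullback ::
    "('m, 'e::real_normed_vector) chart set \<Rightarrow> ('m \<Rightarrow> 'm) \<Rightarrow> ('m, 'e) tensor \<Rightarrow> ('m, 'e) tensor"
  where
  "pullback A f T p \<alpha>s vs =
     T (f p) (map (\<lambda>\<alpha>. \<alpha> o\<^sub>L Blinfun (inv (tangent_map A f p))) \<alpha>s) (map (tangent_map A f p) vs)"

text \<open>Lie derivative, computed at \<open>p\<close> in the coordinates of the preferred chart at \<open>p\<close>, in which
  the Lie derivatives along \<open>X\<close> of a constant vector \<open>v\<close> and a constant covector \<open>\<alpha>\<close> are
  \<open>- DX v\<close> and \<open>\<alpha> \<circ> DX\<close>.\<close>

definition lie_deriv ::
    "('m, 'e::real_normed_vector) chart set \<Rightarrow> ('m, 'e) vfield \<Rightarrow> ('m, 'e) tensor \<Rightarrow>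
     ('m, 'e) tensor" where
  "lie_deriv A X T p \<alpha>s vs =
     (let c = chart_at A p; x = coord c p;
          DX = frechet_derivative (vfield_comp A c X) (at x)
      in frechet_derivative (\<lambda>y. tensor_comp A c T y \<alpha>s vs) (at x) (vfield_comp A c X x)
         - (\<Sum>i<length \<alpha>s. tensor_comp A c T x (\<alpha>s[i := \<alpha>s ! i o\<^sub>L Blinfun DX]) vs)
         + (\<Sum>i<length vs. tensor_comp A c T x \<alpha>s (vs[i := DX (vs ! i)])))"

definition alternating :: "(('e::real_normed_vector \<Rightarrow>\<^sub>L real) list \<Rightarrow> 'e list \<Rightarrow> real) \<Rightarrow> bool" where
  "alternating t \<longleftrightarrow> (\<forall>vs i j. i < j \<and> j < length vs \<and> vs ! i = vs ! j \<longrightarrow> t [] vs = 0)"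

definition exterior_deriv ::
    "('m, 'e::real_normed_vector) chart set \<Rightarrow> ('m, 'e) tensor \<Rightarrow> ('m, 'e) tensor" where
  "exterior_deriv A T p \<alpha>s vs =
     (let c = chart_at A p
      in \<Sum>i<length vs. (-1) ^ i *
           frechet_derivative (\<lambda>y. tensor_comp A c T y \<alpha>s (take i vs @ drop (Suc i) vs))
             (at (coord c p)) (vs ! i))"


section \<open>Nearly-periodic maps\<close>

text \<open>Actions of the circle group, the reals modulo \<open>2 \<pi>\<close>, are given as \<open>2 \<pi>\<close>-periodic
  actions of the reals, and elements of the circle group by real representatives.\<close>

definition circle_action ::
    "('m::topological_space, 'e::real_normed_vector) chart set \<Rightarrow> (real \<Rightarrow> 'm \<Rightarrow> 'm) \<Rightarrow> bool" where
  "circle_action A \<Phi> \<longleftrightarrow> smooth_map_family A \<Phi> \<and> \<Phi> 0 = id \<and>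
     (\<forall>\<theta> \<theta>'. \<Phi> (\<theta> + \<theta>') = \<Phi> \<theta> \<circ> \<Phi> \<theta>') \<and> \<Phi> (2 * pi) = id"

definition infinitesimal_generator ::
    "('m, 'e::real_normed_vector) chart set \<Rightarrow> (real \<Rightarrow> 'm \<Rightarrow> 'm) \<Rightarrow> ('m, 'e) vfield" where
  "infinitesimal_generator A \<Phi> p =
     vector_derivative (\<lambda>\<theta>. coord (chart_at A p) (\<Phi> \<theta> p)) (at 0)"

definition nearly_periodic_map ::
    "('m::topological_space, 'e::real_normed_vector) chart set \<Rightarrow>
     ('g::real_normed_vector \<Rightarrow> 'm \<Rightarrow> 'm) \<Rightarrow> (real \<Rightarrow> 'm \<Rightarrow> 'm) \<Rightarrow> real \<Rightarrow> bool" where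
  "nearly_periodic_map A F \<Phi> \<theta>0 \<longleftrightarrow> smooth_map_family A F \<and> (\<forall>\<gamma>. diffeomorphism A (F \<gamma>)) \<and>
     circle_action A \<Phi> \<and> F 0 = \<Phi> \<theta>0"

definition resonant :: "real \<Rightarrow> bool" where
  "resonant \<theta>0 \<longleftrightarrow> (\<exists>q\<in>\<rat>. \<theta>0 = 2 * pi * q)"


section \<open>Formal power series in the parameter\<close>

text \<open>A formal power series in \<open>\<gamma>\<close> is the sequence of its homogeneous terms, so that
  \<open>R n \<gamma>\<close> is the term of degree \<open>n\<close> of \<open>R\<close> evaluated at \<open>\<gamma>\<close>.\<close>

definition taylor_tensor ::
    "('g::real_normed_vector \<Rightarrow> ('m, 'e::real_normed_vector) tensor) \<Rightarrow> nat \<Rightarrow> 'g \<Rightarrow> ('m, 'e) tensor"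
  where
  "taylor_tensor T n \<gamma> p \<alpha>s vs = taylor_term n (\<lambda>\<delta>. T \<delta> p \<alpha>s vs) \<gamma>"

definition formal_lie_deriv ::
    "('m, 'e::real_normed_vector) chart set \<Rightarrow> (nat \<Rightarrow> 'g \<Rightarrow> ('m, 'e) vfield) \<Rightarrow>
     (nat \<Rightarrow> 'g \<Rightarrow> ('m, 'e) tensor) \<Rightarrow> nat \<Rightarrow> 'g \<Rightarrow> ('m, 'e) tensor" where
  "formal_lie_deriv A R T n \<gamma> p \<alpha>s vs = (\<Sum>i\<le>n. lie_deriv A (R i \<gamma>) (T (n - i) \<gamma>) p \<alpha>s vs)"

definition formal_pullback_vfield ::
    "('m, 'e::real_normed_vector) chart set \<Rightarrow> ('g::real_normed_vector \<Rightarrow> 'm \<Rightarrow> 'm) \<Rightarrow>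
     (nat \<Rightarrow> 'g \<Rightarrow> ('m, 'e) vfield) \<Rightarrow> nat \<Rightarrow> 'g \<Rightarrow> ('m, 'e) vfield" where
  "formal_pullback_vfield A F R n \<gamma> p =
     (\<Sum>i\<le>n. taylor_term i (\<lambda>\<delta>. pullback_vfield A (F \<delta>) (R (n - i) \<gamma>) p) \<gamma>)"

text \<open>Homogeneity is required pointwise; by polarisation the coefficients of these polynomials
  are then linear combinations of values of \<open>R n\<close>, hence vector fields.\<close>

definition formal_vfield ::
    "('m, 'e::real_normed_vector) chart set \<Rightarrow> (nat \<Rightarrow> 'g::real_normed_vector \<Rightarrow> ('m, 'e) vfield) \<Rightarrow>
     bool" where
  "formal_vfield A R \<longleftrightarrow>
     (\<forall>n \<gamma>. vector_field A (R n \<gamma>)) \<and> (\<forall>n p. homogeneous_poly n (\<lambda>\<gamma>. R n \<gamma> p))"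

text \<open>\<open>E \<theta>\<close> is the formal power series of operators \<open>exp (\<theta> L\<^sub>R)\<close>. Smoothness of
  \<open>(\<theta>, T) \<mapsto> E \<theta> n \<gamma> T\<close> is expressed by sending smooth curves of tensor fields to smooth
  families. Linear operators with this property commute with differentiation of curves, which is
  what makes the solution of the differential equation unique; the equation alone also has
  discontinuous solutions.\<close>

definition formal_pullback_flow ::
    "('m, 'e::real_normed_vector) chart set \<Rightarrow> (real \<Rightarrow> 'm \<Rightarrow> 'm) \<Rightarrow>
     (nat \<Rightarrow> 'g::real_normed_vector \<Rightarrow> ('m, 'e) vfield) \<Rightarrow>
     (real \<Rightarrow> nat \<Rightarrow> 'g \<Rightarrow> ('m, 'e) tensor \<Rightarrow> ('m, 'e) tensor) \<Rightarrow> bool" where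
  "formal_pullback_flow A \<Phi> R E \<longleftrightarrow> (\<forall>r s.
     (\<forall>\<theta> n \<gamma> T S a b. tensor_field A r s T \<and> tensor_field A r s S \<longrightarrow>
        E \<theta> n \<gamma> (\<lambda>p \<alpha>s vs. a * T p \<alpha>s vs + b * S p \<alpha>s vs) =
          (\<lambda>p \<alpha>s vs. a * E \<theta> n \<gamma> T p \<alpha>s vs + b * E \<theta> n \<gamma> S p \<alpha>s vs)) \<and>
     (\<forall>n \<gamma> (T :: real \<Rightarrow> ('m, 'e) tensor). smooth_tensor_family A r s T \<longrightarrow>
        smooth_tensor_family A r s (\<lambda>(\<theta>, u). E \<theta> n \<gamma> (T u))) \<and>
     (\<forall>T. tensor_field A r s T \<longrightarrow>
        (\<forall>\<theta> n \<gamma>. tensor_field A r s (E \<theta> n \<gamma> T)) \<and>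
        (\<forall>\<theta> n p \<alpha>s vs. homogeneous_poly n (\<lambda>\<gamma>. E \<theta> n \<gamma> T p \<alpha>s vs)) \<and>
        (\<forall>\<theta> \<gamma>. E \<theta> 0 \<gamma> T = pullback A (\<Phi> \<theta>) T) \<and>
        (\<forall>n \<gamma>. E 0 n \<gamma> T = (if n = 0 then T else (\<lambda>p \<alpha>s vs. 0))) \<and>
        (\<forall>\<theta> n \<gamma> p \<alpha>s vs. ((\<lambda>\<theta>. E \<theta> n \<gamma> T p \<alpha>s vs) has_real_derivative
           (\<Sum>i\<le>n. E \<theta> i \<gamma> (lie_deriv A (R (n - i) \<gamma>) T) p \<alpha>s vs)) (at \<theta>))))"

definition roto_rate ::
    "('m, 'e::real_normed_vector) chart set \<Rightarrow> ('g::real_normed_vector \<Rightarrow> 'm \<Rightarrow> 'm) \<Rightarrow>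
     (real \<Rightarrow> 'm \<Rightarrow> 'm) \<Rightarrow> (nat \<Rightarrow> 'g \<Rightarrow> ('m, 'e) vfield) \<Rightarrow> bool" where
  "roto_rate A F \<Phi> R \<longleftrightarrow> formal_vfield A R \<and>
     (\<forall>\<gamma>. R 0 \<gamma> = infinitesimal_generator A \<Phi>) \<and>
     formal_pullback_vfield A F R = R \<and>
     (\<exists>E. formal_pullback_flow A \<Phi> R E \<and>
        (\<forall>r s T n \<gamma>. tensor_field A r s T \<longrightarrow>
           E (2 * pi) n \<gamma> T = (if n = 0 then T else (\<lambda>p \<alpha>s vs. 0))))"


section \<open>Presymplectic structures\<close>

definition presymplectic_family ::
    "('m, 'e::real_normed_vector) chart set \<Rightarrow> ('g::real_normed_vector \<Rightarrow> ('m, 'e) tensor) \<Rightarrow> bool"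
  where
  "presymplectic_family A \<Omega> \<longleftrightarrow> smooth_tensor_family A 0 2 \<Omega> \<and> (\<forall>\<gamma> p. alternating (\<Omega> \<gamma> p)) \<and>
     (\<forall>\<gamma>. exterior_deriv A (\<Omega> \<gamma>) = (\<lambda>p \<alpha>s vs. 0))"

definition presymplectic_nearly_periodic_map ::
    "('m::topological_space, 'e::real_normed_vector) chart set \<Rightarrow>
     ('g::real_normed_vector \<Rightarrow> ('m, 'e) tensor) \<Rightarrow> ('g \<Rightarrow> 'm \<Rightarrow> 'm) \<Rightarrow> (real \<Rightarrow> 'm \<Rightarrow> 'm) \<Rightarrow>
     real \<Rightarrow> bool" where
  "presymplectic_nearly_periodic_map A \<Omega> F \<Phi> \<theta>0 \<longleftrightarrow> nearly_periodic_map A F \<Phi> \<theta>0 \<and>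
     (\<forall>\<gamma>. pullback A (F \<gamma>) (\<Omega> \<gamma>) = \<Omega> \<gamma>)"

end

theory Submission
  imports Defs
begin

text \<open>Fix \<open>\<gamma>\<close> and let \<open>\<alpha>\<^sub>n\<close> be the coefficients of \<open>L\<^sub>R \<Omega>\<close>; we show \<open>\<alpha>\<^sub>n = 0\<close> by strong induction on
  \<open>n\<close>. Since \<open>F\<close> preserves \<open>\<Omega>\<close> and \<open>R\<close>, it preserves the series \<open>L\<^sub>R \<Omega>\<close>, and comparing leading
  coefficients gives \<open>\<Phi>\<^sub>\<theta>\<^sub>0\<^sup>* \<alpha>\<^sub>n = \<alpha>\<^sub>n\<close>. As \<open>\<theta>0\<close> is not resonant, its multiples are dense in the circle,
  so \<open>\<Phi>\<^sub>\<theta>\<^sup>* \<alpha>\<^sub>n = \<alpha>\<^sub>n\<close> for every \<open>\<theta>\<close>. The degree-\<open>n\<close> term of \<open>exp (\<theta> L\<^sub>R) \<Omega>\<close> has \<open>\<theta>\<close>-derivative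
  equal to the degree-\<open>n\<close> term of \<open>exp (\<theta> L\<^sub>R) L\<^sub>R \<Omega>\<close>, which is \<open>\<Phi>\<^sub>\<theta>\<^sup>* \<alpha>\<^sub>n = \<alpha>\<^sub>n\<close>. Hence it grows by
  \<open>2 \<pi> \<alpha>\<^sub>n\<close> over one period; but \<open>exp (2 \<pi> L\<^sub>R) = 1\<close>, so \<open>\<alpha>\<^sub>n = 0\<close>.

  The comparison of coefficients takes place in charts along the line \<open>t \<mapsto> t \<gamma>\<close>, where formal identities
  become estimates up to \<open>o(t\<^sup>n)\<close>.\<close>

section \<open>Coordinates on finite-dimensional normed spaces\<close>

text \<open>The hypotheses are formal and pointwise: \<open>roto_rate\<close> compares Taylor
  coefficients of pulled-back vector fields at one point at a time, whereas a Lie derivative also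
  involves derivatives in space, and an o(t^n) bound cannot in general be differentiated. It can
  here because the defect is jointly smooth in (t, x): a bound at every x of an open set kills the
  Taylor coefficients as functions of x, hence their space derivatives as well. In place of a formal
  pullback of tensor series, the actual tensors \<open>\<Omega> (t *\<^sub>R \<gamma>)\<close> are
  pulled back by the actual maps; only the series R is truncated, at degree n, and its failure to be
  exactly invariant is that defect. The induction hypothesis serves twice. It strips the lower terms
  from the expansion of the Lie derivative, so that both sides reduce to t^n times one coefficient,
  and it removes all terms but one from the degree-n part of exp(theta L_R) L_R Omega. The
  continuity in theta that the density argument requires comes from the flow equation, since the
  degree-0 part of the flow is the pullback by the circle action.\<close>

lemma norm_insert_span_ge:
  fixes b :: "'a::real_normed_vector"
  assumes "closed (span B)" "b \<notin> span B"
  obtains d where "d > 0" "\<And>c s. s \<in> span B \<Longrightarrow> \<bar>c\<bar> * d \<le> norm (c *\<^sub>R b + s)"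
proof -
  \<comment> \<open>The distance from \<open>b\<close> to the span is positive because the span is
    closed; dividing by \<open>c\<close> turns it into a bound on the coefficient of
    \<open>b\<close>.\<close>
  let ?d = "infdist b (span B)"
  have "?d > 0"
    using assms infdist_pos_not_in_closed[of "span B" b] span_zero by fastforce
  moreover have "\<bar>c\<bar> * ?d \<le> norm (c *\<^sub>R b + s)" if s: "s \<in> span B" for c s
  proof (cases "c = 0")
    case False
    have "?d \<le> dist b (- (1 / c) *\<^sub>R s)"
      by (intro infdist_le span_scale s)
    then have "\<bar>c\<bar> * ?d \<le> \<bar>c\<bar> * norm (b + (1 / c) *\<^sub>R s)"
      by (simp add: dist_norm mult_left_mono)
    also have "\<dots> = norm (c *\<^sub>R (b + (1 / c) *\<^sub>R s))"
      by simp
    finally show ?thesis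
      using False by (simp add: scaleR_add_right)
  qed simp
  ultimately show thesis
    using that by blast
qed

text \<open>Induction on the spanning set: by \<open>norm_insert_span_ge\<close> the coefficients of
  the new vector along a convergent sequence form a Cauchy sequence of reals, so the limit splits in
  the same way as the terms.\<close>

lemma closed_span_finite:
  fixes B :: "'a::real_normed_vector set"
  assumes "finite B"
  shows "closed (span B)"
  using assms
proof (induction B rule: finite_induct)
  case empty
  then show ?case by simp
next
  case (insert b B)
  show ?case
  proof (cases "b \<in> span B")
    case True
    then show ?thesis using insert by (simp add: span_redundant)
  next
    case False
    obtain d where d: "d > 0" "\<And>c s. s \<in> span B \<Longrightarrow> \<bar>c\<bar> * d \<le> norm (c *\<^sub>R b + s)"
      using norm_insert_span_ge[OF insert.IH False] by blast
    show ?thesis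
      unfolding closed_sequential_limits
    proof (intro allI impI, elim conjE)
      fix x l
      assume x: "\<forall>n. x n \<in> span (insert b B)" and l: "x \<longlonglongrightarrow> l"
      obtain c where c: "\<And>n. x n - c n *\<^sub>R b \<in> span B"
      proof -
        have "\<exists>c. \<forall>n. x n - c n *\<^sub>R b \<in> span B"
          using x unfolding span_insert by (intro choice) auto
        then show thesis using that by blast
      qed
      have "Cauchy c"
      proof (rule metric_CauchyI)
        fix e :: real assume "e > 0"
        have "Cauchy x" using l by (rule LIMSEQ_imp_Cauchy)
        then obtain N where N: "\<And>m n. m \<ge> N \<Longrightarrow> n \<ge> N \<Longrightarrow> dist (x m) (x n) < e * d"
          using metric_CauchyD[of x "e * d"] \<open>e > 0\<close> d by (meson mult_pos_pos)
        have "dist (c m) (c n) < e" if "m \<ge> N" "n \<ge> N" for m n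
        proof -
          have "\<bar>c m - c n\<bar> * d \<le>
              norm ((c m - c n) *\<^sub>R b + ((x m - c m *\<^sub>R b) - (x n - c n *\<^sub>R b)))"
            by (intro d(2) span_diff c)
          also have "\<dots> = dist (x m) (x n)"
            by (simp add: dist_norm algebra_simps)
          also have "\<dots> < e * d" by (rule N[OF that])
          finally show ?thesis using d by (simp add: dist_real_def)
        qed
        then show "\<exists>M. \<forall>m\<ge>M. \<forall>n\<ge>M. dist (c m) (c n) < e" by blast
      qed
      then obtain k where "c \<longlonglongrightarrow> k" using Cauchy_convergent_iff convergent_def by blast
      with l have "(\<lambda>n. x n - c n *\<^sub>R b) \<longlonglongrightarrow> l - k *\<^sub>R b" by (intro tendsto_intros)
      then have "l - k *\<^sub>R b \<in> span B"
        using closed_sequentially[OF insert.IH, of "\<lambda>n. x n - c n *\<^sub>R b"] c by auto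
      then show "l \<in> span (insert b B)" unfolding span_insert by blast
    qed
  qed
qed

text \<open>The model and parameter spaces are normed spaces with a finite spanning set and no
  distinguished basis; this lemma supplies coordinates. Each coordinate functional is bounded
  because its basis vector has positive distance from the span of the others.\<close>

lemma finite_dim_coordinates:
  assumes "finite_dim (UNIV :: 'a::real_normed_vector set)"
  obtains B :: "'a::real_normed_vector set" and \<phi> :: "'a::real_normed_vector \<Rightarrow> 'a \<Rightarrow> real"
  where "finite B" "\<And>b. b \<in> B \<Longrightarrow> bounded_linear (\<phi> b)"
    "\<And>x. x = (\<Sum>b\<in>B. \<phi> b x *\<^sub>R b)"
proof -
  obtain B0 :: "'a set" where B0: "finite B0" "span B0 = UNIV"
    using assms unfolding finite_dim_def by blast
  obtain B where B: "B \<subseteq> B0" "independent B" "span B0 = span B"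
  proof -
    obtain B where "B \<subseteq> B0" "independent B" "B0 \<subseteq> span B"
      using maximal_independent_subset[of B0] by blast
    moreover from this have "span B0 = span B"
      by (simp add: span_mono span_minimal subset_antisym)
    ultimately show thesis using that by blast
  qed
  then have fin: "finite B" and sp: "span B = UNIV" using B0 finite_subset by auto
  let ?\<phi> = "\<lambda>b x. representation B x b"
  have rep: "x = (\<Sum>b\<in>B. ?\<phi> b x *\<^sub>R b)" for x
    using sum_representation_eq[OF B(2), of x B] fin sp by simp
  have "bounded_linear (?\<phi> b)" if b: "b \<in> B" for b
  proof -
    have nb: "b \<notin> span (B - {b})" using B(2) b dependent_def by blast
    obtain d where d: "d > 0"
      "\<And>c s. s \<in> span (B - {b}) \<Longrightarrow> \<bar>c\<bar> * d \<le> norm (c *\<^sub>R b + s)"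
      using norm_insert_span_ge[OF closed_span_finite nb] fin by auto
    have "\<bar>?\<phi> b x\<bar> \<le> norm x * (1 / d)" for x
    proof -
      have "\<bar>?\<phi> b x\<bar> * d \<le> norm (?\<phi> b x *\<^sub>R b + (\<Sum>a\<in>B - {b}. ?\<phi> a x *\<^sub>R a))"
        by (intro d(2) span_sum span_scale span_base) auto
      also have "\<dots> = norm x"
        using rep[of x] sum.remove[OF fin b, of "\<lambda>b. ?\<phi> b x *\<^sub>R b"] by simp
      finally show ?thesis using d(1) by (simp add: field_simps)
    qed
    then show ?thesis
      by (intro bounded_linear_intro[where K="1 / d"])
        (auto simp: representation_add representation_scale B(2) sp)
  qed
  then show thesis using that[of B ?\<phi>] fin rep by blast
qed

lemma finite_dim_prod:
  assumes "finite_dim (UNIV :: 'a::real_vector set)" "finite_dim (UNIV :: 'b::real_vector set)"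
  shows "finite_dim (UNIV :: ('a::real_vector \<times> 'b::real_vector) set)"
proof -
  obtain B :: "'a set" and C :: "'b set" where
    BC: "finite B" "span B = UNIV" "finite C" "span C = UNIV"
    using assms unfolding finite_dim_def by blast
  let ?S = "(\<lambda>b. (b, 0)) ` B \<union> (\<lambda>c. (0, c)) ` C :: ('a \<times> 'b) set"
  have "(x, 0) \<in> span ?S" for x
  proof -
    have "linear (\<lambda>x::'a. (x, 0::'b))" by (auto intro!: linearI)
    then have "(\<lambda>x. (x, 0)) ` span B = span ((\<lambda>b. (b, 0::'b)) ` B)" by (metis linear_span_image)
    then show ?thesis using BC(2) span_mono[of "(\<lambda>b. (b, 0)) ` B" ?S] by blast
  qed
  moreover have "(0, y) \<in> span ?S" for y
  proof -
    have "linear (\<lambda>y::'b. (0::'a, y))" by (auto intro!: linearI)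
    then have "(\<lambda>y. (0, y)) ` span C = span ((\<lambda>c. (0::'a, c)) ` C)" by (metis linear_span_image)
    then show ?thesis using BC(4) span_mono[of "(\<lambda>c. (0, c)) ` C" ?S] by blast
  qed
  ultimately have "z \<in> span ?S" for z
    using span_add[of "(fst z, 0)" ?S "(0, snd z)"] by simp
  then have "span ?S = UNIV" by blast
  moreover have "finite ?S" using BC by simp
  ultimately show ?thesis unfolding finite_dim_def by blast
qed

lemma finite_dim_real: "finite_dim (UNIV :: real set)"
  unfolding finite_dim_def
proof (intro exI conjI)
  show "span {1 :: real} = UNIV"
    by (auto simp: span_singleton)
qed auto

lemma bounded_linear_finite_dim:
  fixes L :: "'a::real_normed_vector \<Rightarrow> 'b::real_normed_vector"
  assumes "finite_dim (UNIV :: 'a set)" "linear L"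
  shows "bounded_linear L"
proof -
  obtain B :: "'a set" and \<phi> where B: "finite B" "\<And>b. b \<in> B \<Longrightarrow> bounded_linear (\<phi> b)"
    "\<And>x. x = (\<Sum>b\<in>B. \<phi> b x *\<^sub>R b)"
    using finite_dim_coordinates[OF assms(1)] by metis
  interpret linear L by fact
  have "L x = (\<Sum>b\<in>B. \<phi> b x *\<^sub>R L b)" for x
    by (subst B(3)[of x]) (simp add: sum scaleR)
  then have "L = (\<lambda>x. \<Sum>b\<in>B. \<phi> b x *\<^sub>R L b)"
    by blast
  moreover have "bounded_linear (\<lambda>x. \<Sum>b\<in>B. \<phi> b x *\<^sub>R L b)"
    by (intro bounded_linear_sum bounded_linear_scaleR_const B(2))
  ultimately show ?thesis by simp
qed

section \<open>Smooth maps\<close>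

abbreviation fd :: "('a::real_normed_vector \<Rightarrow> 'b::real_normed_vector) \<Rightarrow> 'a \<Rightarrow> 'a \<Rightarrow> 'b" where
  "fd f x \<equiv> frechet_derivative f (at x)"

lemma has_derivative_fd: "f differentiable (at x) \<Longrightarrow> (f has_derivative fd f x) (at x)"
  by (simp add: frechet_derivative_works)

lemma bounded_linear_fd: "f differentiable (at x) \<Longrightarrow> bounded_linear (fd f x)"
  using has_derivative_bounded_linear has_derivative_fd by blast

lemma linear_fd: "f differentiable (at x) \<Longrightarrow> linear (fd f x)"
  by (simp add: linear_frechet_derivative)

lemma fd_eqI: "(f has_derivative f') (at x) \<Longrightarrow> fd f x = f'"
  using frechet_derivative_at by metis

lemma differentiable_cong_open:
  assumes "open S" "x \<in> S" "\<And>y. y \<in> S \<Longrightarrow> f y = g y" "f differentiable (at x)"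
  shows "g differentiable (at x)" "fd g x = fd f x"
proof -
  have "(g has_derivative fd f x) (at x)"
    using has_derivative_transform_within_open[OF has_derivative_fd] assms by blast
  then show "g differentiable (at x)" "fd g x = fd f x"
    by (auto simp: differentiable_def fd_eqI)
qed

lemma fd_chain:
  assumes "f differentiable (at (g x))" "g differentiable (at x)"
  shows "((\<lambda>x. f (g x)) has_derivative (\<lambda>v. fd f (g x) (fd g x v))) (at x)"
  using has_derivative_compose[OF has_derivative_fd[OF assms(2)] has_derivative_fd[OF assms(1)]] .

section \<open>Closure properties of finite differentiability classes\<close>

lemma Ck_on_cong:
  assumes "open S" "\<And>x. x \<in> S \<Longrightarrow> f x = g x" "Ck_on k S f"
  shows "Ck_on k S g"
  using assms
proof (induction k arbitrary: f g)
  case 0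
  then show ?case by (auto cong: continuous_on_cong)
next
  case (Suc k)
  have "fd g x v = fd f x v" "g differentiable (at x)" if "x \<in> S" for x v
    using differentiable_cong_open[of S x f g] Suc.prems that by auto
  then show ?case
    using Suc.prems Suc.IH[of "\<lambda>x. fd f x v" "\<lambda>x. fd g x v" for v] by auto
qed

lemma Ck_on_SucD: "Ck_on (Suc k) S f \<Longrightarrow> Ck_on k S f"
proof (induction k arbitrary: f)
  case 0
  then show ?case
    by (auto intro!: differentiable_imp_continuous_on
        simp: differentiable_on_def differentiable_at_withinI)
next
  case (Suc k)
  then show ?case by (metis Ck_on.simps(2))
qed

lemma Ck_on_const: "Ck_on k S (\<lambda>x. c)"
  by (induction k arbitrary: c) auto

lemma Ck_on_bounded_linear:
  assumes "bounded_linear L" "open S"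
  shows "Ck_on k S f \<Longrightarrow> Ck_on k S (\<lambda>x. L (f x))"
proof (induction k arbitrary: f)
  case 0
  then show ?case
    using assms(1) by (auto intro: bounded_linear.continuous_on)
next
  case (Suc k)
  have D: "((\<lambda>x. L (f x)) has_derivative (\<lambda>v. L (fd f x v))) (at x)" if "x \<in> S" for x
    using bounded_linear.has_derivative[OF assms(1) has_derivative_fd] Suc.prems that by auto
  have "Ck_on k S (\<lambda>x. fd (\<lambda>x. L (f x)) x v)" for v
    by (rule Ck_on_cong[OF assms(2) _ Suc.IH[of "\<lambda>x. fd f x v"]])
      (use Suc.prems in \<open>auto simp: fd_eqI[OF D]\<close>)
  then show ?case using D by (auto simp: differentiable_def)
qed

lemma Ck_on_add:
  assumes "open S"
  shows "Ck_on k S f \<Longrightarrow> Ck_on k S g \<Longrightarrow> Ck_on k S (\<lambda>x. f x + g x)"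
proof (induction k arbitrary: f g)
  case 0
  then show ?case by (auto intro: continuous_on_add)
next
  case (Suc k)
  have D: "((\<lambda>x. f x + g x) has_derivative (\<lambda>v. fd f x v + fd g x v)) (at x)" if "x \<in> S" for x
    using Suc.prems that by (auto intro!: has_derivative_add has_derivative_fd)
  have "Ck_on k S (\<lambda>x. fd (\<lambda>x. f x + g x) x v)" for v
    by (rule Ck_on_cong[OF assms _ Suc.IH[of "\<lambda>x. fd f x v" "\<lambda>x. fd g x v"]])
      (use Suc.prems in \<open>auto simp: fd_eqI[OF D]\<close>)
  then show ?case using D by (auto simp: differentiable_def)
qed

lemma Ck_on_sum:
  assumes "open S" "\<And>i. i \<in> I \<Longrightarrow> Ck_on k S (f i)"
  shows "Ck_on k S (\<lambda>x. \<Sum>i\<in>I. f i x)"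
  using assms(2)
  by (induction I rule: infinite_finite_induct) (auto intro: Ck_on_const Ck_on_add[OF assms(1)])

lemma Ck_on_scaleR:
  assumes "open S"
  shows "Ck_on k S a \<Longrightarrow> Ck_on k S f \<Longrightarrow> Ck_on k S (\<lambda>x. a x *\<^sub>R f x)"
proof (induction k arbitrary: a f)
  case 0
  then show ?case by (auto intro: continuous_on_scaleR)
next
  case (Suc k)
  have D: "((\<lambda>x. a x *\<^sub>R f x) has_derivative (\<lambda>v. a x *\<^sub>R fd f x v + fd a x v *\<^sub>R f x)) (at x)"
    if "x \<in> S" for x
    using Suc.prems that by (auto intro!: has_derivative_scaleR has_derivative_fd)
  have "Ck_on k S (\<lambda>x. fd (\<lambda>x. a x *\<^sub>R f x) x v)" for v
    by (rule Ck_on_cong[OF assms _ Ck_on_add[OF assms Suc.IH[of a "\<lambda>x. fd f x v"]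
            Suc.IH[of "\<lambda>x. fd a x v" f]]])
      (use Suc.prems Ck_on_SucD[OF Suc.prems(1)] Ck_on_SucD[OF Suc.prems(2)] in
        \<open>auto simp: fd_eqI[OF D]\<close>)
  then show ?case using D by (auto simp: differentiable_def)
qed

text \<open>The chain rule produces the derivative of \<open>f\<close> in the direction
  \<open>fd g x v\<close>, which moves with \<open>x\<close>, while the induction hypothesis only
  covers fixed directions. Expanding the direction in coordinates leaves sums of products of
  functions that it does cover; this is where finite dimension of the middle space enters.\<close>

lemma Ck_on_compose:
  fixes f :: "'b::real_normed_vector \<Rightarrow> 'c::real_normed_vector"
    and g :: "'a::real_normed_vector \<Rightarrow> 'b"
  assumes fin: "finite_dim (UNIV :: 'b set)" and "open S" "open T" "g ` S \<subseteq> T"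
  shows "Ck_on k T f \<Longrightarrow> Ck_on k S g \<Longrightarrow> Ck_on k S (\<lambda>x. f (g x))"
proof (induction k arbitrary: f)
  case 0
  then show ?case using assms(4) by (auto intro: continuous_on_compose2)
next
  case (Suc k)
  obtain B :: "'b set" and \<phi> where B: "finite B" "\<And>b. b \<in> B \<Longrightarrow> bounded_linear (\<phi> b)"
    "\<And>x. x = (\<Sum>b\<in>B. \<phi> b x *\<^sub>R b)"
    using finite_dim_coordinates[OF fin] by metis
  have gT: "g x \<in> T" if "x \<in> S" for x using assms(4) that by auto
  have D: "((\<lambda>x. f (g x)) has_derivative (\<lambda>v. fd f (g x) (fd g x v))) (at x)" if "x \<in> S" for x
    using Suc.prems that gT[OF that] by (auto intro!: fd_chain)
  have E: "fd f (g x) w = (\<Sum>b\<in>B. \<phi> b w *\<^sub>R fd f (g x) b)" if "x \<in> S" for x w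
  proof -
    interpret linear "fd f (g x)"
      using Suc.prems gT[OF that] by (auto intro!: linear_fd)
    show ?thesis by (subst B(3)[of w]) (simp add: sum scaleR)
  qed
  have "Ck_on k S (\<lambda>x. \<phi> b (fd g x v))" if "b \<in> B" for b v
    by (rule Ck_on_bounded_linear[OF B(2)[OF that] \<open>open S\<close>]) (use Suc.prems in simp)
  moreover have "Ck_on k S (\<lambda>x. fd f (g x) b)" for b
    by (rule Suc.IH) (use Suc.prems Ck_on_SucD[OF Suc.prems(2)] in simp_all)
  ultimately have "Ck_on k S (\<lambda>x. \<Sum>b\<in>B. \<phi> b (fd g x v) *\<^sub>R fd f (g x) b)" for v
    by (intro Ck_on_sum Ck_on_scaleR \<open>open S\<close>)
  then have "Ck_on k S (\<lambda>x. fd (\<lambda>x. f (g x)) x v)" for v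
    by (rule Ck_on_cong[OF \<open>open S\<close>, rotated]) (auto simp: fd_eqI[OF D] E)
  then show ?case using D by (auto simp: differentiable_def)
qed

section \<open>The same closure properties for smooth maps\<close>

lemma smooth_on_cong:
  "open S \<Longrightarrow> (\<And>x. x \<in> S \<Longrightarrow> f x = g x) \<Longrightarrow> smooth_on S f \<Longrightarrow> smooth_on S g"
  by (auto simp: smooth_on_def intro: Ck_on_cong)

lemma smooth_on_imp_continuous_on: "smooth_on S f \<Longrightarrow> continuous_on S f"
  unfolding smooth_on_def by (metis Ck_on.simps(1))

lemma smooth_on_imp_differentiable: "smooth_on S f \<Longrightarrow> x \<in> S \<Longrightarrow> f differentiable (at x)"
  unfolding smooth_on_def by (metis Ck_on.simps(2))

lemma smooth_on_fd: "smooth_on S f \<Longrightarrow> smooth_on S (\<lambda>x. fd f x v)"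
  unfolding smooth_on_def by (metis Ck_on.simps(2))

lemma smooth_on_const: "smooth_on S (\<lambda>x. c)"
  by (auto simp: smooth_on_def intro: Ck_on_const)

lemma smooth_on_bounded_linear:
  "bounded_linear L \<Longrightarrow> open S \<Longrightarrow> smooth_on S f \<Longrightarrow> smooth_on S (\<lambda>x. L (f x))"
  by (auto simp: smooth_on_def intro: Ck_on_bounded_linear)

lemma smooth_on_add:
  "open S \<Longrightarrow> smooth_on S f \<Longrightarrow> smooth_on S g \<Longrightarrow> smooth_on S (\<lambda>x. f x + g x)"
  by (auto simp: smooth_on_def intro: Ck_on_add)

lemma smooth_on_sum:
  "open S \<Longrightarrow> (\<And>i. i \<in> I \<Longrightarrow> smooth_on S (f i)) \<Longrightarrow> smooth_on S (\<lambda>x. \<Sum>i\<in>I. f i x)"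
  by (auto simp: smooth_on_def intro: Ck_on_sum)

lemma smooth_on_scaleR:
  "open S \<Longrightarrow> smooth_on S a \<Longrightarrow> smooth_on S f \<Longrightarrow> smooth_on S (\<lambda>x. a x *\<^sub>R f x)"
  by (auto simp: smooth_on_def intro: Ck_on_scaleR)

lemma smooth_on_compose:
  fixes f :: "'b::real_normed_vector \<Rightarrow> 'c::real_normed_vector"
    and g :: "'a::real_normed_vector \<Rightarrow> 'b"
  assumes "finite_dim (UNIV :: 'b set)" "smooth_on T f" "smooth_on S g" "open S" "open T"
    "\<And>x. x \<in> S \<Longrightarrow> g x \<in> T"
  shows "smooth_on S (\<lambda>x. f (g x))"
  using assms Ck_on_compose[of S T g _ f] unfolding smooth_on_def by blast

lemma smooth_on_id: "smooth_on S (\<lambda>x. x)"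
proof -
  have "Ck_on k S (\<lambda>x. x)" for k by (cases k) (auto intro: Ck_on_const)
  then show ?thesis by (simp add: smooth_on_def)
qed

lemma smooth_on_linear: "bounded_linear L \<Longrightarrow> open S \<Longrightarrow> smooth_on S L"
  using smooth_on_bounded_linear[OF _ _ smooth_on_id] by blast

lemma smooth_on_Pair:
  assumes "open S" "smooth_on S f" "smooth_on S g"
  shows "smooth_on S (\<lambda>x. (f x, g x))"
proof -
  have "bounded_linear (\<lambda>y::'b. (y, 0::'c))" "bounded_linear (\<lambda>y::'c. (0::'b, y))"
    by (auto intro: bounded_linear_Pair bounded_linear_ident bounded_linear_zero)
  then have "smooth_on S (\<lambda>x. (f x, 0) + (0, g x))"
    using assms by (intro smooth_on_add smooth_on_bounded_linear[of "\<lambda>y. (y, 0)"]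
        smooth_on_bounded_linear[of "\<lambda>y. (0, y)"])
  then show ?thesis by simp
qed

lemma smooth_on_fst: "open S \<Longrightarrow> smooth_on S f \<Longrightarrow> smooth_on S (\<lambda>x. fst (f x))"
  by (rule smooth_on_bounded_linear[OF bounded_linear_fst])

lemma smooth_on_snd: "open S \<Longrightarrow> smooth_on S f \<Longrightarrow> smooth_on S (\<lambda>x. snd (f x))"
  by (rule smooth_on_bounded_linear[OF bounded_linear_snd])

lemma smooth_on_uminus: "open S \<Longrightarrow> smooth_on S f \<Longrightarrow> smooth_on S (\<lambda>x. - f x)"
  by (rule smooth_on_bounded_linear[OF bounded_linear_minus[OF bounded_linear_ident]])

lemma smooth_on_diff:
  "open S \<Longrightarrow> smooth_on S f \<Longrightarrow> smooth_on S g \<Longrightarrow> smooth_on S (\<lambda>x. f x - g x)"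
  using smooth_on_add[OF _ _ smooth_on_uminus, of S f g] by simp

lemma smooth_on_power:
  fixes a :: "'a::real_normed_vector \<Rightarrow> real"
  shows "open S \<Longrightarrow> smooth_on S a \<Longrightarrow> smooth_on S (\<lambda>x. a x ^ i)"
proof (induction i)
  case (Suc i)
  then show ?case using smooth_on_scaleR[of S a "\<lambda>x. a x ^ i"] by simp
qed (simp add: smooth_on_const)

text \<open>Smoothness is assumed for each fixed vector only. Linearity lets a moving vector be
  expanded in a basis, so that just the values on basis vectors occur.\<close>

lemma smooth_on_parametric_linear:
  fixes B :: "'a::real_normed_vector \<Rightarrow> 'b::real_normed_vector \<Rightarrow> 'c::real_normed_vector"
  assumes fin: "finite_dim (UNIV :: 'b set)" and "open S"
    and lin: "\<And>x. x \<in> S \<Longrightarrow> linear (B x)" and sm: "\<And>v. smooth_on S (\<lambda>x. B x v)"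
    and y: "smooth_on S y"
  shows "smooth_on S (\<lambda>x. B x (y x))"
proof -
  obtain C :: "'b set" and \<phi> where C: "finite C" "\<And>b. b \<in> C \<Longrightarrow> bounded_linear (\<phi> b)"
    "\<And>x. x = (\<Sum>b\<in>C. \<phi> b x *\<^sub>R b)"
    using finite_dim_coordinates[OF fin] by metis
  have "B x w = (\<Sum>b\<in>C. \<phi> b w *\<^sub>R B x b)" if "x \<in> S" for x w
  proof -
    interpret linear "B x" using lin that .
    show ?thesis by (subst C(3)[of w]) (simp add: sum scaleR)
  qed
  then have eq: "(\<Sum>b\<in>C. \<phi> b (y x) *\<^sub>R B x b) = B x (y x)" if "x \<in> S" for x
    using that by simp
  have "smooth_on S (\<lambda>x. \<phi> b (y x))" if "b \<in> C" for b
    by (rule smooth_on_bounded_linear[OF C(2)[OF that] \<open>open S\<close> y])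
  then have "smooth_on S (\<lambda>x. \<Sum>b\<in>C. \<phi> b (y x) *\<^sub>R B x b)"
    by (intro smooth_on_sum smooth_on_scaleR \<open>open S\<close> sm)
  then show ?thesis by (rule smooth_on_cong[OF \<open>open S\<close> eq, rotated])
qed

lemma smooth_on_fd_apply:
  fixes f :: "'a::real_normed_vector \<Rightarrow> 'b::real_normed_vector"
  assumes "finite_dim (UNIV :: 'a set)" "open S" "open T" "smooth_on T f"
    "smooth_on S g" "smooth_on S y" "\<And>x. x \<in> S \<Longrightarrow> g x \<in> T"
  shows "smooth_on S (\<lambda>x. fd f (g x) (y x))"
proof (rule smooth_on_parametric_linear[where B="\<lambda>x. fd f (g x)" and y=y])
  show "linear (fd f (g x))" if "x \<in> S" for x
    by (rule linear_fd[OF smooth_on_imp_differentiable[OF assms(4) assms(7)[OF that]]])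
  show "smooth_on S (\<lambda>x. fd f (g x) v)" for v
    by (rule smooth_on_compose[OF assms(1) smooth_on_fd[OF assms(4)] assms(5,2,3,7)])
qed (fact assms)+

section \<open>Inverses of smooth families of linear maps\<close>

text \<open>Pointwise convergence of linear maps is convergence in operator norm in finite
  dimension: it suffices to control the finitely many basis vectors.\<close>

lemma linear_family_near:
  fixes A :: "'u \<Rightarrow> 'a::real_normed_vector \<Rightarrow> 'b::real_normed_vector"
  assumes fin: "finite_dim (UNIV :: 'a set)"
    and lin: "\<forall>\<^sub>F u in G. linear (A u)" "linear L"
    and lim: "\<And>v. ((\<lambda>u. A u v) \<longlongrightarrow> L v) G" and "e > 0"
  shows "\<forall>\<^sub>F u in G. \<forall>w. norm (A u w - L w) \<le> e * norm w"
proof -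
  obtain B :: "'a set" and \<phi> where B: "finite B" "\<And>b. b \<in> B \<Longrightarrow> bounded_linear (\<phi> b)"
    "\<And>x. x = (\<Sum>b\<in>B. \<phi> b x *\<^sub>R b)"
    using finite_dim_coordinates[OF fin] by metis
  have "((\<lambda>u. \<Sum>b\<in>B. onorm (\<phi> b) * norm (A u b - L b)) \<longlongrightarrow> (\<Sum>b\<in>B. onorm (\<phi> b) * norm (L b - L b))) G"
    by (intro tendsto_intros lim)
  then have "\<forall>\<^sub>F u in G. (\<Sum>b\<in>B. onorm (\<phi> b) * norm (A u b - L b)) < e"
    using \<open>e > 0\<close> by (intro order_tendstoD(2)) auto
  with lin(1) show ?thesis
  proof eventually_elim
    case (elim u)
    have "norm (A u w - L w) \<le> e * norm w" for w
    proof -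
      have "A u w - L w = (\<Sum>b\<in>B. \<phi> b w *\<^sub>R (A u b - L b))"
      proof -
        have "A u w = (\<Sum>b\<in>B. \<phi> b w *\<^sub>R A u b)"
          by (subst B(3)[of w]) (simp add: linear_sum[OF elim(1)] linear_scale[OF elim(1)])
        moreover have "L w = (\<Sum>b\<in>B. \<phi> b w *\<^sub>R L b)"
          by (subst B(3)[of w]) (simp add: linear_sum[OF lin(2)] linear_scale[OF lin(2)])
        ultimately show ?thesis by (simp add: sum_subtractf scaleR_diff_right)
      qed
      also have "norm \<dots> \<le> (\<Sum>b\<in>B. onorm (\<phi> b) * norm w * norm (A u b - L b))"
      proof (intro sum_norm_le)
        fix b assume "b \<in> B"
        then show "norm (\<phi> b w *\<^sub>R (A u b - L b)) \<le> onorm (\<phi> b) * norm w * norm (A u b - L b)"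
          using onorm[OF B(2), of b w] by (simp add: mult_right_mono)
      qed
      also have "\<dots> = (\<Sum>b\<in>B. onorm (\<phi> b) * norm (A u b - L b)) * norm w"
        by (simp add: sum_distrib_right sum_distrib_left mult_ac)
      also have "\<dots> \<le> e * norm w"
        using elim(2) by (intro mult_right_mono) auto
      finally show ?thesis .
    qed
    then show ?case by blast
  qed
qed

text \<open>This is the formula d(A^-1) = - A^-1 (dA) A^-1. Freezing \<open>w = B u0 v\<close> gives
  \<open>B u v - B u0 v = - B u (A u w - A u0 w)\<close>, which reduces the claim to a bound on
  \<open>B u\<close> uniform near \<open>u0\<close> and to the derivative of \<open>A\<close> at one
  fixed vector.\<close>

lemma has_derivative_inverse_family:
  fixes A B :: "'u::real_normed_vector \<Rightarrow> 'a::real_normed_vector \<Rightarrow> 'a"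
  assumes fin: "finite_dim (UNIV :: 'a set)" and S: "open S" "u0 \<in> S"
    and lin: "\<And>u. u \<in> S \<Longrightarrow> linear (A u)" "\<And>u. u \<in> S \<Longrightarrow> linear (B u)"
    and AB: "\<And>u x. u \<in> S \<Longrightarrow> A u (B u x) = x" and BA: "\<And>u x. u \<in> S \<Longrightarrow> B u (A u x) = x"
    and diff: "\<And>v. (\<lambda>u. A u v) differentiable (at u0)"
  shows "((\<lambda>u. B u v) has_derivative (\<lambda>h. - B u0 (fd (\<lambda>u. A u (B u0 v)) u0 h))) (at u0)"
proof -
  define w where "w = B u0 v"
  define D where "D = fd (\<lambda>u. A u w) u0"
  have blB: "bounded_linear (B u0)" using bounded_linear_finite_dim[OF fin] lin S by blast
  have blD: "bounded_linear D" unfolding D_def by (rule bounded_linear_fd[OF diff])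
  obtain K where K: "K > 0" "\<And>x. norm (B u0 x) \<le> norm x * K"
    using bounded_linear.pos_bounded[OF blB] by blast
  obtain M where M: "M > 0" "\<And>x. norm (D x) \<le> norm x * M"
    using bounded_linear.pos_bounded[OF blD] by blast
  have cont: "((\<lambda>u. A u x) \<longlongrightarrow> A u0 x) (nhds u0)" for x
    using differentiable_imp_continuous_within[OF diff] isCont_def
      continuous_within tendsto_at_iff_tendsto_nhds by blast
  have evS: "\<forall>\<^sub>F u in nhds u0. u \<in> S" using S by (simp add: eventually_nhds_in_open)
  then have evlin: "\<forall>\<^sub>F u in nhds u0. linear (A u)"
    by eventually_elim (rule lin)
  have near: "\<forall>\<^sub>F u in nhds u0. \<forall>x. norm (A u x - A u0 x) \<le> e * norm x" if "e > 0" for e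
    by (rule linear_family_near[OF fin evlin lin(1)[OF S(2)] cont that])
  have D: "((\<lambda>u. A u w) has_derivative D) (at u0)"
    unfolding D_def by (rule has_derivative_fd[OF diff])
  have "\<forall>\<^sub>F u in nhds u0. norm (B u v - B u0 v - (- B u0 (D (u - u0)))) \<le> e * norm (u - u0)"
    if "e > 0" for e
  proof -
    \<comment> \<open>\<open>e2\<close> bounds the differentiation error of \<open>A u w\<close>;
      after an application of \<open>B u0\<close> it costs \<open>K * e2\<close>, at most half of
      \<open>e\<close>, and the cap 1 yields the factor \<open>M + 1\<close> below.
      \<open>e1\<close> bounds the operator distance of \<open>A u\<close> from \<open>A u0\<close>:
      its first entry gives \<open>norm (B u x) \<le> 2 * K * norm x\<close>, its second makes the
      replacement of \<open>B u\<close> by \<open>B u0\<close> cost the other half of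
      \<open>e\<close>.\<close>
    define e2 where "e2 = min 1 (e / (2 * K))"
    define e1 where "e1 = min (1 / (2 * K)) (e / (4 * K * K * (M + 1)))"
    have e2: "e2 > 0" "e2 \<le> 1" "K * e2 \<le> e / 2" and e1: "e1 > 0" "K * e1 \<le> 1 / 2"
      "2 * K * e1 * K * (M + 1) \<le> e / 2"
    proof -
      show "e2 > 0" "e2 \<le> 1" "e1 > 0" using \<open>e > 0\<close> K M by (auto simp: e1_def e2_def)
      have "e2 \<le> e / (2 * K)" by (simp add: e2_def)
      then show "K * e2 \<le> e / 2" using K(1) by (simp add: field_simps)
      have "e1 \<le> 1 / (2 * K)" by (simp add: e1_def)
      then show "K * e1 \<le> 1 / 2" using K(1) by (simp add: field_simps)
      have p: "4 * K * K * (M + 1) > 0" using K M by simp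
      have "e1 \<le> e / (4 * K * K * (M + 1))" by (simp add: e1_def)
      then have "e1 * (4 * K * K * (M + 1)) \<le> e" by (simp only: pos_le_divide_eq[OF p])
      then show "2 * K * e1 * K * (M + 1) \<le> e / 2" by (simp add: algebra_simps)
    qed
    have "\<forall>\<^sub>F u in nhds u0. norm (A u w - A u0 w - D (u - u0)) \<le> e2 * norm (u - u0)"
      using D e2(1) unfolding has_derivative_at_alt eventually_nhds_metric dist_norm
      by blast
    with near[OF e1(1)] evS show ?thesis
    proof eventually_elim
      case (elim u)
      define g where "g = A u w - A u0 w"
      define r where "r = g - D (u - u0)"
      have r: "norm r \<le> e2 * norm (u - u0)" using elim by (simp add: r_def g_def)
      have g: "norm g \<le> (M + 1) * norm (u - u0)"
      proof -
        have "norm g \<le> norm r + norm (D (u - u0))"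
          unfolding r_def by (metis add.commute norm_triangle_sub)
        also have "\<dots> \<le> 1 * norm (u - u0) + norm (u - u0) * M"
          using r e2(2) M(2)[of "u - u0"] mult_right_mono[OF e2(2), of "norm (u - u0)"] by auto
        finally show ?thesis by (simp add: algebra_simps)
      qed
      have Bu: "norm (B u x) \<le> 2 * K * norm x" for x
      proof -
        have "norm (B u x) = norm (B u0 (A u0 (B u x)))" using BA S by simp
        also have "\<dots> \<le> norm (A u0 (B u x)) * K" by (rule K)
        also have "\<dots> \<le> (norm (A u (B u x)) + e1 * norm (B u x)) * K"
          using K elim(1)[rule_format, of "B u x"]
          by (intro mult_right_mono)
            (auto simp: norm_minus_commute intro: order_trans[OF norm_triangle_sub[of _ "A u (B u x)"]])
        also have "\<dots> = norm x * K + (K * e1) * norm (B u x)"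
          using AB elim by (simp add: algebra_simps)
        \<comment> \<open>The unknown norm reappears with factor at most 1/2 and is absorbed into
          the left-hand side.\<close>
        also have "\<dots> \<le> norm x * K + 1 / 2 * norm (B u x)"
          using e1 by (intro add_left_mono mult_right_mono) auto
        finally show ?thesis by (simp add: algebra_simps)
      qed
      have "A u0 w = v" using AB S by (simp add: w_def)
      then have a: "B u v - B u0 v = - B u g"
        using BA elim by (simp add: g_def w_def[symmetric] linear_diff[OF lin(2)])
      have b: "B u0 g - B u g = B u (A u (B u0 g) - A u0 (B u0 g))"
        using BA AB S elim by (simp add: linear_diff[OF lin(2)])
      have c: "B u0 g = B u0 r + B u0 (D (u - u0))"
        using linear_add[OF lin(2)[OF S(2)], of r "D (u - u0)"] by (simp add: r_def)
      have "B u v - B u0 v - (- B u0 (D (u - u0))) = B u0 g - B u g - B u0 r"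
        unfolding a c by simp
      then have "norm (B u v - B u0 v - (- B u0 (D (u - u0)))) =
          norm (B u (A u (B u0 g) - A u0 (B u0 g)) - B u0 r)"
        by (simp only: b)
      also have "\<dots> \<le> 2 * K * (e1 * (K * ((M + 1) * norm (u - u0)))) + K * (e2 * norm (u - u0))"
      proof (rule order_trans[OF norm_triangle_ineq4 add_mono])
        have "norm (B u (A u (B u0 g) - A u0 (B u0 g))) \<le> 2 * K * (e1 * norm (B u0 g))"
          using elim(1)[rule_format, of "B u0 g"] K
          by (intro order_trans[OF Bu] mult_left_mono) auto
        also have "norm (B u0 g) \<le> K * ((M + 1) * norm (u - u0))"
          using K(2)[of g] g K(1) by (simp add: mult.commute order_trans mult_left_mono)
        finally show "norm (B u (A u (B u0 g) - A u0 (B u0 g))) \<le>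
            2 * K * (e1 * (K * ((M + 1) * norm (u - u0))))"
          using K e1 by (simp add: mult_left_mono)
        show "norm (B u0 r) \<le> K * (e2 * norm (u - u0))"
          using K(2)[of r] r K(1) by (metis mult.commute mult_left_mono order_less_imp_le order_trans)
      qed
      also have "\<dots> = (2 * K * e1 * K * (M + 1)) * norm (u - u0) + (K * e2) * norm (u - u0)"
        by (simp add: algebra_simps)
      also have "\<dots> \<le> e / 2 * norm (u - u0) + e / 2 * norm (u - u0)"
        using e1 e2 by (intro add_mono mult_right_mono) auto
      finally show ?case by simp
    qed
  qed
  moreover have "bounded_linear (\<lambda>h. - B u0 (D h))"
    by (intro bounded_linear_minus bounded_linear_compose[OF blB blD])
  ultimately show ?thesis
    unfolding has_derivative_at_alt w_def[symmetric] D_def[symmetric]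
      eventually_nhds_metric dist_norm by blast
qed

text \<open>A bootstrap: the derivative of \<open>B\<close> is an expression in \<open>B\<close> and
  the derivatives of \<open>A\<close>, so class C^k for \<open>B\<close> gives class
  C^(k+1).\<close>

lemma smooth_on_inverse_family:
  fixes A B :: "'u::real_normed_vector \<Rightarrow> 'a::real_normed_vector \<Rightarrow> 'a"
  assumes fin: "finite_dim (UNIV :: 'a set)" and S: "open S"
    and lin: "\<And>u. u \<in> S \<Longrightarrow> linear (A u)" "\<And>u. u \<in> S \<Longrightarrow> linear (B u)"
    and AB: "\<And>u x. u \<in> S \<Longrightarrow> A u (B u x) = x" and BA: "\<And>u x. u \<in> S \<Longrightarrow> B u (A u x) = x"
    and sm: "\<And>v. smooth_on S (\<lambda>u. A u v)"
  shows "smooth_on S (\<lambda>u. B u v)"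
proof -
  obtain C :: "'a set" and \<phi> where C: "finite C" "\<And>b. b \<in> C \<Longrightarrow> bounded_linear (\<phi> b)"
    "\<And>x. x = (\<Sum>b\<in>C. \<phi> b x *\<^sub>R b)"
    using finite_dim_coordinates[OF fin] by metis
  have lin_coord: "L w = (\<Sum>b\<in>C. \<phi> b w *\<^sub>R L b)" if "linear L" for L :: "'a \<Rightarrow> 'a" and w
    by (subst C(3)[of w]) (simp add: linear_sum[OF that] linear_scale[OF that])
  have D: "((\<lambda>u. B u v) has_derivative (\<lambda>h. - B u0 (fd (\<lambda>u. A u (B u0 v)) u0 h))) (at u0)"
    if "u0 \<in> S" for u0 v
    by (rule has_derivative_inverse_family[OF fin S that lin AB BA smooth_on_imp_differentiable[OF sm that]])
  have fdA: "fd (\<lambda>u. A u w) u0 h = (\<Sum>a\<in>C. \<phi> a w *\<^sub>R fd (\<lambda>u. A u a) u0 h)" if "u0 \<in> S" for u0 w h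
  proof -
    have "((\<lambda>u. \<Sum>a\<in>C. \<phi> a w *\<^sub>R A u a) has_derivative
        (\<lambda>h. \<Sum>a\<in>C. \<phi> a w *\<^sub>R fd (\<lambda>u. A u a) u0 h)) (at u0)"
      by (intro has_derivative_sum has_derivative_scaleR_right has_derivative_fd
          smooth_on_imp_differentiable[OF sm that])
    then have "((\<lambda>u. A u w) has_derivative (\<lambda>h. \<Sum>a\<in>C. \<phi> a w *\<^sub>R fd (\<lambda>u. A u a) u0 h)) (at u0)"
      by (rule has_derivative_transform_within_open[OF _ S that])
        (rule lin_coord[OF lin(1), symmetric])
    then show ?thesis by (simp add: fd_eqI)
  qed
  have "Ck_on k S (\<lambda>u. B u v)" for k v
  proof (induction k arbitrary: v)
    case 0
    show ?case
      unfolding Ck_on.simps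
      by (rule differentiable_imp_continuous_on)
        (auto simp: differentiable_on_def differentiable_def intro: D has_derivative_at_withinI)
  next
    case (Suc k)
    \<comment> \<open>\<open>B\<close> occurs inside the derivative of \<open>A\<close> and again
      outside it; each occurrence is expanded in coordinates, so that only \<open>B\<close> and
      \<open>fd\<close> of \<open>A\<close> at fixed vectors remain.\<close>
    have eq: "- (\<Sum>b\<in>C. \<phi> b (\<Sum>a\<in>C. \<phi> a (B u v) *\<^sub>R fd (\<lambda>u. A u a) u h) *\<^sub>R B u b) =
        fd (\<lambda>u. B u v) u h" if "u \<in> S" for u h
    proof -
      have "fd (\<lambda>u. B u v) u h = - B u (fd (\<lambda>u'. A u' (B u v)) u h)"
        by (simp only: fd_eqI[OF D[OF that, of v]])
      then show ?thesis
        using lin_coord[OF lin(2)[OF that], of "fd (\<lambda>u'. A u' (B u v)) u h"]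
        unfolding fdA[OF that, of "B u v" h] by metis
    qed
    have 1: "Ck_on k S (\<lambda>u. \<phi> a (B u v))" if "a \<in> C" for a
      by (rule Ck_on_bounded_linear[OF C(2)[OF that] S Suc.IH])
    have 2: "Ck_on k S (\<lambda>u. fd (\<lambda>u. A u a) u h)" for a h
      using smooth_on_fd[OF sm] by (auto simp: smooth_on_def)
    have 3: "Ck_on k S (\<lambda>u. \<Sum>a\<in>C. \<phi> a (B u v) *\<^sub>R fd (\<lambda>u. A u a) u h)" for h
      by (intro Ck_on_sum[OF S] Ck_on_scaleR[OF S] 1 2)
    have 4: "Ck_on k S (\<lambda>u. \<phi> b (\<Sum>a\<in>C. \<phi> a (B u v) *\<^sub>R fd (\<lambda>u. A u a) u h))"
      if "b \<in> C" for b h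
      by (rule Ck_on_bounded_linear[OF C(2)[OF that] S 3])
    have "Ck_on k S (\<lambda>u. \<Sum>b\<in>C. \<phi> b (\<Sum>a\<in>C. \<phi> a (B u v) *\<^sub>R fd (\<lambda>u. A u a) u h) *\<^sub>R B u b)" for h
      by (intro Ck_on_sum[OF S] Ck_on_scaleR[OF S] 4 Suc.IH)
    then have "Ck_on k S (\<lambda>u. - (\<Sum>b\<in>C. \<phi> b (\<Sum>a\<in>C. \<phi> a (B u v) *\<^sub>R fd (\<lambda>u. A u a) u h) *\<^sub>R B u b))" for h
      by (rule Ck_on_bounded_linear[OF bounded_linear_minus[OF bounded_linear_ident] S])
    then have "Ck_on k S (\<lambda>u. fd (\<lambda>u. B u v) u h)" for h
      by (rule Ck_on_cong[OF S eq, rotated])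
    then show ?case using D by (auto simp: differentiable_def)
  qed
  then show ?thesis by (simp add: smooth_on_def)
qed

section \<open>Symmetry of second derivatives\<close>

lemma vector_derivative_bound:
  fixes k :: "real \<Rightarrow> 'b::real_normed_vector"
  assumes "\<And>s. s \<in> closed_segment a b \<Longrightarrow> (k has_vector_derivative k' s) (at s)"
    and "\<And>s. s \<in> closed_segment a b \<Longrightarrow> norm (k' s) \<le> C"
  shows "norm (k b - k a) \<le> C * \<bar>b - a\<bar>"
proof -
  have "norm (k b - k a) \<le> C * norm (b - a)"
  proof (rule differentiable_bound[of "closed_segment a b"])
    show "(k has_derivative (\<lambda>h. h *\<^sub>R k' s)) (at s within closed_segment a b)"
      if "s \<in> closed_segment a b" for s
      using assms(1)[OF that] by (auto simp: has_vector_derivative_def intro: has_derivative_at_withinI)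
    show "onorm (\<lambda>h. h *\<^sub>R k' s) \<le> C" if "s \<in> closed_segment a b" for s
      using assms(2)[OF that] by (intro onorm_le) (simp, metis abs_ge_zero mult.commute mult_right_mono)
  qed auto
  then show ?thesis by simp
qed

lemma has_vector_derivative_line:
  assumes "f differentiable (at (x + s *\<^sub>R u))"
  shows "((\<lambda>s. f (x + s *\<^sub>R u)) has_vector_derivative fd f (x + s *\<^sub>R u) u) (at s)"
proof -
  have "((\<lambda>s. x + s *\<^sub>R u) has_derivative (\<lambda>h. h *\<^sub>R u)) (at s)"
    by (auto intro!: derivative_eq_intros)
  from has_derivative_compose[OF this has_derivative_fd[OF assms]]
  show ?thesis
    by (simp add: has_vector_derivative_def linear_scale[OF linear_fd[OF assms]])
qed

text \<open>The mean value inequality is applied twice, along \<open>u\<close> to the difference of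
  two parallel segments and along \<open>v\<close> to the derivative in direction \<open>u\<close>.
  One-sided limits suffice for the comparison in \<open>fd_commute\<close>.\<close>

lemma second_difference_bound:
  fixes f :: "'a::real_normed_vector \<Rightarrow> 'b::real_normed_vector"
  assumes "open S" "smooth_on S f" "z \<in> S" "e > 0"
  shows "\<forall>\<^sub>F t in at_right 0. norm (f (z + t *\<^sub>R u + t *\<^sub>R v) - f (z + t *\<^sub>R u) - f (z + t *\<^sub>R v) + f z
    - (t * t) *\<^sub>R fd (\<lambda>x. fd f x u) z v) \<le> e * (t * t)"
proof -
  define g where "g = (\<lambda>x. fd f x u)"
  define h where "h = (\<lambda>x. fd g x v)"
  have sm: "smooth_on S g" "smooth_on S h"
    using assms by (auto simp: g_def h_def intro!: smooth_on_fd)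
  have "isCont h z"
    using smooth_on_imp_continuous_on[OF sm(2)] assms by (simp add: continuous_on_eq_continuous_at)
  then obtain r1 where r1: "r1 > 0" "\<And>x. dist x z < r1 \<Longrightarrow> dist (h x) (h z) < e"
    using \<open>e > 0\<close> unfolding continuous_at_eps_delta by blast
  obtain r2 where r2: "r2 > 0" "ball z r2 \<subseteq> S" using assms open_contains_ball by blast
  define r where "r = min r1 r2"
  define d where "d = r / (norm u + norm v + 1)"
  have uv: "norm u + norm v + 1 > 0" by (simp add: add_nonneg_pos)
  have d: "d > 0" using r1(1) r2(1) uv by (simp add: d_def r_def)
  have near: "dist (z + s *\<^sub>R u + q *\<^sub>R v) z < r"
    if "0 \<le> s" "s \<le> t" "0 \<le> q" "q \<le> t" "t < d" "0 < t" for s q t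
  proof -
    have "norm (s *\<^sub>R u + q *\<^sub>R v) \<le> s * norm u + q * norm v"
      using norm_triangle_ineq[of "s *\<^sub>R u" "q *\<^sub>R v"] that by simp
    also have "\<dots> \<le> t * norm u + t * norm v"
      using that by (intro add_mono mult_right_mono) auto
    also have "\<dots> < t * (norm u + norm v + 1)" using that by (simp add: algebra_simps)
    also have "\<dots> \<le> d * (norm u + norm v + 1)"
      using that by (intro mult_right_mono) auto
    also have "\<dots> = r" using uv by (simp add: d_def)
    finally show ?thesis by (simp add: dist_norm add.assoc)
  qed
  have nearS: "x \<in> S" "norm (h x - h z) \<le> e" if "dist x z < r" for x
    using r1(2)[of x] r2 that by (auto simp: r_def dist_norm subset_iff mem_ball norm_minus_commute)
  have "norm (f (z + t *\<^sub>R u + t *\<^sub>R v) - f (z + t *\<^sub>R u) - f (z + t *\<^sub>R v) + f z - (t * t) *\<^sub>R h z)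
      \<le> e * (t * t)" if t: "0 < t" "t < d" for t
  proof -
    have inner: "norm (g (z + s *\<^sub>R u + t *\<^sub>R v) - g (z + s *\<^sub>R u) - t *\<^sub>R h z) \<le> e * t"
      if s: "0 \<le> s" "s \<le> t" for s
    proof -
      have "norm ((g (z + s *\<^sub>R u + t *\<^sub>R v) - t *\<^sub>R h z) - (g (z + s *\<^sub>R u + 0 *\<^sub>R v) - 0 *\<^sub>R h z))
          \<le> e * \<bar>t - 0\<bar>"
      proof (rule vector_derivative_bound)
        fix q assume "q \<in> closed_segment 0 t"
        then have q: "0 \<le> q" "q \<le> t" using t by (auto simp: closed_segment_eq_real_ivl)
        note n = nearS[OF near[OF s q t(2,1)]]
        show "((\<lambda>q. g (z + s *\<^sub>R u + q *\<^sub>R v) - q *\<^sub>R h z) has_vector_derivative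
            h (z + s *\<^sub>R u + q *\<^sub>R v) - h z) (at q)"
          unfolding h_def
          by (auto intro!: derivative_eq_intros has_vector_derivative_line
              smooth_on_imp_differentiable[OF sm(1)] n)
        show "norm (h (z + s *\<^sub>R u + q *\<^sub>R v) - h z) \<le> e" by (rule n)
      qed
      then show ?thesis using t by (simp add: algebra_simps)
    qed
    have "norm ((f (z + t *\<^sub>R v + t *\<^sub>R u) - f (z + t *\<^sub>R u) - t *\<^sub>R t *\<^sub>R h z) -
        (f (z + t *\<^sub>R v + 0 *\<^sub>R u) - f (z + 0 *\<^sub>R u) - 0 *\<^sub>R t *\<^sub>R h z)) \<le> (e * t) * \<bar>t - 0\<bar>"
    proof (rule vector_derivative_bound)
      fix s assume "s \<in> closed_segment 0 t"
      then have s: "0 \<le> s" "s \<le> t" using t by (auto simp: closed_segment_eq_real_ivl)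
      have n1: "z + t *\<^sub>R v + s *\<^sub>R u \<in> S"
        using nearS(1)[OF near[OF s _ _ t(2,1), of t]] t by (simp add: add_ac)
      have n2: "z + s *\<^sub>R u \<in> S"
        using nearS(1)[OF near[OF s _ _ t(2,1), of 0]] t by simp
      show "((\<lambda>s. f (z + t *\<^sub>R v + s *\<^sub>R u) - f (z + s *\<^sub>R u) - s *\<^sub>R t *\<^sub>R h z) has_vector_derivative
          g (z + t *\<^sub>R v + s *\<^sub>R u) - g (z + s *\<^sub>R u) - t *\<^sub>R h z) (at s)"
        unfolding g_def
        by (auto intro!: derivative_eq_intros has_vector_derivative_line
            smooth_on_imp_differentiable[OF assms(2)] n1 n2)
      show "norm (g (z + t *\<^sub>R v + s *\<^sub>R u) - g (z + s *\<^sub>R u) - t *\<^sub>R h z) \<le> e * t"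
        using inner[OF s] by (simp add: add_ac)
    qed
    moreover have "f (z + t *\<^sub>R v + t *\<^sub>R u) - f (z + t *\<^sub>R u) - t *\<^sub>R t *\<^sub>R h z -
        (f (z + t *\<^sub>R v + 0 *\<^sub>R u) - f (z + 0 *\<^sub>R u) - 0 *\<^sub>R t *\<^sub>R h z) =
        f (z + t *\<^sub>R u + t *\<^sub>R v) - f (z + t *\<^sub>R u) - f (z + t *\<^sub>R v) + f z - (t * t) *\<^sub>R h z"
      by (simp add: add_ac algebra_simps)
    ultimately show ?thesis using t by (simp add: algebra_simps)
  qed
  then show ?thesis
    using d unfolding h_def g_def eventually_at_right_field by auto
qed

text \<open>The second difference is symmetric in \<open>u\<close> and \<open>v\<close>, so both
  mixed derivatives approximate it. The symmetry is used to exchange time and space derivatives and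
  to cancel the second-derivative terms in the naturality of the Lie derivative.\<close>

lemma fd_commute:
  fixes f :: "'a::real_normed_vector \<Rightarrow> 'b::real_normed_vector"
  assumes "open S" "smooth_on S f" "z \<in> S"
  shows "fd (\<lambda>x. fd f x u) z v = fd (\<lambda>x. fd f x v) z u"
proof -
  let ?H = "fd (\<lambda>x. fd f x u) z v" and ?H' = "fd (\<lambda>x. fd f x v) z u"
  have "norm (?H - ?H') \<le> e" if "e > 0" for e
  proof -
    have "e / 2 > 0" using that by simp
    note ev = second_difference_bound[OF assms this]
    have "\<forall>\<^sub>F t::real in at_right 0. norm (?H - ?H') \<le> e"
      using ev[of u v] ev[of v u] eventually_at_right_less[of "0::real"]
    proof eventually_elim
      case (elim t)
      let ?d = "f (z + t *\<^sub>R u + t *\<^sub>R v) - f (z + t *\<^sub>R u) - f (z + t *\<^sub>R v) + f z"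
      have *: "?d = f (z + t *\<^sub>R v + t *\<^sub>R u) - f (z + t *\<^sub>R v) - f (z + t *\<^sub>R u) + f z"
        by (simp add: algebra_simps)
      have "(t * t) * norm (?H - ?H') = norm ((?d - (t * t) *\<^sub>R ?H') - (?d - (t * t) *\<^sub>R ?H))"
        by (simp add: scaleR_diff_right[symmetric] norm_minus_commute)
      also have "\<dots> \<le> e / 2 * (t * t) + e / 2 * (t * t)"
        using elim(1,2) unfolding *[symmetric]
        by (intro order_trans[OF norm_triangle_ineq4 add_mono])
      also have "\<dots> = (t * t) * e" by simp
      finally show ?case using elim(3) by (simp add: mult_le_cancel_left)
    qed
    then show ?thesis by (simp add: eventually_const_iff trivial_limit_at_right_real)
  qed
  then have "norm (?H - ?H') \<le> 0" by (metis field_le_epsilon add_0)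
  then show ?thesis by simp
qed

section \<open>Taylor expansion in the parameter\<close>

text \<open>The size \<open>\<tau>\<close> and the filter are kept separate so that one notion
  covers both estimates for t tending to 0 at a fixed point (filter \<open>at 0\<close>) and
  estimates uniform in nearby points (filter \<open>nhds (0, z0)\<close> with
  \<open>\<tau> = fst\<close>). The uniform ones may be evaluated along moving points by
  \<open>small_o_compose\<close>.\<close>

definition small_o :: "nat \<Rightarrow> ('w \<Rightarrow> real) \<Rightarrow> 'w filter \<Rightarrow> ('w \<Rightarrow> 'b::real_normed_vector) \<Rightarrow> bool" where
  "small_o n \<tau> G h \<longleftrightarrow> (\<forall>e>0. \<forall>\<^sub>F w in G. norm (h w) \<le> e * \<bar>\<tau> w\<bar> ^ n)"

lemma small_oD: "small_o n \<tau> G h \<Longrightarrow> e > 0 \<Longrightarrow> \<forall>\<^sub>F w in G. norm (h w) \<le> e * \<bar>\<tau> w\<bar> ^ n"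
  by (simp add: small_o_def)

section \<open>Arithmetic of remainders\<close>

lemma small_o_cong:
  assumes "small_o n \<tau> G h" "\<forall>\<^sub>F w in G. h w = k w"
  shows "small_o n \<tau> G k"
  unfolding small_o_def
proof (intro allI impI)
  fix e :: real assume "e > 0"
  from small_oD[OF assms(1) this] assms(2)
  show "\<forall>\<^sub>F w in G. norm (k w) \<le> e * \<bar>\<tau> w\<bar> ^ n" by eventually_elim simp
qed

lemma small_o_zero: "small_o n \<tau> G (\<lambda>w. 0)"
  by (simp add: small_o_def)

lemma small_o_bound:
  assumes "small_o n \<tau> G h" "\<forall>\<^sub>F w in G. norm (k w) \<le> K * norm (h w)"
  shows "small_o n \<tau> G k"
  unfolding small_o_def
proof (intro allI impI)
  fix e :: real assume "e > 0"
  then have "e / (\<bar>K\<bar> + 1) > 0" by simp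
  from small_oD[OF assms(1) this] assms(2)
  show "\<forall>\<^sub>F w in G. norm (k w) \<le> e * \<bar>\<tau> w\<bar> ^ n"
  proof eventually_elim
    case (elim w)
    have "norm (k w) \<le> (\<bar>K\<bar> + 1) * norm (h w)"
      using elim(2) by (intro order_trans[OF elim(2)] mult_right_mono) auto
    also have "\<dots> \<le> (\<bar>K\<bar> + 1) * (e / (\<bar>K\<bar> + 1) * \<bar>\<tau> w\<bar> ^ n)"
      using elim(1) by (intro mult_left_mono) auto
    also have "\<dots> = e * \<bar>\<tau> w\<bar> ^ n"
    proof -
      have "\<bar>K\<bar> + 1 \<noteq> 0" by linarith
      then show ?thesis by simp
    qed
    finally show ?case .
  qed
qed

lemma small_o_add:
  assumes "small_o n \<tau> G h" "small_o n \<tau> G k"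
  shows "small_o n \<tau> G (\<lambda>w. h w + k w)"
  unfolding small_o_def
proof (intro allI impI)
  fix e :: real assume "e > 0"
  then have "e / 2 > 0" by simp
  from small_oD[OF assms(1) this] small_oD[OF assms(2) this]
  show "\<forall>\<^sub>F w in G. norm (h w + k w) \<le> e * \<bar>\<tau> w\<bar> ^ n"
  proof eventually_elim
    case (elim w)
    show ?case using norm_triangle_ineq[of "h w" "k w"] elim by simp
  qed
qed

lemma small_o_sum:
  assumes "\<And>i. i \<in> I \<Longrightarrow> small_o n \<tau> G (h i)"
  shows "small_o n \<tau> G (\<lambda>w. \<Sum>i\<in>I. h i w)"
  using assms by (induction I rule: infinite_finite_induct) (auto intro: small_o_zero small_o_add)

lemma small_o_uminus: "small_o n \<tau> G h \<Longrightarrow> small_o n \<tau> G (\<lambda>w. - h w)"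
  by (simp add: small_o_def)

lemma small_o_diff:
  "small_o n \<tau> G h \<Longrightarrow> small_o n \<tau> G k \<Longrightarrow> small_o n \<tau> G (\<lambda>w. h w - k w)"
  using small_o_add[OF _ small_o_uminus, of n \<tau> G h k] by simp

lemma small_o_bounded_linear:
  assumes "bounded_linear L" "small_o n \<tau> G h"
  shows "small_o n \<tau> G (\<lambda>w. L (h w))"
proof -
  obtain K where "\<And>x. norm (L x) \<le> norm x * K"
    using bounded_linear.bounded[OF assms(1)] by blast
  then show ?thesis
    by (intro small_o_bound[OF assms(2), of _ K]) (simp add: mult.commute)
qed

lemma small_o_power:
  assumes "small_o n \<tau> G h"
  shows "small_o (i + n) \<tau> G (\<lambda>w. \<tau> w ^ i *\<^sub>R h w)"
  unfolding small_o_def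
proof (intro allI impI)
  fix e :: real assume "e > 0"
  from small_oD[OF assms(1) this]
  show "\<forall>\<^sub>F w in G. norm (\<tau> w ^ i *\<^sub>R h w) \<le> e * \<bar>\<tau> w\<bar> ^ (i + n)"
  proof eventually_elim
    case (elim w)
    have "norm (\<tau> w ^ i *\<^sub>R h w) = \<bar>\<tau> w\<bar> ^ i * norm (h w)" by (simp add: power_abs)
    also have "\<dots> \<le> \<bar>\<tau> w\<bar> ^ i * (e * \<bar>\<tau> w\<bar> ^ n)" using elim by (intro mult_left_mono) auto
    finally show ?case by (simp add: power_add mult_ac)
  qed
qed

lemma small_o_compose:
  assumes "small_o n \<tau> G h" "filterlim g G G'"
  shows "small_o n (\<lambda>w. \<tau> (g w)) G' (\<lambda>w. h (g w))"
  using assms unfolding small_o_def filterlim_iff by blast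

lemma small_o_SucD:
  assumes "small_o (Suc n) \<tau> G h" "(\<tau> \<longlongrightarrow> 0) G"
  shows "small_o n \<tau> G h"
  unfolding small_o_def
proof (intro allI impI)
  fix e :: real assume "e > 0"
  have "\<forall>\<^sub>F w in G. \<bar>\<tau> w\<bar> < 1" using tendstoD[OF assms(2), of 1] by simp
  with small_oD[OF assms(1) \<open>e > 0\<close>]
  show "\<forall>\<^sub>F w in G. norm (h w) \<le> e * \<bar>\<tau> w\<bar> ^ n"
  proof eventually_elim
    case (elim w)
    have "\<bar>\<tau> w\<bar> ^ Suc n \<le> \<bar>\<tau> w\<bar> ^ n" using elim by (intro power_decreasing) auto
    then show ?case using elim \<open>e > 0\<close> by (meson mult_left_mono less_imp_le order_trans)
  qed
qed

text \<open>Division by t^n on a punctured neighbourhood. The coefficient may vary with t because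
  the transported leading coefficient is later evaluated at a moving point.\<close>

lemma small_o_power_imp_zero:
  assumes "small_o n (\<lambda>t. t) (at 0) (\<lambda>t. t ^ n *\<^sub>R c t)" "(c \<longlongrightarrow> l) (at (0::real))"
  shows "l = 0"
proof -
  have "(c \<longlongrightarrow> 0) (at 0)"
    unfolding tendsto_iff
  proof (intro allI impI)
    fix e :: real assume "e > 0"
    then have "e / 2 > 0" by simp
    have "\<forall>\<^sub>F t in at (0::real). t \<noteq> 0" by (simp add: eventually_at_filter)
    with small_oD[OF assms(1) \<open>e / 2 > 0\<close>] show "\<forall>\<^sub>F t in at 0. dist (c t) 0 < e"
    proof eventually_elim
      case (elim t)
      then have "\<bar>t\<bar> ^ n * norm (c t) \<le> \<bar>t\<bar> ^ n * (e / 2)" "\<bar>t\<bar> ^ n > 0"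
        by (auto simp: power_abs mult_ac)
      then show ?case using \<open>e > 0\<close> by (simp add: mult_le_cancel_left_pos)
    qed
  qed
  then show ?thesis using tendsto_unique assms(2) by (metis trivial_limit_at)
qed

text \<open>Uniqueness of Taylor coefficients: the top term is itself negligible at the next lower
  order, so induction clears all the others, and then the top coefficient.\<close>

lemma small_o_polynomial_imp_zero:
  assumes "small_o n (\<lambda>t. t) (at (0::real)) (\<lambda>t. \<Sum>k\<le>n. t ^ k *\<^sub>R a k)" "k \<le> n"
  shows "a k = 0"
  using assms
proof (induction n arbitrary: k)
  case 0
  then show ?case using small_o_power_imp_zero[of 0 "\<lambda>t. a 0" "a 0"] by simp
next
  case (Suc n)
  have lim: "((\<lambda>t::real. t) \<longlongrightarrow> 0) (at 0)" by (rule tendsto_ident_at)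
  have "small_o n (\<lambda>t. t) (at (0::real)) (\<lambda>t. t ^ Suc n *\<^sub>R a (Suc n))"
  proof -
    have "small_o 0 (\<lambda>t. t) (at (0::real)) (\<lambda>t. t *\<^sub>R a (Suc n))"
      unfolding small_o_def
    proof (intro allI impI)
      fix e :: real assume "e > 0"
      have "((\<lambda>t. t *\<^sub>R a (Suc n)) \<longlongrightarrow> 0 *\<^sub>R a (Suc n)) (at 0)" by (intro tendsto_intros)
      from tendstoD[OF this \<open>e > 0\<close>]
      show "\<forall>\<^sub>F t in at 0. norm (t *\<^sub>R a (Suc n)) \<le> e * \<bar>t\<bar> ^ 0"
        by eventually_elim simp
    qed
    from small_o_power[OF this, of n] show ?thesis by (simp add: mult.commute)
  qed
  from small_o_diff[OF small_o_SucD[OF Suc.prems(1) lim] this]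
  have "small_o n (\<lambda>t. t) (at (0::real)) (\<lambda>t. \<Sum>k\<le>n. t ^ k *\<^sub>R a k)" by simp
  then have *: "a k = 0" if "k \<le> n" for k using Suc.IH that by blast
  then have "small_o (Suc n) (\<lambda>t. t) (at (0::real)) (\<lambda>t. t ^ Suc n *\<^sub>R a (Suc n))"
    using Suc.prems(1) by simp
  then have "a (Suc n) = 0" by (rule small_o_power_imp_zero) (rule tendsto_const)
  with * Suc.prems(2) show ?case by (metis le_Suc_eq)
qed

text \<open>The Cauchy product with remainders. The prefactor of degree i already supplies i orders,
  hence \<open>Q i\<close> is expanded only to order \<open>n - i\<close>. The coefficients may
  depend on \<open>w\<close>, as they do for expansions uniform in the point.\<close>

lemma small_o_triangle:
  assumes "\<And>i. i \<le> n \<Longrightarrow>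
    small_o (n - i) \<tau> G (\<lambda>w. Q i w - (\<Sum>k\<le>n - i. \<tau> w ^ k *\<^sub>R q i k w))"
  shows "small_o n \<tau> G (\<lambda>w. (\<Sum>i\<le>n. \<tau> w ^ i *\<^sub>R Q i w) -
    (\<Sum>m\<le>n. \<tau> w ^ m *\<^sub>R (\<Sum>i\<le>m. q i (m - i) w)))"
proof -
  have "small_o n \<tau> G (\<lambda>w. \<tau> w ^ i *\<^sub>R (Q i w - (\<Sum>k\<le>n - i. \<tau> w ^ k *\<^sub>R q i k w)))"
    if "i \<in> {..n}" for i
    using small_o_power[OF assms, of i i] that by simp
  then have "small_o n \<tau> G (\<lambda>w. \<Sum>i\<le>n. \<tau> w ^ i *\<^sub>R (Q i w - (\<Sum>k\<le>n - i. \<tau> w ^ k *\<^sub>R q i k w)))"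
    by (rule small_o_sum)
  moreover have "(\<Sum>i\<le>n. \<tau> w ^ i *\<^sub>R (Q i w - (\<Sum>k\<le>n - i. \<tau> w ^ k *\<^sub>R q i k w))) =
      (\<Sum>i\<le>n. \<tau> w ^ i *\<^sub>R Q i w) - (\<Sum>m\<le>n. \<tau> w ^ m *\<^sub>R (\<Sum>i\<le>m. q i (m - i) w))" for w
  proof -
    have "(\<Sum>i\<le>n. \<tau> w ^ i *\<^sub>R (\<Sum>k\<le>n - i. \<tau> w ^ k *\<^sub>R q i k w)) =
        (\<Sum>i\<le>n. \<Sum>k\<le>n - i. \<tau> w ^ (i + k) *\<^sub>R q i k w)"
      by (simp add: scaleR_sum_right power_add)
    also have "\<dots> = (\<Sum>(i, k)\<in>{(i, k). i + k \<le> n}. \<tau> w ^ (i + k) *\<^sub>R q i k w)"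
    proof -
      have "(\<Sum>i\<le>n. \<Sum>k\<le>n - i. \<tau> w ^ (i + k) *\<^sub>R q i k w) =
          (\<Sum>(i, k)\<in>Sigma {..n} (\<lambda>i. {..n - i}). \<tau> w ^ (i + k) *\<^sub>R q i k w)"
        by (simp add: sum.Sigma)
      also have "Sigma {..n} (\<lambda>i. {..n - i}) = {(i, k). i + k \<le> n}" by auto
      finally show ?thesis .
    qed
    also have "\<dots> = (\<Sum>m\<le>n. \<Sum>i\<le>m. \<tau> w ^ (i + (m - i)) *\<^sub>R q i (m - i) w)"
      by (rule sum.triangle_reindex_eq)
    also have "\<dots> = (\<Sum>m\<le>n. \<tau> w ^ m *\<^sub>R (\<Sum>i\<le>m. q i (m - i) w))"
      by (simp add: scaleR_sum_right)
    finally show ?thesis by (simp add: scaleR_diff_right sum_subtractf)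
  qed
  ultimately show ?thesis by simp
qed

text \<open>Near \<open>a0\<close> the derivatives of \<open>T\<close> lie within operator distance
  1 of the one at \<open>a0\<close>, so they are uniformly bounded and preserve the order of the
  remainder.\<close>

lemma small_o_fd:
  fixes T :: "'a::real_normed_vector \<Rightarrow> 'b::real_normed_vector"
  assumes fin: "finite_dim (UNIV :: 'a set)" and "open S" "smooth_on S T" "a0 \<in> S"
    and g: "filterlim g (nhds a0) G" and "small_o n \<tau> G \<omega>"
  shows "small_o n \<tau> G (\<lambda>w. fd T (g w) (\<omega> w))"
proof -
  have dif: "T differentiable (at a)" if "a \<in> S" for a
    using smooth_on_imp_differentiable[OF assms(3) that] .
  have "\<forall>\<^sub>F a in nhds a0. a \<in> S" using assms by (simp add: eventually_nhds_in_open)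
  then have "\<forall>\<^sub>F a in nhds a0. linear (fd T a)" by eventually_elim (rule linear_fd[OF dif])
  moreover have "((\<lambda>a. fd T a v) \<longlongrightarrow> fd T a0 v) (nhds a0)" for v
    using smooth_on_imp_continuous_on[OF smooth_on_fd[OF assms(3)]] assms(2,4)
    by (metis continuous_on_eq_continuous_at isCont_def tendsto_at_iff_tendsto_nhds)
  ultimately have "\<forall>\<^sub>F a in nhds a0. \<forall>w. norm (fd T a w - fd T a0 w) \<le> 1 * norm w"
    by (intro linear_family_near[OF fin] linear_fd[OF dif[OF assms(4)]]) auto
  then have "\<forall>\<^sub>F w in G. \<forall>v. norm (fd T (g w) v - fd T a0 v) \<le> 1 * norm v"
    using g by (rule eventually_compose_filterlim)
  then have "\<forall>\<^sub>F w in G. norm (fd T (g w) (\<omega> w)) \<le> (1 + onorm (fd T a0)) * norm (\<omega> w)"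
  proof eventually_elim
    case (elim w)
    show ?case
      using norm_triangle_sub[of "fd T (g w) (\<omega> w)" "fd T a0 (\<omega> w)"] elim[rule_format, of "\<omega> w"]
        onorm[OF bounded_linear_fd[OF dif[OF assms(4)]], of "\<omega> w"]
      by (simp add: algebra_simps)
  qed
  then show ?thesis by (rule small_o_bound[OF assms(6)])
qed

text \<open>Taken as a directional derivative on the product, so that the iterates stay functions of
  time and space whose joint smoothness and space derivatives remain available.\<close>

definition time_deriv :: "(real \<times> 'z::real_normed_vector \<Rightarrow> 'b::real_normed_vector) \<Rightarrow> real \<times> 'z \<Rightarrow> 'b"
  where "time_deriv h p = fd h p (1, 0)"

lemma smooth_on_time_deriv: "smooth_on S h \<Longrightarrow> smooth_on S ((time_deriv ^^ k) h)"
proof (induction k)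
  case (Suc k)
  have "smooth_on S (\<lambda>p. fd ((time_deriv ^^ k) h) p (1, 0))" by (rule smooth_on_fd[OF Suc.IH[OF Suc.prems]])
  then show ?case by (simp add: time_deriv_def[abs_def])
qed simp

lemma has_vector_derivative_time:
  assumes "h differentiable (at (t, z))"
  shows "((\<lambda>t. h (t, z)) has_vector_derivative time_deriv h (t, z)) (at t)"
  using has_vector_derivative_line[of h "(0, z)" t "(1, 0)"] assms
  by (simp add: time_deriv_def)

lemma open_time_slice:
  assumes "open S"
  shows "open {t. (t, z) \<in> S}" "open {z. (t, z) \<in> S}"
proof -
  have "continuous_on UNIV (\<lambda>t. (t, z))" "continuous_on UNIV (\<lambda>z. (t, z))"
    by (intro continuous_intros)+
  then have "open ((\<lambda>t. (t, z)) -` S)" "open ((\<lambda>z. (t, z)) -` S)"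
    using assms by (auto intro: open_vimage)
  then show "open {t. (t, z) \<in> S}" "open {z. (t, z) \<in> S}"
    by (simp_all add: vimage_def)
qed

lemma iterated_vector_derivative_eq:
  assumes "open S" "smooth_on S h" "(t, z) \<in> S"
  shows "((\<lambda>h t. vector_derivative h (at t)) ^^ k) (\<lambda>t. h (t, z)) t = (time_deriv ^^ k) h (t, z)"
  using assms(3)
proof (induction k arbitrary: t)
  case (Suc k)
  have "((\<lambda>t. (time_deriv ^^ k) h (t, z)) has_vector_derivative (time_deriv ^^ Suc k) h (t, z)) (at t)"
    using has_vector_derivative_time[OF smooth_on_imp_differentiable[OF
          smooth_on_time_deriv[OF assms(2)] Suc.prems], of k] by simp
  then have "(((\<lambda>h t. vector_derivative h (at t)) ^^ k) (\<lambda>t. h (t, z)) has_vector_derivative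
      (time_deriv ^^ Suc k) h (t, z)) (at t)"
    by (rule has_vector_derivative_transform_within_open[OF _ open_time_slice(1)[OF assms(1)]])
      (use Suc in auto)
  then show ?case by (simp add: vector_derivative_at)
qed simp

text \<open>Differentiation in time sees a single slice. This allows data that depend on space alone
  to be frozen at the point of evaluation.\<close>

lemma time_deriv_cong:
  assumes "open S" "smooth_on S h" "smooth_on S h'" "(t, z) \<in> S" "\<And>t. (t, z) \<in> S \<Longrightarrow> h (t, z) = h' (t, z)"
  shows "(time_deriv ^^ k) h (t, z) = (time_deriv ^^ k) h' (t, z)"
  using assms(4)
proof (induction k arbitrary: t)
  case (Suc k)
  have d: "((\<lambda>t. (time_deriv ^^ k) h (t, z)) has_vector_derivative (time_deriv ^^ Suc k) h (t, z)) (at t)"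
    if "smooth_on S h" for h
    using has_vector_derivative_time[OF smooth_on_imp_differentiable[OF
          smooth_on_time_deriv[OF that] Suc.prems], of k] by simp
  have "((\<lambda>t. (time_deriv ^^ k) h' (t, z)) has_vector_derivative (time_deriv ^^ Suc k) h (t, z)) (at t)"
    by (rule has_vector_derivative_transform_within_open[OF d[OF assms(2)] open_time_slice(1)[OF assms(1)]])
      (use Suc in auto)
  with d[OF assms(3)] show ?case using vector_derivative_unique_at by blast
qed (use assms in auto)

text \<open>Symmetry of second derivatives, once for each time derivative.\<close>

lemma time_deriv_fd:
  assumes "open S" "smooth_on S h" "p \<in> S"
  shows "(time_deriv ^^ k) (\<lambda>p. fd h p v) p = fd ((time_deriv ^^ k) h) p v"
  using assms(3)
proof (induction k arbitrary: p)
  case (Suc k)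
  note sm = smooth_on_time_deriv[OF assms(2), of k]
  have "(time_deriv ^^ Suc k) (\<lambda>p. fd h p v) p = fd ((time_deriv ^^ k) (\<lambda>p. fd h p v)) p (1, 0)"
    by (simp add: time_deriv_def)
  also have "\<dots> = fd (\<lambda>p. fd ((time_deriv ^^ k) h) p v) p (1, 0)"
  proof -
    have "(\<lambda>p. fd ((time_deriv ^^ k) h) p v) differentiable (at p)"
      by (rule smooth_on_imp_differentiable[OF smooth_on_fd[OF sm] Suc.prems])
    from differentiable_cong_open(2)[OF assms(1) Suc.prems _ this, of "(time_deriv ^^ k) (\<lambda>p. fd h p v)"]
    show ?thesis using Suc.IH by simp
  qed
  also have "\<dots> = fd (\<lambda>p. fd ((time_deriv ^^ k) h) p (1, 0)) p v"
    by (rule fd_commute[OF assms(1) sm Suc.prems])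
  finally show ?case by (simp add: time_deriv_def[abs_def])
qed simp

text \<open>The remainder vanishes at time 0 and its time derivative is the remainder of
  \<open>time_deriv h\<close> of one order less, so the mean value inequality drives the induction.
  The bound is uniform in \<open>z\<close> near \<open>z0\<close>.\<close>

lemma Taylor_time:
  assumes "open S" "smooth_on S h" "(0, z0) \<in> S"
  shows "small_o n fst (nhds (0, z0))
    (\<lambda>(t, z). h (t, z) - (\<Sum>k\<le>n. (t ^ k / fact k) *\<^sub>R (time_deriv ^^ k) h (0, z)))"
  using assms(2)
proof (induction n arbitrary: h)
  case 0
  have "((\<lambda>p. h p - h (0, snd p)) \<longlongrightarrow> h (0, z0) - h (0, z0)) (nhds (0, z0))"
  proof (intro tendsto_diff)
    have c: "(h \<longlongrightarrow> h (0, z0)) (nhds (0, z0))"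
      using smooth_on_imp_continuous_on[OF 0] assms(1,3)
      by (metis continuous_on_eq_continuous_at isCont_def tendsto_at_iff_tendsto_nhds)
    then show "(h \<longlongrightarrow> h (0, z0)) (nhds (0, z0))" .
    have "((\<lambda>p. (0, snd p)) \<longlongrightarrow> (0::real, z0)) (nhds (0::real, z0))"
      using tendsto_Pair[OF tendsto_const tendsto_snd[OF filterlim_ident[of "nhds (0::real, z0)"]]]
      by simp
    then show "((\<lambda>p. h (0, snd p)) \<longlongrightarrow> h (0, z0)) (nhds (0::real, z0))"
      by (rule filterlim_compose[OF c])
  qed
  then have "\<forall>\<^sub>F p in nhds (0, z0). norm (h p - h (0, snd p)) < e" if "e > 0" for e
    using tendstoD[OF _ that] by (force simp: dist_norm)
  then have "\<forall>\<^sub>F p in nhds (0, z0). norm (h p - h (0, snd p)) \<le> e" if "e > 0" for e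
    using that by (force elim: eventually_mono)
  then show ?case by (simp add: small_o_def split_def)
next
  case (Suc n)
  have sm: "smooth_on S (time_deriv h)" using smooth_on_time_deriv[OF Suc.prems, of 1] by simp
  have fs: "(time_deriv ^^ k) (time_deriv h) = (time_deriv ^^ Suc k) h" for k
    by (simp add: funpow_swap1)
  show ?case
    unfolding small_o_def
  proof (intro allI impI)
    fix e :: real assume "e > 0"
    have "\<forall>\<^sub>F p in nhds (0, z0). p \<in> S" using assms by (simp add: eventually_nhds_in_open)
    with small_oD[OF Suc.IH[OF sm] \<open>e > 0\<close>]
    have "\<forall>\<^sub>F p in nhds (0, z0). p \<in> S \<and> norm (time_deriv h p -
        (\<Sum>k\<le>n. (fst p ^ k / fact k) *\<^sub>R (time_deriv ^^ Suc k) h (0, snd p))) \<le> e * \<bar>fst p\<bar> ^ n"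
      by eventually_elim (simp add: split_def fs)
    \<comment> \<open>The neighbourhood is shrunk to a box: for each admissible \<open>z\<close> the
      whole time segment from 0 to \<open>t\<close> then stays where the bound on the derivative
      holds.\<close>
    then obtain P Q where PQ: "eventually P (nhds (0::real))" "eventually Q (nhds z0)"
      and imp: "\<And>t z. P t \<Longrightarrow> Q z \<Longrightarrow> (t, z) \<in> S \<and> norm (time_deriv h (t, z) -
        (\<Sum>k\<le>n. (t ^ k / fact k) *\<^sub>R (time_deriv ^^ Suc k) h (0, z))) \<le> e * \<bar>t\<bar> ^ n"
      unfolding nhds_prod eventually_prod_filter by auto
    obtain d where d: "d > 0" "\<And>t. \<bar>t\<bar> < d \<Longrightarrow> P t"
      using PQ(1) unfolding eventually_nhds_metric by (auto simp: dist_real_def)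
    have "norm (h (t, z) - (\<Sum>k\<le>Suc n. (t ^ k / fact k) *\<^sub>R (time_deriv ^^ k) h (0, z)))
        \<le> e * \<bar>t\<bar> ^ Suc n" if t: "\<bar>t\<bar> < d" and z: "Q z" for t z
    proof -
      let ?r = "\<lambda>t. h (t, z) - (\<Sum>k\<le>Suc n. (t ^ k / fact k) *\<^sub>R (time_deriv ^^ k) h (0, z))"
      let ?r' = "\<lambda>t. time_deriv h (t, z) - (\<Sum>k\<le>n. (t ^ k / fact k) *\<^sub>R (time_deriv ^^ Suc k) h (0, z))"
      have "norm (?r t - ?r 0) \<le> (e * \<bar>t\<bar> ^ n) * \<bar>t - 0\<bar>"
      proof (rule vector_derivative_bound)
        fix s assume "s \<in> closed_segment 0 t"
        then have s: "\<bar>s\<bar> \<le> \<bar>t\<bar>" by (auto simp: closed_segment_eq_real_ivl split: if_splits)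
        have i: "(s, z) \<in> S" "norm (?r' s) \<le> e * \<bar>s\<bar> ^ n"
          using imp[OF d(2) z, of s] s t by auto
        have p: "((\<lambda>t. (t ^ k / fact k) *\<^sub>R c) has_vector_derivative
            (if k = 0 then 0 else (s ^ (k - 1) / fact (k - 1)) *\<^sub>R c)) (at s)" for k and c :: 'b
        proof (cases k)
          case (Suc j)
          have "((\<lambda>t. t ^ Suc j / fact (Suc j)) has_real_derivative s ^ j / fact j) (at s)"
            using DERIV_cdivide[OF DERIV_pow[of "Suc j" s], of "fact (Suc j)"]
            by (simp del: of_nat_Suc)
          then have "((\<lambda>t. t ^ Suc j / fact (Suc j)) has_vector_derivative s ^ j / fact j) (at s)"
            by (simp add: has_real_derivative_iff_has_vector_derivative)
          from bounded_linear.has_vector_derivative[OF bounded_linear_scaleR_left this, of c]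
          show ?thesis using Suc by simp
        qed simp
        have "(?r has_vector_derivative time_deriv h (s, z) - (\<Sum>k\<le>Suc n.
            (if k = 0 then 0 else (s ^ (k - 1) / fact (k - 1)) *\<^sub>R (time_deriv ^^ k) h (0, z)))) (at s)"
          by (intro has_vector_derivative_diff has_vector_derivative_sum p
              has_vector_derivative_time smooth_on_imp_differentiable[OF Suc.prems i(1)])
        also have "(\<Sum>k\<le>Suc n.
            (if k = 0 then 0 else (s ^ (k - 1) / fact (k - 1)) *\<^sub>R (time_deriv ^^ k) h (0, z))) =
            (\<Sum>k\<le>n. (s ^ k / fact k) *\<^sub>R (time_deriv ^^ Suc k) h (0, z))"
          by (subst sum.atMost_Suc_shift) simp
        finally show "(?r has_vector_derivative ?r' s) (at s)" .
        have "e * \<bar>s\<bar> ^ n \<le> e * \<bar>t\<bar> ^ n"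
          using s \<open>e > 0\<close> by (intro mult_left_mono power_mono) auto
        with i(2) show "norm (?r' s) \<le> e * \<bar>t\<bar> ^ n" by linarith
      qed
      moreover have "?r 0 = 0"
        by (subst sum.atMost_Suc_shift) simp
      ultimately show ?thesis by (simp add: mult_ac)
    qed
    moreover have "eventually (\<lambda>t. \<bar>t\<bar> < d) (nhds (0::real))"
      unfolding eventually_nhds_metric dist_real_def using d(1) by auto
    ultimately show "\<forall>\<^sub>F w in nhds (0, z0).
        norm (case w of (t, z) \<Rightarrow> h (t, z) - (\<Sum>k\<le>Suc n. (t ^ k / fact k) *\<^sub>R (time_deriv ^^ k) h (0, z)))
        \<le> e * \<bar>fst w\<bar> ^ Suc n"
      unfolding nhds_prod eventually_prod_filter using PQ(2)
      by (intro exI[of _ "\<lambda>t. \<bar>t\<bar> < d"] exI[of _ Q]) auto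
  qed
qed

section \<open>Lie derivatives in a chart\<close>

lemma has_derivative_snd_slice:
  assumes "h differentiable (at (t, z))"
  shows "((\<lambda>z. h (t, z)) has_derivative (\<lambda>\<zeta>. fd h (t, z) (0, \<zeta>))) (at z)"
proof -
  have "((\<lambda>z. (t, z)) has_derivative (\<lambda>\<zeta>. (0, \<zeta>))) (at z)"
    by (auto intro!: derivative_eq_intros)
  from has_derivative_compose[OF this has_derivative_fd[OF assms]] show ?thesis .
qed

lemma has_derivative_fst_slice:
  assumes "h differentiable (at (t, z))"
  shows "((\<lambda>t. h (t, z)) has_derivative (\<lambda>\<tau>. fd h (t, z) (\<tau>, 0))) (at t)"
proof -
  have "((\<lambda>t. (t, z)) has_derivative (\<lambda>\<tau>. (\<tau>, 0))) (at t)"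
    by (auto intro!: derivative_eq_intros)
  from has_derivative_compose[OF this has_derivative_fd[OF assms]] show ?thesis .
qed

lemma smooth_on_snd_slice:
  fixes h :: "'t::real_normed_vector \<times> 'z::real_normed_vector \<Rightarrow> 'b::real_normed_vector"
  assumes "finite_dim (UNIV :: 't set)" "finite_dim (UNIV :: 'z set)" "open S" "smooth_on S h"
  shows "smooth_on ((\<lambda>z. (t, z)) -` S) (\<lambda>z. h (t, z))"
proof -
  have "open ((\<lambda>z. (t, z)) -` S)" by (intro open_vimage assms continuous_intros)
  then show ?thesis
    by (intro smooth_on_compose[OF finite_dim_prod[OF assms(1,2)] assms(4) _ _ assms(3)]
        smooth_on_Pair smooth_on_const smooth_on_id) auto
qed

text \<open>The map taking (x, v) to \<open>fd f x v\<close> is jointly smooth in finite dimension;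
  its partial derivatives are a second derivative of \<open>f\<close> in x and, by linearity,
  \<open>fd f x\<close> in v.\<close>

lemma has_derivative_fd_apply:
  fixes f :: "'a::real_normed_vector \<Rightarrow> 'b::real_normed_vector"
  assumes fin: "finite_dim (UNIV :: 'a set)" and S: "open S" "smooth_on S f" "x \<in> S"
    and g: "(g has_derivative g') (at a)" "g a = x" and y: "(y has_derivative y') (at a)" "y a = v"
  shows "((\<lambda>a. fd f (g a) (y a)) has_derivative
    (\<lambda>h. fd (\<lambda>x. fd f x v) x (g' h) + fd f x (y' h))) (at a)"
proof -
  let ?F = "\<lambda>(x, v). fd f x v"
  have "smooth_on (S \<times> UNIV) (\<lambda>p. fd f (fst p) (snd p))"
    by (intro smooth_on_fd_apply[OF fin _ S(1,2)] smooth_on_fst smooth_on_snd smooth_on_id open_Times S)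
      auto
  then have d: "?F differentiable (at (x, v))"
    using smooth_on_imp_differentiable[of "S \<times> UNIV" ?F "(x, v)"] S(3) by (simp add: split_def)
  interpret linear "fd ?F (x, v)" by (rule linear_fd[OF d])
  have "fd ?F (x, v) (\<xi>, 0) = fd (\<lambda>x. fd f x v) x \<xi>" for \<xi>
    using fd_eqI[OF has_derivative_fst_slice[OF d]] by simp
  moreover have "fd ?F (x, v) (0, \<eta>) = fd f x \<eta>" for \<eta>
  proof -
    have "bounded_linear (fd f x)"
      by (rule bounded_linear_fd[OF smooth_on_imp_differentiable[OF S(2,3)]])
    then have "fd (fd f x) v = fd f x" by (intro fd_eqI bounded_linear_imp_has_derivative)
    then show ?thesis using fd_eqI[OF has_derivative_snd_slice[OF d]] by simp
  qed
  ultimately have "fd ?F (x, v) (\<xi>, \<eta>) = fd (\<lambda>x. fd f x v) x \<xi> + fd f x \<eta>" for \<xi> \<eta>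
    using add[of "(\<xi>, 0)" "(0, \<eta>)"] by simp
  moreover have "((\<lambda>a. (g a, y a)) has_derivative (\<lambda>h. (g' h, y' h))) (at a)"
    by (rule has_derivative_Pair[OF g(1) y(1)])
  from has_derivative_compose[OF this, of ?F "fd ?F (x, v)"] has_derivative_fd[OF d]
  have "((\<lambda>a. ?F (g a, y a)) has_derivative (\<lambda>h. fd ?F (x, v) (g' h, y' h))) (at a)"
    using g(2) y(2) by simp
  ultimately show ?thesis by simp
qed

text \<open>A covariant 2-tensor is treated as a function \<open>T\<close> of the point and the two vectors; its Lie
  derivative along \<open>X\<close> is then the derivative of \<open>T\<close> along the complete lift of \<open>X\<close>.\<close>

definition complete_lift :: "('e::real_normed_vector \<Rightarrow> 'e) \<Rightarrow> 'e \<times> 'e \<times> 'e \<Rightarrow> 'e \<times> 'e \<times> 'e" where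
  "complete_lift X = (\<lambda>(x, v, w). (X x, fd X x v, fd X x w))"

lemma smooth_on_complete_lift:
  fixes X :: "'e::real_normed_vector \<Rightarrow> 'e"
  assumes fin: "finite_dim (UNIV :: 'e set)" and C: "open C" "smooth_on C X"
  shows "smooth_on (C \<times> UNIV) (complete_lift X)"
proof -
  have o: "open (C \<times> (UNIV :: ('e \<times> 'e) set))" by (intro open_Times C open_UNIV)
  have "smooth_on (C \<times> UNIV) (\<lambda>p::'e \<times> 'e \<times> 'e. (X (fst p), fd X (fst p) (fst (snd p)), fd X (fst p) (snd (snd p))))"
    by (intro smooth_on_Pair[OF o] smooth_on_fd_apply[OF fin o C] smooth_on_compose[OF fin C(2) _ o C(1)]
        smooth_on_fst[OF o] smooth_on_snd[OF o] smooth_on_id) auto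
  then show ?thesis by (simp add: complete_lift_def split_def)
qed

text \<open>With \<open>G (x, v, w) = (f x, Df x v, Df x w)\<close> one has \<open>T = T' \<circ> G\<close>. By symmetry of the second
  derivative of \<open>f\<close>, the derivative of \<open>G\<close> takes the complete lift of \<open>X\<close> to that of \<open>X'\<close> minus that
  of the defect \<open>W\<close>, which measures how far \<open>X\<close> and \<open>X'\<close> are from being \<open>f\<close>-related.\<close>

lemma lie_naturality:
  fixes f :: "'e::real_normed_vector \<Rightarrow> 'e" and T T' :: "'e \<times> 'e \<times> 'e \<Rightarrow> 'b::real_normed_vector"
    and X X' :: "'e \<Rightarrow> 'e"
  assumes fin: "finite_dim (UNIV :: 'e set)" and S: "open S" "smooth_on S f" "x \<in> S"
    and T': "T' differentiable (at (f x, fd f x v, fd f x w))"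
    and X: "X differentiable (at x)" and X': "X' differentiable (at (f x))"
    and T: "\<And>x v w. x \<in> S \<Longrightarrow> T (x, v, w) = T' (f x, fd f x v, fd f x w)"
    and W: "\<And>x. x \<in> S \<Longrightarrow> W x = X' (f x) - fd f x (X x)"
  shows "fd T (x, v, w) (complete_lift X (x, v, w)) =
    fd T' (f x, fd f x v, fd f x w) (complete_lift X' (f x, fd f x v, fd f x w))
    - fd T' (f x, fd f x v, fd f x w) (complete_lift W (x, v, w))"
proof -
  define G where "G = (\<lambda>p::'e \<times> 'e \<times> 'e. (f (fst p), fd f (fst p) (fst (snd p)), fd f (fst p) (snd (snd p))))"
  note df = smooth_on_imp_differentiable[OF S(2)]
  have fst': "(fst has_derivative fst) (at p)" for p :: "'e \<times> 'e \<times> 'e"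
    by (auto intro!: derivative_eq_intros)
  have 1: "((\<lambda>p. f (fst p)) has_derivative (\<lambda>h. fd f x (fst h))) (at (x, v, w))"
    using has_derivative_compose[OF fst', of f "fd f x" "(x, v, w)"] has_derivative_fd[OF df[OF S(3)]]
    by simp
  have 2: "((\<lambda>p. fd f (fst p) (fst (snd p))) has_derivative
      (\<lambda>h. fd (\<lambda>x. fd f x v) x (fst h) + fd f x (fst (snd h)))) (at (x, v, w))"
    by (rule has_derivative_fd_apply[OF fin S fst']) (auto intro!: derivative_eq_intros)
  have 3: "((\<lambda>p. fd f (fst p) (snd (snd p))) has_derivative
      (\<lambda>h. fd (\<lambda>x. fd f x w) x (fst h) + fd f x (snd (snd h)))) (at (x, v, w))"
    by (rule has_derivative_fd_apply[OF fin S fst']) (auto intro!: derivative_eq_intros)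
  define G' where "G' = (\<lambda>h::'e \<times> 'e \<times> 'e. (fd f x (fst h), fd (\<lambda>x. fd f x v) x (fst h) + fd f x (fst (snd h)),
      fd (\<lambda>x. fd f x w) x (fst h) + fd f x (snd (snd h))))"
  have G: "(G has_derivative G') (at (x, v, w))"
    unfolding G_def G'_def by (intro has_derivative_Pair 1 2 3)
  have Gx: "G (x, v, w) = (f x, fd f x v, fd f x w)" by (simp add: G_def)
  have "((\<lambda>p. T' (G p)) has_derivative (\<lambda>h. fd T' (f x, fd f x v, fd f x w) (G' h))) (at (x, v, w))"
    using has_derivative_compose[OF G, of T'] has_derivative_fd[OF T'] Gx by simp
  then have "(T has_derivative (\<lambda>h. fd T' (f x, fd f x v, fd f x w) (G' h))) (at (x, v, w))"
    by (rule has_derivative_transform_within_open[OF _ open_Times[OF S(1) open_UNIV]])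
      (use S in \<open>auto simp: T G_def\<close>)
  then have fdT: "fd T (x, v, w) = (\<lambda>h. fd T' (f x, fd f x v, fd f x w) (G' h))" by (rule fd_eqI)
  have "((\<lambda>x. X' (f x) - fd f x (X x)) has_derivative
      (\<lambda>\<xi>. fd X' (f x) (fd f x \<xi>) - (fd (\<lambda>y. fd f y (X x)) x \<xi> + fd f x (fd X x \<xi>)))) (at x)"
    by (intro has_derivative_diff fd_chain X' df S has_derivative_fd_apply[OF fin S]
        has_derivative_ident has_derivative_fd X) auto
  then have "(W has_derivative
      (\<lambda>\<xi>. fd X' (f x) (fd f x \<xi>) - (fd (\<lambda>y. fd f y (X x)) x \<xi> + fd f x (fd X x \<xi>)))) (at x)"
    by (rule has_derivative_transform_within_open[OF _ S(1,3)]) (simp add: W)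
  then have fdW: "fd W x = (\<lambda>\<xi>. fd X' (f x) (fd f x \<xi>) - (fd (\<lambda>y. fd f y (X x)) x \<xi> + fd f x (fd X x \<xi>)))"
    by (rule fd_eqI)
  have "G' (complete_lift X (x, v, w)) =
      complete_lift X' (f x, fd f x v, fd f x w) - complete_lift W (x, v, w)"
    using fd_commute[OF S, of "X x"] W[OF S(3)] fdW
    by (simp add: G'_def complete_lift_def)
  then show ?thesis
    unfolding fdT using linear_diff[OF linear_fd[OF T']] by simp
qed

section \<open>Invariance of the leading coefficient in a chart\<close>

definition coef :: "(real \<times> 'z::real_normed_vector \<Rightarrow> 'b::real_normed_vector) \<Rightarrow> nat \<Rightarrow> 'z \<Rightarrow> 'b" where
  "coef T k z = (time_deriv ^^ k) T (0, z) /\<^sub>R fact k"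

text \<open>The coefficient of t^m in the Lie derivative of \<open>T\<close> along the series with
  terms t^i \<open>X i\<close>, with each Lie derivative written through the complete lift.\<close>

definition lie_coef :: "(real \<times> 'e \<times> 'e \<times> 'e \<Rightarrow> 'b) \<Rightarrow> (nat \<Rightarrow> 'e \<Rightarrow> 'e) \<Rightarrow> nat \<Rightarrow>
    'e::real_normed_vector \<times> 'e \<times> 'e \<Rightarrow> 'b::real_normed_vector" where
  "lie_coef T X m z = (\<Sum>i\<le>m. fd (coef T (m - i)) z (complete_lift (X i) z))"

lemma smooth_on_coef:
  fixes T :: "real \<times> 'z::real_normed_vector \<Rightarrow> 'b::real_normed_vector"
  assumes "finite_dim (UNIV :: 'z set)" "open D" "smooth_on (UNIV \<times> D) T"
  shows "smooth_on D (coef T k)"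
proof -
  have "smooth_on ((\<lambda>z. (0::real, z)) -` (UNIV \<times> D)) (\<lambda>z. (time_deriv ^^ k) T (0, z))"
    by (intro smooth_on_snd_slice[OF finite_dim_real assms(1)] smooth_on_time_deriv open_Times assms
        open_UNIV)
  then have "smooth_on D (\<lambda>z. (time_deriv ^^ k) T (0, z))" by (simp add: vimage_def)
  then show ?thesis
    unfolding coef_def[abs_def]
    by (rule smooth_on_bounded_linear[OF bounded_linear_scaleR_right assms(2)])
qed

lemma fd_coef:
  fixes T :: "real \<times> 'z::real_normed_vector \<Rightarrow> 'b::real_normed_vector"
  assumes "open S" "smooth_on S T" "(0, z) \<in> S"
  shows "fd (coef T k) z \<zeta> = fd ((time_deriv ^^ k) T) (0, z) (0, \<zeta>) /\<^sub>R fact k"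
proof -
  have "(coef T k has_derivative (\<lambda>\<zeta>. fd ((time_deriv ^^ k) T) (0, z) (0, \<zeta>) /\<^sub>R fact k)) (at z)"
    unfolding coef_def[abs_def]
    by (intro has_derivative_scaleR_right has_derivative_snd_slice
        smooth_on_imp_differentiable[OF smooth_on_time_deriv[OF assms(2)] assms(3)])
  then show ?thesis by (simp add: fd_eqI)
qed

lemma smooth_on_lie_coef:
  fixes T :: "real \<times> 'e::real_normed_vector \<times> 'e \<times> 'e \<Rightarrow> 'b::real_normed_vector"
    and X :: "nat \<Rightarrow> 'e \<Rightarrow> 'e"
  assumes fin: "finite_dim (UNIV :: 'e set)" and C: "open C"
    and T: "smooth_on (UNIV \<times> (C \<times> UNIV)) T" and X: "\<And>i. smooth_on C (X i)"
  shows "smooth_on (C \<times> UNIV) (lie_coef T X m)"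
proof -
  have o: "open (C \<times> (UNIV :: ('e \<times> 'e) set))" by (intro open_Times C open_UNIV)
  have fin3: "finite_dim (UNIV :: ('e \<times> 'e \<times> 'e) set)" by (intro finite_dim_prod fin)
  show ?thesis
    unfolding lie_coef_def[abs_def]
    by (intro smooth_on_sum[OF o] smooth_on_fd_apply[OF fin3 o o] smooth_on_coef[OF fin3 o T]
        smooth_on_id smooth_on_complete_lift[OF fin C X])
qed

lemma complete_lift_sum:
  assumes "\<And>i. i \<in> I \<Longrightarrow> X i differentiable (at (fst z))"
  shows "complete_lift (\<lambda>x. \<Sum>i\<in>I. c i *\<^sub>R X i x) z = (\<Sum>i\<in>I. c i *\<^sub>R complete_lift (X i) z)"
proof -
  obtain x v w where z: "z = (x, v, w)" by (cases z)
  have "((\<lambda>x. \<Sum>i\<in>I. c i *\<^sub>R X i x) has_derivative (\<lambda>v. \<Sum>i\<in>I. c i *\<^sub>R fd (X i) x v)) (at x)"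
    using assms z by (intro has_derivative_sum has_derivative_scaleR_right has_derivative_fd) simp
  then show ?thesis
    by (simp add: complete_lift_def z fd_eqI fst_sum snd_sum prod_eq_iff)
qed

text \<open>Each \<open>fd T\<close> along the lift of \<open>X i\<close> is Taylor expanded in time
  and the expansions are combined as a Cauchy product. Its coefficients are the
  \<open>lie_coef\<close>, because time derivatives pass through the space derivative; those below
  degree n vanish by hypothesis.\<close>

lemma lie_expansion:
  fixes T :: "real \<times> 'e::real_normed_vector \<times> 'e \<times> 'e \<Rightarrow> 'b::real_normed_vector"
    and X :: "nat \<Rightarrow> 'e \<Rightarrow> 'e"
  assumes fin: "finite_dim (UNIV :: 'e set)" and C: "open C"
    and T: "smooth_on (UNIV \<times> (C \<times> UNIV)) T" and X: "\<And>i. smooth_on C (X i)"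
    and z0: "z0 \<in> C \<times> UNIV"
    and vanish: "\<And>m z. m < n \<Longrightarrow> z \<in> C \<times> UNIV \<Longrightarrow> lie_coef T X m z = 0"
  shows "small_o n fst (nhds (0, z0)) (\<lambda>(t, z).
    fd T (t, z) (0, complete_lift (\<lambda>x. \<Sum>i\<le>n. t ^ i *\<^sub>R X i x) z) - t ^ n *\<^sub>R lie_coef T X n z)"
proof -
  let ?S = "UNIV \<times> (C \<times> UNIV) :: (real \<times> 'e \<times> 'e \<times> 'e) set"
  have oC: "open (C \<times> (UNIV :: ('e \<times> 'e) set))" by (intro open_Times C open_UNIV)
  then have o: "open ?S" by (rule open_Times[OF open_UNIV])
  have fin3: "finite_dim (UNIV :: ('e \<times> 'e \<times> 'e) set)" by (intro finite_dim_prod fin)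
  have fin4: "finite_dim (UNIV :: (real \<times> 'e \<times> 'e \<times> 'e) set)"
    by (intro finite_dim_prod fin3 finite_dim_real)
  define Q where "Q = (\<lambda>i p. fd T p (0, complete_lift (X i) (snd p)))"
  have smQ: "smooth_on ?S (Q i)" for i
    unfolding Q_def
    by (intro smooth_on_fd_apply[OF fin4 o o T] smooth_on_id smooth_on_Pair[OF o] smooth_on_const
        smooth_on_compose[OF fin3 smooth_on_complete_lift[OF fin C X] smooth_on_snd[OF o smooth_on_id] o oC])
      auto
  have ev: "\<forall>\<^sub>F p in nhds (0, z0). p \<in> ?S"
    using z0 o by (intro eventually_nhds_in_open) auto
  have tdQ: "(time_deriv ^^ k) (Q i) (0, z) /\<^sub>R fact k = fd (coef T k) z (complete_lift (X i) z)"
    if z: "z \<in> C \<times> UNIV" for i k z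
  proof -
    let ?\<zeta> = "complete_lift (X i) z"
    have zS: "(0, z) \<in> ?S" using z by simp
    \<comment> \<open>The lift depends on the point but not on time, so its value at
      \<open>z\<close> may replace it; the direction is then constant and
      \<open>time_deriv_fd\<close> applies.\<close>
    have "(time_deriv ^^ k) (Q i) (0, z) = (time_deriv ^^ k) (\<lambda>p. fd T p (0, ?\<zeta>)) (0, z)"
      by (rule time_deriv_cong[OF o smQ smooth_on_fd[OF T] zS]) (simp add: Q_def)
    also have "\<dots> = fd ((time_deriv ^^ k) T) (0, z) (0, ?\<zeta>)"
      by (rule time_deriv_fd[OF o T zS])
    finally show ?thesis using fd_coef[OF o T zS, of k ?\<zeta>] by simp
  qed
  have "small_o (n - i) fst (nhds (0, z0)) (\<lambda>p. Q i p -
      (\<Sum>k\<le>n - i. fst p ^ k *\<^sub>R fd (coef T k) (snd p) (complete_lift (X i) (snd p))))" for i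
  proof (rule small_o_cong[OF Taylor_time[OF o smQ]])
    show "(0, z0) \<in> ?S" using z0 by simp
    show "\<forall>\<^sub>F p in nhds (0, z0). (case p of (t, z) \<Rightarrow> Q i (t, z) -
        (\<Sum>k\<le>n - i. (t ^ k / fact k) *\<^sub>R (time_deriv ^^ k) (Q i) (0, z))) =
        Q i p - (\<Sum>k\<le>n - i. fst p ^ k *\<^sub>R fd (coef T k) (snd p) (complete_lift (X i) (snd p)))"
      using ev
    proof eventually_elim
      case (elim p)
      then have "snd p \<in> C \<times> UNIV" by auto
      from tdQ[OF this] show ?case
        by (auto simp: split_def divide_inverse scaleR_scaleR[symmetric] simp del: scaleR_scaleR)
    qed
  qed
  then have "small_o n fst (nhds (0, z0)) (\<lambda>p. (\<Sum>i\<le>n. fst p ^ i *\<^sub>R Q i p) -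
    (\<Sum>m\<le>n. fst p ^ m *\<^sub>R (\<Sum>i\<le>m. fd (coef T (m - i)) (snd p) (complete_lift (X i) (snd p)))))"
    by (intro small_o_triangle)
  then show ?thesis
  proof (rule small_o_cong)
    show "\<forall>\<^sub>F p in nhds (0, z0). (\<Sum>i\<le>n. fst p ^ i *\<^sub>R Q i p) -
      (\<Sum>m\<le>n. fst p ^ m *\<^sub>R (\<Sum>i\<le>m. fd (coef T (m - i)) (snd p) (complete_lift (X i) (snd p)))) =
      (case p of (t, z) \<Rightarrow> fd T (t, z) (0, complete_lift (\<lambda>x. \<Sum>i\<le>n. t ^ i *\<^sub>R X i x) z)
        - t ^ n *\<^sub>R lie_coef T X n z)"
      using ev
    proof eventually_elim
      case (elim p)
      obtain t z where p: "p = (t, z)" by (cases p)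
      then have z: "z \<in> C \<times> UNIV" using elim by simp
      have "(\<Sum>m\<le>n. t ^ m *\<^sub>R lie_coef T X m z) = (\<Sum>m\<in>{n}. t ^ m *\<^sub>R lie_coef T X m z)"
        by (rule sum.mono_neutral_right) (use vanish[OF _ z] in auto)
      moreover have "(\<Sum>i\<le>n. t ^ i *\<^sub>R Q i p) = fd T (t, z) (0, complete_lift (\<lambda>x. \<Sum>i\<le>n. t ^ i *\<^sub>R X i x) z)"
      proof -
        have "X i differentiable (at (fst z))" for i
          using smooth_on_imp_differentiable[OF X] z by auto
        then have eq: "(0, complete_lift (\<lambda>x. \<Sum>i\<le>n. t ^ i *\<^sub>R X i x) z) =
            (\<Sum>i\<le>n. t ^ i *\<^sub>R (0, complete_lift (X i) z))"
          by (subst complete_lift_sum) (auto simp: prod_eq_iff fst_sum snd_sum)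
        have "linear (fd T (t, z))"
          using smooth_on_imp_differentiable[OF T, of "(t, z)"] z by (intro linear_fd) auto
        then have "fd T (t, z) (\<Sum>i\<le>n. t ^ i *\<^sub>R (0, complete_lift (X i) z)) =
            (\<Sum>i\<le>n. t ^ i *\<^sub>R fd T (t, z) (0, complete_lift (X i) z))"
          by (simp only: linear_sum linear_scale)
        then show ?thesis
          unfolding eq by (simp add: Q_def p)
      qed
      ultimately show ?case by (simp add: p lie_coef_def)
    qed
  qed
qed

text \<open>By uniqueness of Taylor coefficients, the bound at every point of the open time-0 slice
  makes the coefficients up to degree n vanish identically there. Their space derivatives therefore
  vanish too, and these are the Taylor coefficients of the space derivative of
  \<open>W\<close>.\<close>

lemma small_o_fd_of_pointwise:
  fixes W :: "real \<times> 'z::real_normed_vector \<Rightarrow> 'b::real_normed_vector"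
  assumes U: "open U" "smooth_on U W" "(0, x0) \<in> U"
    and o: "\<And>x. (0, x) \<in> U \<Longrightarrow> small_o n (\<lambda>t. t) (at 0) (\<lambda>t. W (t, x))"
  shows "small_o n (\<lambda>t. t) (at 0) (\<lambda>t. fd W (t, x0) (0, v))"
proof -
  have taylor: "small_o n (\<lambda>t. t) (at 0) (\<lambda>t. h (t, x) -
      (\<Sum>k\<le>n. (t ^ k / fact k) *\<^sub>R (time_deriv ^^ k) h (0, x)))"
    if "(0, x) \<in> U" "smooth_on U h" for h :: "real \<times> 'z \<Rightarrow> 'b" and x
  proof -
    have "filterlim (\<lambda>t. (t, x)) (nhds (0, x)) (at 0)"
      by (intro tendsto_Pair tendsto_ident_at tendsto_const)
    from small_o_compose[OF Taylor_time[OF U(1) that(2,1)] this] show ?thesis by simp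
  qed
  have zero: "(time_deriv ^^ k) W (0, x) = 0" if x: "(0, x) \<in> U" and k: "k \<le> n" for x k
  proof -
    have "small_o n (\<lambda>t. t) (at 0) (\<lambda>t. \<Sum>k\<le>n. t ^ k *\<^sub>R ((time_deriv ^^ k) W (0, x) /\<^sub>R fact k))"
      using small_o_diff[OF o[OF x] taylor[OF x U(2)]] by (simp add: divide_inverse)
    from small_o_polynomial_imp_zero[OF this k] show ?thesis by simp
  qed
  have "(time_deriv ^^ k) (\<lambda>p. fd W p (0, v)) (0, x0) = 0" if k: "k \<le> n" for k
  proof -
    have "fd (coef W k) x0 v = fd (\<lambda>x. 0 :: 'b) x0 v"
      by (subst differentiable_cong_open(2)[OF open_time_slice(2)[OF U(1)], of x0 0 "\<lambda>x. 0" "coef W k"])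
        (use U zero k in \<open>auto simp: coef_def\<close>)
    then show ?thesis
      using fd_coef[OF U(1,2,3), of k v] time_deriv_fd[OF U(1,2,3), of k "(0, v)"] by simp
  qed
  then show ?thesis using taylor[OF U(3) smooth_on_fd[OF U(2)], of "(0, v)"] by simp
qed

lemma small_o_Pair:
  assumes "small_o n \<tau> G h" "small_o n \<tau> G k"
  shows "small_o n \<tau> G (\<lambda>w. (h w, k w))"
proof -
  have "bounded_linear (\<lambda>y::'b. (y, 0::'c))" "bounded_linear (\<lambda>y::'c. (0::'b, y))"
    by (auto intro: bounded_linear_Pair bounded_linear_ident bounded_linear_zero)
  from small_o_add[OF small_o_bounded_linear[OF this(1) assms(1)] small_o_bounded_linear[OF this(2) assms(2)]]
  show ?thesis by simp
qed

text \<open>For each t, naturality compares the Lie derivatives of \<open>T\<close> and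
  \<open>T'\<close> along the truncated series; the difference is the derivative of
  \<open>T'\<close> along the complete lift of the defect. As the defect and its space derivatives
  are o(t^n), the two terms t^n \<open>lie_coef\<close> agree up to o(t^n), and the limit at t = 0
  gives the identity.\<close>

lemma lie_coef_invariant:
  fixes f :: "real \<times> 'e::real_normed_vector \<Rightarrow> 'e" and T T' :: "real \<times> 'e \<times> 'e \<times> 'e \<Rightarrow> 'b::real_normed_vector"
    and X X' :: "nat \<Rightarrow> 'e \<Rightarrow> 'e"
  assumes fin: "finite_dim (UNIV :: 'e set)" and C: "open C" "open C'"
    and U: "open U" "(0, x0) \<in> U" "\<And>t x. (t, x) \<in> U \<Longrightarrow> x \<in> C \<and> f (t, x) \<in> C'" and f: "smooth_on U f"
    and T: "smooth_on (UNIV \<times> (C \<times> UNIV)) T" and X: "\<And>i. smooth_on C (X i)"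
    and T': "smooth_on (UNIV \<times> (C' \<times> UNIV)) T'" and X': "\<And>i. smooth_on C' (X' i)"
    and pull: "\<And>t x v w. (t, x) \<in> U \<Longrightarrow>
      T (t, x, v, w) = T' (t, f (t, x), fd f (t, x) (0, v), fd f (t, x) (0, w))"
    and W: "\<And>x. (0, x) \<in> U \<Longrightarrow> small_o n (\<lambda>t. t) (at 0)
      (\<lambda>t. \<Sum>i\<le>n. t ^ i *\<^sub>R (X' i (f (t, x)) - fd f (t, x) (0, X i x)))"
    and vanish: "\<And>m z. m < n \<Longrightarrow> z \<in> C \<times> UNIV \<Longrightarrow> lie_coef T X m z = 0"
    and vanish': "\<And>m z. m < n \<Longrightarrow> z \<in> C' \<times> UNIV \<Longrightarrow> lie_coef T' X' m z = 0"
  shows "lie_coef T X n (x0, v, w) = lie_coef T' X' n (f (0, x0), fd f (0, x0) (0, v), fd f (0, x0) (0, w))"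
proof -
  let ?S' = "UNIV \<times> (C' \<times> UNIV) :: (real \<times> 'e \<times> 'e \<times> 'e) set"
  have oC': "open (C' \<times> (UNIV :: ('e \<times> 'e) set))" by (intro open_Times C open_UNIV)
  then have oS': "open ?S'" by (rule open_Times[OF open_UNIV])
  have fin2: "finite_dim (UNIV :: (real \<times> 'e) set)" by (intro finite_dim_prod fin finite_dim_real)
  have fin4: "finite_dim (UNIV :: (real \<times> 'e \<times> 'e \<times> 'e) set)"
    by (intro finite_dim_prod fin finite_dim_real)
  define g where "g t = (f (t, x0), fd f (t, x0) (0, v), fd f (t, x0) (0, w))" for t
  define Xt where "Xt t x = (\<Sum>i\<le>n. t ^ i *\<^sub>R X i x)" for t x
  define Xt' where "Xt' t x = (\<Sum>i\<le>n. t ^ i *\<^sub>R X' i x)" for t x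
  \<comment> \<open>The defect of the truncated series as a function of (t, x); its joint smoothness
    is what permits differentiating the bound \<open>W\<close> in x.\<close>
  define Wf where "Wf p = (\<Sum>i\<le>n. fst p ^ i *\<^sub>R (X' i (f p) - fd f p (0, X i (snd p))))" for p
  define \<omega> where "\<omega> t = (Wf (t, x0), fd Wf (t, x0) (0, v), fd Wf (t, x0) (0, w))" for t
  note df = smooth_on_imp_differentiable[OF f]
  have smW: "smooth_on U Wf"
    unfolding Wf_def
    by (intro smooth_on_sum[OF U(1)] smooth_on_scaleR[OF U(1)] smooth_on_power[OF U(1)]
        smooth_on_fst[OF U(1)] smooth_on_id smooth_on_diff[OF U(1)]
        smooth_on_compose[OF fin X' f U(1) C(2)] smooth_on_fd_apply[OF fin2 U(1) U(1) f]
        smooth_on_Pair[OF U(1)] smooth_on_const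
        smooth_on_compose[OF fin X smooth_on_snd[OF U(1) smooth_on_id] U(1) C(1)])
      (use U in auto)
  have Wo: "small_o n (\<lambda>t. t) (at 0) (\<lambda>t. Wf (t, x))" if "(0, x) \<in> U" for x
    using W[OF that] by (simp add: Wf_def)
  have \<omega>: "small_o n (\<lambda>t. t) (at 0) \<omega>"
    unfolding \<omega>_def
    by (intro small_o_Pair Wo U(2) small_o_fd_of_pointwise[OF U(1) smW U(2) Wo])
  have contU: "(h \<longlongrightarrow> h (0, x0)) (nhds (0, x0))" if "smooth_on U h" for h :: "real \<times> 'e \<Rightarrow> 'e"
    using smooth_on_imp_continuous_on[OF that] U(1,2)
    by (metis continuous_on_eq_continuous_at isCont_def tendsto_at_iff_tendsto_nhds)
  have lim0: "((\<lambda>t. (t, x0)) \<longlongrightarrow> (0, x0)) (at 0)"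
    by (intro tendsto_Pair tendsto_ident_at tendsto_const)
  have limg: "(g \<longlongrightarrow> g 0) (at 0)"
    unfolding g_def
    by (intro tendsto_Pair filterlim_compose[OF contU[OF f] lim0]
        filterlim_compose[OF contU[OF smooth_on_fd[OF f]] lim0])
  have limtg: "((\<lambda>t. (t, g t)) \<longlongrightarrow> (0, g 0)) (at 0)"
    by (intro tendsto_Pair tendsto_ident_at limg)
  have g0: "g 0 \<in> C' \<times> UNIV" using U by (auto simp: g_def)
  have evU: "\<forall>\<^sub>F t in at 0. (t, x0) \<in> U"
    using lim0 U(1,2) by (rule topological_tendstoD)
  have E: "small_o n (\<lambda>t. t) (at 0) (\<lambda>t. fd T' (t, g t) (0, \<omega> t))"
    by (rule small_o_fd[OF fin4 oS' T' _ limtg small_o_Pair[OF small_o_zero \<omega>]]) (use g0 in auto)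
  \<comment> \<open>Here \<open>a\<close> and \<open>b\<close> are the Lie derivatives before and
    after transport; the coefficient \<open>l\<close> sits at the fixed point, while
    \<open>c t\<close> is taken along the moving point \<open>g t\<close>.\<close>
  have combine: "small_o n (\<lambda>t. t) (at 0) (\<lambda>t. t ^ n *\<^sub>R (l - c t))"
    if "small_o n (\<lambda>t. t) (at 0) (\<lambda>t. a t - t ^ n *\<^sub>R l)"
      "small_o n (\<lambda>t. t) (at 0) (\<lambda>t. b t - t ^ n *\<^sub>R c t)"
      "small_o n (\<lambda>t. t) (at 0) (\<lambda>t. a t - b t)"
    for a b c :: "real \<Rightarrow> 'b" and l
    using small_o_add[OF small_o_diff[OF that(2,1)] that(3)] by (simp add: scaleR_diff_right)
  have "small_o n (\<lambda>t. t) (at 0) (\<lambda>t. fd T (t, x0, v, w) (0, complete_lift (Xt t) (x0, v, w))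
      - t ^ n *\<^sub>R lie_coef T X n (x0, v, w))"
  proof -
    have "((\<lambda>t. (t, x0, v, w)) \<longlongrightarrow> (0, x0, v, w)) (at 0)"
      by (intro tendsto_Pair tendsto_ident_at tendsto_const)
    from small_o_compose[OF lie_expansion[OF fin C(1) T X _ vanish] this]
    show ?thesis using U by (simp add: Xt_def[abs_def])
  qed
  moreover have "small_o n (\<lambda>t. t) (at 0) (\<lambda>t. fd T' (t, g t) (0, complete_lift (Xt' t) (g t))
      - t ^ n *\<^sub>R lie_coef T' X' n (g t))"
    using small_o_compose[OF lie_expansion[OF fin C(2) T' X' g0 vanish'] limtg]
    by (simp add: Xt'_def[abs_def])
  moreover have "small_o n (\<lambda>t. t) (at 0) (\<lambda>t. fd T (t, x0, v, w) (0, complete_lift (Xt t) (x0, v, w))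
      - fd T' (t, g t) (0, complete_lift (Xt' t) (g t)))"
  proof (rule small_o_cong[OF small_o_uminus[OF E]])
    show "\<forall>\<^sub>F t in at 0. - fd T' (t, g t) (0, \<omega> t) =
        fd T (t, x0, v, w) (0, complete_lift (Xt t) (x0, v, w))
        - fd T' (t, g t) (0, complete_lift (Xt' t) (g t))"
      using evU
    proof eventually_elim
      case (elim t)
      let ?S = "(\<lambda>x. (t, x)) -` U"
      have oS: "open ?S" by (intro open_vimage U continuous_intros)
      have sms: "smooth_on ?S (\<lambda>x. f (t, x))" "smooth_on ?S (\<lambda>x. Wf (t, x))"
        by (intro smooth_on_snd_slice[OF finite_dim_real fin U(1)] f smW)+
      have fdf: "fd (\<lambda>x. f (t, x)) x = (\<lambda>v. fd f (t, x) (0, v))" if "x \<in> ?S" for x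
        using that by (intro fd_eqI has_derivative_snd_slice df) auto
      have fdW: "fd (\<lambda>x. Wf (t, x)) x = (\<lambda>v. fd Wf (t, x) (0, v))" if "x \<in> ?S" for x
        using that by (intro fd_eqI has_derivative_snd_slice smooth_on_imp_differentiable[OF smW]) auto
      have xS: "x0 \<in> ?S" using elim by simp
      have gt: "(f (t, x0), fd (\<lambda>x. f (t, x)) x0 v, fd (\<lambda>x. f (t, x)) x0 w) = g t"
        by (simp add: g_def fdf[OF xS])
      have dT: "T differentiable (at (t, x0, v, w))"
        by (rule smooth_on_imp_differentiable[OF T]) (use U(3) elim in auto)
      have dT': "T' differentiable (at (t, g t))"
        by (rule smooth_on_imp_differentiable[OF T']) (use U(3)[OF elim] in \<open>auto simp: g_def\<close>)
      have Xsum: "(\<lambda>x. \<Sum>i\<le>n. t ^ i *\<^sub>R Y i x) differentiable (at y)"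
        if "\<And>i. Y i differentiable (at y)" for y and Y :: "nat \<Rightarrow> 'e \<Rightarrow> 'e"
        using that by (intro differentiable_sum differentiable_scaleR) auto
      \<comment> \<open>Naturality is exact at each fixed t; only the resulting defect term has to
        be estimated.\<close>
      have "fd (\<lambda>z. T (t, z)) (x0, v, w) (complete_lift (Xt t) (x0, v, w)) =
          fd (\<lambda>z. T' (t, z)) (g t) (complete_lift (Xt' t) (g t))
          - fd (\<lambda>z. T' (t, z)) (g t) (complete_lift (\<lambda>x. Wf (t, x)) (x0, v, w))"
        unfolding gt[symmetric]
      proof (rule lie_naturality[OF fin oS sms(1) xS])
        show "(\<lambda>z. T' (t, z)) differentiable
            (at (f (t, x0), fd (\<lambda>x. f (t, x)) x0 v, fd (\<lambda>x. f (t, x)) x0 w))"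
          unfolding gt using has_derivative_snd_slice[OF dT'] differentiable_def by blast
        show "Xt t differentiable (at x0)"
          unfolding Xt_def[abs_def]
          by (intro Xsum smooth_on_imp_differentiable[OF X]) (use U(3)[OF elim] in simp)
        show "Xt' t differentiable (at (f (t, x0)))"
          unfolding Xt'_def[abs_def]
          by (intro Xsum smooth_on_imp_differentiable[OF X']) (use U(3)[OF elim] in simp)
        fix x assume x: "x \<in> ?S"
        show "T (t, x, v, w) = T' (t, f (t, x), fd (\<lambda>x. f (t, x)) x v, fd (\<lambda>x. f (t, x)) x w)" for v w
          using pull x fdf[OF x] by simp
        have "linear (fd f (t, x))" using x by (intro linear_fd df) auto
        then have "fd f (t, x) (\<Sum>i\<le>n. t ^ i *\<^sub>R (0, X i x)) =
            (\<Sum>i\<le>n. t ^ i *\<^sub>R fd f (t, x) (0, X i x))"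
          by (simp only: linear_sum linear_scale)
        moreover have "(\<Sum>i\<le>n. t ^ i *\<^sub>R (0::real, X i x)) = (0, Xt t x)"
          by (simp add: Xt_def prod_eq_iff fst_sum snd_sum)
        ultimately show "Wf (t, x) = Xt' t (f (t, x)) - fd (\<lambda>x. f (t, x)) x (Xt t x)"
          unfolding fdf[OF x] by (simp add: Wf_def Xt'_def scaleR_diff_right sum_subtractf)
      qed
      moreover have "fd (\<lambda>z. T (t, z)) (x0, v, w) = (\<lambda>\<zeta>. fd T (t, x0, v, w) (0, \<zeta>))"
        "fd (\<lambda>z. T' (t, z)) (g t) = (\<lambda>\<zeta>. fd T' (t, g t) (0, \<zeta>))"
        by (rule fd_eqI[OF has_derivative_snd_slice[OF dT]], rule fd_eqI[OF has_derivative_snd_slice[OF dT']])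
      moreover have "complete_lift (\<lambda>x. Wf (t, x)) (x0, v, w) = \<omega> t"
        by (simp add: complete_lift_def \<omega>_def fdW[OF xS])
      ultimately show ?case by simp
    qed
  qed
  ultimately have "small_o n (\<lambda>t. t) (at 0)
      (\<lambda>t. t ^ n *\<^sub>R (lie_coef T X n (x0, v, w) - lie_coef T' X' n (g t)))"
    by (rule combine)
  \<comment> \<open>Continuity replaces the coefficient at the moving point \<open>g t\<close> by
    its value at \<open>g 0\<close>.\<close>
  moreover have "isCont (lie_coef T' X' n) (g 0)"
    using smooth_on_imp_continuous_on[OF smooth_on_lie_coef[OF fin C(2) T' X', where m=n]] g0
    unfolding continuous_on_eq_continuous_at[OF oC'] by (rule bspec)
  then have "(lie_coef T' X' n \<longlongrightarrow> lie_coef T' X' n (g 0)) (nhds (g 0))"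
    by (simp only: isCont_def tendsto_at_iff_tendsto_nhds)
  from tendsto_diff[OF tendsto_const filterlim_compose[OF this limg]]
  have "((\<lambda>t. lie_coef T X n (x0, v, w) - lie_coef T' X' n (g t)) \<longlongrightarrow>
      lie_coef T X n (x0, v, w) - lie_coef T' X' n (g 0)) (at 0)" .
  ultimately have "lie_coef T X n (x0, v, w) - lie_coef T' X' n (g 0) = 0"
    by (rule small_o_power_imp_zero)
  then show ?thesis by (simp add: g_def)
qed

text \<open>Differentiation in a variable other than the linear one keeps linearity. It makes Lie
  derivatives, and through \<open>linear_time_deriv\<close> also Taylor coefficients, linear in each
  vector argument.\<close>

lemma linear_fd_param:
  fixes h :: "'v::real_vector \<Rightarrow> 'a::real_normed_vector \<Rightarrow> 'b::real_normed_vector"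
  assumes "open S" "x \<in> S" and lin: "\<And>y. y \<in> S \<Longrightarrow> linear (\<lambda>v. h v y)"
    and dif: "\<And>v. h v differentiable (at x)"
  shows "linear (\<lambda>v. fd (h v) x \<xi>)"
proof (rule linearI)
  fix u v
  have "(h (u + v) has_derivative (\<lambda>\<xi>. fd (h u) x \<xi> + fd (h v) x \<xi>)) (at x)"
    by (rule has_derivative_transform_within_open[OF
          has_derivative_add[OF has_derivative_fd[OF dif] has_derivative_fd[OF dif]] assms(1,2)])
      (simp add: linear_add[OF lin])
  then show "fd (h (u + v)) x \<xi> = fd (h u) x \<xi> + fd (h v) x \<xi>" by (simp add: fd_eqI)
next
  fix r v
  have "(h (r *\<^sub>R v) has_derivative (\<lambda>\<xi>. r *\<^sub>R fd (h v) x \<xi>)) (at x)"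
    by (rule has_derivative_transform_within_open[OF
          has_derivative_scaleR_right[OF has_derivative_fd[OF dif]] assms(1,2)])
      (simp add: linear_scale[OF lin])
  then show "fd (h (r *\<^sub>R v)) x \<xi> = r *\<^sub>R fd (h v) x \<xi>" by (simp add: fd_eqI)
qed

lemma linear_time_deriv:
  assumes S: "open S" "smooth_on S h"
    and T: "open I" "t \<in> I" "\<And>s v. s \<in> I \<Longrightarrow> (s, z v) \<in> S"
    and lin: "\<And>s. s \<in> I \<Longrightarrow> linear (\<lambda>v. h (s, z v))"
  shows "linear (\<lambda>v. (time_deriv ^^ k) h (t, z v))"
  using T(2)
proof (induction k arbitrary: t)
  case 0
  then show ?case using lin T(3) by simp
next
  case (Suc k)
  note d = smooth_on_imp_differentiable[OF smooth_on_time_deriv[OF S(2)] T(3)[OF Suc.prems]]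
  have "(time_deriv ^^ Suc k) h (t, z v) = fd (\<lambda>s. (time_deriv ^^ k) h (s, z v)) t 1" for v
    using fd_eqI[OF has_derivative_fst_slice[OF d]] by (simp add: time_deriv_def)
  moreover have "linear (\<lambda>v. fd (\<lambda>s. (time_deriv ^^ k) h (s, z v)) t 1)"
  proof (rule linear_fd_param[OF T(1) Suc.prems])
    show "linear (\<lambda>v. (time_deriv ^^ k) h (s, z v))" if "s \<in> I" for s by (rule Suc.IH[OF that])
    show "(\<lambda>s. (time_deriv ^^ k) h (s, z v)) differentiable (at t)" for v
      using has_derivative_fst_slice[OF d] unfolding differentiable_def by blast
  qed
  ultimately show ?case by simp
qed

section \<open>Tensor fields on a manifold\<close>

text \<open>A tangent map between two arbitrary charts. Tangent maps in preferred charts and chart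
  transitions, the latter with the identity as map, are both instances, so one chain rule serves for
  all.\<close>

definition tmap :: "('m, 'e::real_normed_vector) chart \<Rightarrow> ('m, 'e) chart \<Rightarrow> ('m \<Rightarrow> 'm) \<Rightarrow> 'm \<Rightarrow> 'e \<Rightarrow> 'e" where
  "tmap c c' f p = fd (coord c' \<circ> f \<circ> coord_inv c) (coord c p)"

lemma transition_deriv_eq_tmap: "transition_deriv c c' p = tmap c c' id p"
  by (simp add: transition_deriv_def tmap_def)

lemma tangent_map_eq_tmap: "tangent_map A f p = tmap (chart_at A p) (chart_at A (f p)) f p"
  by (simp add: tangent_map_def tmap_def)

abbreviation chart_im :: "('m, 'e) chart \<Rightarrow> 'e set" where
  "chart_im c \<equiv> coord c ` chart_dom c"

definition tensor2_comp :: "('m, 'e::real_normed_vector) chart set \<Rightarrow> ('m, 'e) chart \<Rightarrow> ('m, 'e) tensor \<Rightarrow>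
    'e \<times> 'e \<times> 'e \<Rightarrow> real" where
  "tensor2_comp A c T = (\<lambda>(x, v, w). tensor_comp A c T x [] [v, w])"

locale manifold =
  fixes A :: "('m::{t2_space, second_countable_topology}, 'e::real_normed_vector) chart set"
  assumes manifold: "smooth_manifold A"
begin

section \<open>Charts and tangent maps\<close>

lemma fin: "finite_dim (UNIV :: 'e set)"
  using manifold by (simp add: smooth_manifold_def)

lemma
  assumes "c \<in> A"
  shows open_chart_dom: "open (chart_dom c)" and open_chart_im: "open (chart_im c)"
    and coord_inv_coord: "p \<in> chart_dom c \<Longrightarrow> coord_inv c (coord c p) = p"
    and coord_coord_inv: "x \<in> chart_im c \<Longrightarrow> coord c (coord_inv c x) = x"
    and coord_inv_in: "x \<in> chart_im c \<Longrightarrow> coord_inv c x \<in> chart_dom c"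
    and continuous_on_coord_inv: "continuous_on (chart_im c) (coord_inv c)"
proof -
  have "is_chart c" using assms manifold by (simp add: smooth_manifold_def)
  then show "open (chart_dom c)" "open (chart_im c)"
    "p \<in> chart_dom c \<Longrightarrow> coord_inv c (coord c p) = p"
    "x \<in> chart_im c \<Longrightarrow> coord c (coord_inv c x) = x"
    "x \<in> chart_im c \<Longrightarrow> coord_inv c x \<in> chart_dom c"
    "continuous_on (chart_im c) (coord_inv c)"
    unfolding is_chart_def homeomorphism_def by blast+
qed

lemma chart_at_in: "chart_at A p \<in> A" and chart_at_dom: "p \<in> chart_dom (chart_at A p)"
proof -
  have "(\<Union>c\<in>A. chart_dom c) = UNIV" using manifold by (simp add: smooth_manifold_def)
  then have "\<exists>c. c \<in> A \<and> p \<in> chart_dom c" by blast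
  from someI_ex[OF this] show "chart_at A p \<in> A" "p \<in> chart_dom (chart_at A p)"
    by (simp_all add: chart_at_def)
qed

lemma coord_image_eq:
  assumes "c \<in> A"
  shows "coord c ` (chart_dom c \<inter> V) = {x \<in> chart_im c. coord_inv c x \<in> V}"
  using coord_inv_coord[OF assms] by force

lemma open_coord_image:
  assumes "c \<in> A" "open V"
  shows "open (coord c ` (chart_dom c \<inter> V))"
proof -
  have "open (coord_inv c -` V \<inter> chart_im c)"
    using continuous_on_open_vimage[OF open_chart_im[OF assms(1)]] continuous_on_coord_inv[OF assms(1)] assms(2)
    by blast
  moreover have "coord_inv c -` V \<inter> chart_im c = {x \<in> chart_im c. coord_inv c x \<in> V}" by blast
  ultimately show ?thesis unfolding coord_image_eq[OF assms(1)] by simp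
qed

lemma smooth_map_id: "smooth_map A id"
  using manifold by (simp add: smooth_map_def smooth_manifold_def)

lemma
  assumes "smooth_map A f" "c \<in> A" "c' \<in> A"
  shows smooth_on_local_rep: "smooth_on (coord c ` (chart_dom c \<inter> f -` chart_dom c')) (coord c' \<circ> f \<circ> coord_inv c)"
    and open_local_rep: "open (coord c ` (chart_dom c \<inter> f -` chart_dom c'))"
proof -
  show "smooth_on (coord c ` (chart_dom c \<inter> f -` chart_dom c')) (coord c' \<circ> f \<circ> coord_inv c)"
    using assms by (simp add: smooth_map_def)
  have "continuous_on UNIV f" using assms(1) by (simp add: smooth_map_def)
  then have "open (f -` chart_dom c')" using open_chart_dom[OF assms(3)] by (simp add: continuous_on_open_vimage)
  then show "open (coord c ` (chart_dom c \<inter> f -` chart_dom c'))" by (rule open_coord_image[OF assms(2)])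
qed

lemma local_rep_differentiable:
  assumes "smooth_map A f" "c \<in> A" "c' \<in> A" "p \<in> chart_dom c" "f p \<in> chart_dom c'"
  shows "(coord c' \<circ> f \<circ> coord_inv c) differentiable (at (coord c p))"
  using smooth_on_imp_differentiable[OF smooth_on_local_rep[OF assms(1-3)]] assms(4,5) by blast

lemma linear_tmap:
  assumes "smooth_map A f" "c \<in> A" "c' \<in> A" "p \<in> chart_dom c" "f p \<in> chart_dom c'"
  shows "linear (tmap c c' f p)"
  unfolding tmap_def by (rule linear_fd[OF local_rep_differentiable[OF assms]])

lemma tmap_comp:
  assumes f: "smooth_map A f" and g: "smooth_map A g" and c: "c \<in> A" "c' \<in> A" "c'' \<in> A"
    and p: "p \<in> chart_dom c" "f p \<in> chart_dom c'" "g (f p) \<in> chart_dom c''"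
  shows "tmap c' c'' g (f p) (tmap c c' f p v) = tmap c c'' (g \<circ> f) p v"
proof -
  let ?G = "coord c'' \<circ> g \<circ> coord_inv c'" and ?F = "coord c' \<circ> f \<circ> coord_inv c"
  have Fp: "?F (coord c p) = coord c' (f p)" using coord_inv_coord c p by simp
  have "((\<lambda>x. ?G (?F x)) has_derivative (\<lambda>v. tmap c' c'' g (f p) (tmap c c' f p v))) (at (coord c p))"
    using fd_chain[of ?G ?F "coord c p"] local_rep_differentiable[OF g c(2,3) p(2,3)]
      local_rep_differentiable[OF f c(1,2) p(1,2)] unfolding Fp tmap_def by blast
  then have "((coord c'' \<circ> (g \<circ> f) \<circ> coord_inv c) has_derivative
      (\<lambda>v. tmap c' c'' g (f p) (tmap c c' f p v))) (at (coord c p))"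
    by (rule has_derivative_transform_within_open[OF _ open_local_rep[OF f c(1,2)]])
      (use p c coord_inv_coord in auto)
  then show ?thesis unfolding tmap_def[of c c''] by (simp add: fd_eqI)
qed

lemma tmap_id:
  assumes "c \<in> A" "p \<in> chart_dom c"
  shows "tmap c c id p = id"
proof -
  have "((coord c \<circ> id \<circ> coord_inv c) has_derivative (\<lambda>v. v)) (at (coord c p))"
    by (rule has_derivative_transform_within_open[OF has_derivative_ident open_chart_im[OF assms(1)]])
      (use assms coord_inv_coord in auto)
  then show ?thesis by (auto simp: tmap_def fd_eqI)
qed

lemma tmap_inverse:
  assumes "smooth_map A f" "smooth_map A g" "\<And>p. g (f p) = p" "c \<in> A" "c' \<in> A"
    "p \<in> chart_dom c" "f p \<in> chart_dom c'"
  shows "tmap c' c g (f p) (tmap c c' f p v) = v"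
proof -
  have "g \<circ> f = id" using assms(3) by auto
  then show ?thesis using tmap_comp[OF assms(1,2,4,5,4,6,7), of v] assms(3,6) tmap_id[OF assms(4,6)] by simp
qed

lemma tmap_change:
  assumes f: "smooth_map A f" and c: "c \<in> A" "c' \<in> A" "d \<in> A" "d' \<in> A"
    and p: "p \<in> chart_dom c" "f p \<in> chart_dom c'" "p \<in> chart_dom d" "f p \<in> chart_dom d'"
  shows "tmap c' d' id (f p) (tmap c c' f p v) = tmap d d' f p (tmap c d id p v)"
  using tmap_comp[OF f smooth_map_id c(1,2,4), of p v] tmap_comp[OF smooth_map_id f c(1,3,4), of p v] p
  by simp

lemma tangent_map_comp:
  assumes "smooth_map A f" "smooth_map A g"
  shows "tangent_map A (g \<circ> f) p v = tangent_map A g (f p) (tangent_map A f p v)"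
  using tmap_comp[OF assms chart_at_in chart_at_in chart_at_in chart_at_dom chart_at_dom chart_at_dom]
  by (simp add: tangent_map_eq_tmap)

section \<open>Components under maps and changes of chart\<close>

lemma tensor_comp_coord:
  assumes "c \<in> A" "p \<in> chart_dom c"
  shows "tensor_comp A c T (coord c p) [] vs = T p [] (map (tmap c (chart_at A p) id p) vs)"
  using coord_inv_coord[OF assms] by (simp add: tensor_comp_def Let_def transition_deriv_eq_tmap)

lemma tensor_comp_chart_at: "tensor_comp A (chart_at A p) T (coord (chart_at A p) p) [] vs = T p [] vs"
  using tensor_comp_coord[OF chart_at_in chart_at_dom] tmap_id[OF chart_at_in chart_at_dom]
  by simp

lemma tensor_comp_related:
  assumes f: "smooth_map A f" and c: "c \<in> A" "c' \<in> A" and p: "p \<in> chart_dom c" "f p \<in> chart_dom c'"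
    and rel: "\<And>vs. S p [] vs = T (f p) [] (map (tangent_map A f p) vs)"
  shows "tensor_comp A c S (coord c p) [] vs = tensor_comp A c' T (coord c' (f p)) [] (map (tmap c c' f p) vs)"
  using tmap_change[OF f c chart_at_in chart_at_in p chart_at_dom chart_at_dom]
  by (simp add: tensor_comp_coord c p rel tangent_map_eq_tmap o_def)

lemma tangent_map_id: "tangent_map A id p = id"
  by (simp add: tangent_map_eq_tmap tmap_id[OF chart_at_in chart_at_dom])

lemma tensor_comp_change:
  assumes "c \<in> A" "c' \<in> A" "p \<in> chart_dom c" "p \<in> chart_dom c'"
  shows "tensor_comp A c T (coord c p) [] vs = tensor_comp A c' T (coord c' p) [] (map (tmap c c' id p) vs)"
  using tensor_comp_related[OF smooth_map_id assms(1,2), of p T T vs] assms by (simp add: tangent_map_id)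

lemma vfield_comp_coord:
  assumes "c \<in> A" "p \<in> chart_dom c"
  shows "vfield_comp A c X (coord c p) = tmap (chart_at A p) c id p (X p)"
  using coord_inv_coord[OF assms] by (simp add: vfield_comp_def Let_def transition_deriv_eq_tmap)

lemma vfield_comp_related:
  assumes f: "smooth_map A f" and c: "c \<in> A" "c' \<in> A" and p: "p \<in> chart_dom c" "f p \<in> chart_dom c'"
    and rel: "tangent_map A f p v = X (f p)"
  shows "vfield_comp A c' X (coord c' (f p)) = tmap c c' f p (tmap (chart_at A p) c id p v)"
  using tmap_change[OF f chart_at_in chart_at_in c chart_at_dom chart_at_dom p]
  by (simp add: vfield_comp_coord c p rel[symmetric] tangent_map_eq_tmap)

lemma linear_tensor2_comp:
  assumes "tensor_at 0 2 (T p)" "c \<in> A" "p \<in> chart_dom c"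
  shows "linear (\<lambda>v. tensor2_comp A c T (coord c p, v, w))"
    "linear (\<lambda>w. tensor2_comp A c T (coord c p, v, w))"
proof -
  let ?\<tau> = "tmap c (chart_at A p) id p"
  have ml: "multilinear 2 (T p [])" using assms(1) by (simp add: tensor_at_def)
  have lin: "linear ?\<tau>"
    using linear_tmap[OF smooth_map_id assms(2) chart_at_in assms(3)] chart_at_dom by simp
  have "linear (\<lambda>v. T p [] [v, w'])" "linear (\<lambda>w. T p [] [v', w])" for v' w'
    using ml[unfolded multilinear_def, rule_format, of "[v', w']" 0]
      ml[unfolded multilinear_def, rule_format, of "[v', w']" 1] by simp_all
  from linear_compose[OF lin this(1)] linear_compose[OF lin this(2)]
  show "linear (\<lambda>v. tensor2_comp A c T (coord c p, v, w))"
    "linear (\<lambda>w. tensor2_comp A c T (coord c p, v, w))"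
    by (simp_all add: tensor2_comp_def tensor_comp_coord assms o_def)
qed

text \<open>A smooth family has smooth components for fixed vectors. Linearity in the two vectors,
  used one argument at a time, gives smoothness in parameter, point and vectors together, as the
  complete-lift calculus requires.\<close>

lemma smooth_on_tensor2_comp_family:
  fixes T :: "'p::real_normed_vector \<Rightarrow> ('m, 'e) tensor"
  assumes finp: "finite_dim (UNIV :: 'p set)" and T: "smooth_tensor_family A 0 2 T" and c: "c \<in> A"
  shows "smooth_on (UNIV \<times> (chart_im c \<times> UNIV)) (\<lambda>(u, z). tensor2_comp A c (T u) z)"
proof -
  let ?S = "UNIV \<times> (chart_im c \<times> UNIV) :: ('p \<times> 'e \<times> 'e \<times> 'e) set"
  have o1: "open (UNIV \<times> chart_im c :: ('p \<times> 'e) set)" by (intro open_Times open_UNIV open_chart_im c)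
  have o: "open ?S" by (intro open_Times open_UNIV open_chart_im c)
  have sm: "smooth_on (UNIV \<times> chart_im c) (\<lambda>(u, x). tensor_comp A c (T u) x [] [v, w])" for v w
    using T c by (simp add: smooth_tensor_family_def)
  have tat: "tensor_at 0 2 (T u p)" for u p using T by (simp add: smooth_tensor_family_def)
  have lin: "linear (\<lambda>v. tensor2_comp A c (T u) (x, v, w))" "linear (\<lambda>w. tensor2_comp A c (T u) (x, v, w))"
    if x: "x \<in> chart_im c" for u x v w
  proof -
    obtain p where p: "p \<in> chart_dom c" "x = coord c p" using x by blast
    show "linear (\<lambda>v. tensor2_comp A c (T u) (x, v, w))" "linear (\<lambda>w. tensor2_comp A c (T u) (x, v, w))"
      unfolding p(2) by (rule linear_tensor2_comp[of "T u" p, OF tat c p(1)])+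
  qed
  have fst3: "smooth_on ?S (\<lambda>q. (fst q, fst (snd q)))"
    by (intro smooth_on_Pair[OF o] smooth_on_fst[OF o] smooth_on_snd[OF o] smooth_on_id)
  have "smooth_on ?S (\<lambda>q. tensor_comp A c (T (fst q)) (fst (snd q)) [] [v, w])" for v w
    using smooth_on_compose[OF finite_dim_prod[OF finp fin] sm[of v w] fst3 o o1] by auto
  then have sm0: "smooth_on ?S (\<lambda>q. tensor2_comp A c (T (fst q)) (fst (snd q), v, w))" for v w
    by (simp add: tensor2_comp_def)
  have l1: "linear (\<lambda>v. tensor2_comp A c (T (fst q)) (fst (snd q), v, w))"
    and l2: "linear (\<lambda>w. tensor2_comp A c (T (fst q)) (fst (snd q), v, w))"
    if "q \<in> ?S" for q v w
    by (rule lin; use that in auto)+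
  have sv: "smooth_on ?S (\<lambda>q. fst (snd (snd q)))" and sw: "smooth_on ?S (\<lambda>q. snd (snd (snd q)))"
    by (intro smooth_on_fst[OF o] smooth_on_snd[OF o] smooth_on_id)+
  have sm1: "smooth_on ?S (\<lambda>q. tensor2_comp A c (T (fst q)) (fst (snd q), fst (snd (snd q)), w))" for w
    by (rule smooth_on_parametric_linear[OF fin o l1 sm0 sv])
  have "smooth_on ?S (\<lambda>q. tensor2_comp A c (T (fst q)) (fst (snd q), fst (snd (snd q)), snd (snd (snd q))))"
    by (rule smooth_on_parametric_linear[OF fin o l2 sm1 sw])
  then show ?thesis by (simp add: split_def)
qed

text \<open>A single tensor field is viewed as a constant family over the reals and then
  sliced.\<close>

lemma smooth_on_tensor2_comp:
  assumes "tensor_field A 0 2 T" "c \<in> A"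
  shows "smooth_on (chart_im c \<times> UNIV) (tensor2_comp A c T)"
proof -
  have "smooth_on (UNIV \<times> chart_im c) (\<lambda>p :: real \<times> 'e. tensor_comp A c T (snd p) \<alpha>s vs)" if "c \<in> A" for c \<alpha>s vs
  proof -
    have o: "open (UNIV \<times> chart_im c :: (real \<times> 'e) set)" by (intro open_Times open_UNIV open_chart_im that)
    have "smooth_on (chart_im c) (\<lambda>x. tensor_comp A c T x \<alpha>s vs)"
      using assms(1) that by (simp add: tensor_field_def)
    from smooth_on_compose[OF fin this smooth_on_snd[OF o smooth_on_id] o open_chart_im[OF that]]
    show ?thesis by auto
  qed
  then have "smooth_tensor_family A 0 2 (\<lambda>_::real. T)"
    using assms(1) by (simp add: smooth_tensor_family_def tensor_field_def split_def)
  from smooth_on_tensor2_comp_family[OF finite_dim_real this assms(2)]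
  have "smooth_on (UNIV \<times> (chart_im c \<times> UNIV)) (\<lambda>p :: real \<times> 'e \<times> 'e \<times> 'e. tensor2_comp A c T (snd p))"
    by (simp add: split_def)
  from smooth_on_snd_slice[OF finite_dim_real finite_dim_prod[OF fin finite_dim_prod[OF fin fin]] _ this, of 0]
  show ?thesis by (simp add: vimage_def open_Times open_chart_im[OF assms(2)])
qed

lemma tensor_field_02I:
  assumes z: "\<And>p \<alpha>s vs. length \<alpha>s \<noteq> 0 \<or> length vs \<noteq> 2 \<Longrightarrow> T p \<alpha>s vs = 0"
    and l1: "\<And>p w. linear (\<lambda>v. T p [] [v, w])" and l2: "\<And>p v. linear (\<lambda>w. T p [] [v, w])"
    and s: "\<And>c v w. c \<in> A \<Longrightarrow> smooth_on (chart_im c) (\<lambda>x. tensor_comp A c T x [] [v, w])"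
  shows "tensor_field A 0 2 T"
  unfolding tensor_field_def
proof (intro conjI allI ballI)
  fix p
  have "multilinear 2 (T p \<alpha>s)" for \<alpha>s
    unfolding multilinear_def
  proof (intro allI impI)
    fix xs :: "'e list" and i assume xs: "length xs = 2" "i < (2::nat)"
    then obtain a b where ab: "xs = [a, b]" by (metis (no_types, opaque_lifting) One_nat_def Suc_1 length_0_conv length_Suc_conv)
    consider "i = 0" | "i = 1" using xs by linarith
    then show "linear (\<lambda>x. T p \<alpha>s (xs[i := x]))"
    proof cases
      case 1
      then show ?thesis using l1[of p b] z[of \<alpha>s] by (cases \<alpha>s) (simp_all add: ab linear_zero)
    next
      case 2
      then show ?thesis using l2[of p a] z[of \<alpha>s] by (cases \<alpha>s) (simp_all add: ab linear_zero)
    qed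
  qed
  then show "tensor_at 0 2 (T p)" using z by (auto simp: tensor_at_def multilinear_def)
next
  fix c \<alpha>s and vs :: "'e list" assume c: "c \<in> A"
  show "smooth_on (chart_im c) (\<lambda>x. tensor_comp A c T x \<alpha>s vs)"
  proof (cases "length \<alpha>s \<noteq> 0 \<or> length vs \<noteq> 2")
    case True
    then have "tensor_comp A c T x \<alpha>s vs = 0" for x by (simp add: tensor_comp_def Let_def z)
    then show ?thesis by (simp add: smooth_on_const)
  next
    case False
    then obtain a b where "vs = [a, b]" "\<alpha>s = []"
      by (metis (no_types, opaque_lifting) One_nat_def Suc_1 length_0_conv length_Suc_conv)
    then show ?thesis using s[OF c] by simp
  qed
qed

lemma tensor_field_zero: "tensor_field A 0 2 T \<Longrightarrow> length \<alpha>s \<noteq> 0 \<or> length vs \<noteq> 2 \<Longrightarrow> T p \<alpha>s vs = 0"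
  by (auto simp: tensor_field_def tensor_at_def)

lemma tensor_field_linear:
  assumes "tensor_field A 0 2 T"
  shows "linear (\<lambda>v. T p [] [v, w])" "linear (\<lambda>w. T p [] [v, w])"
proof -
  have "tensor_at 0 2 (T p)" using assms by (simp add: tensor_field_def)
  from linear_tensor2_comp[of T p, OF this chart_at_in chart_at_dom]
  show "linear (\<lambda>v. T p [] [v, w])" "linear (\<lambda>w. T p [] [v, w])"
    by (simp_all add: tensor2_comp_def tensor_comp_chart_at)
qed

lemma tensor_field_sum:
  assumes "\<And>i. i \<in> I \<Longrightarrow> tensor_field A 0 2 (T i)"
  shows "tensor_field A 0 2 (\<lambda>p \<alpha>s vs. \<Sum>i\<in>I. T i p \<alpha>s vs)"
proof (rule tensor_field_02I)
  fix p and \<alpha>s :: "('e \<Rightarrow>\<^sub>L real) list" and vs :: "'e list" assume "length \<alpha>s \<noteq> 0 \<or> length vs \<noteq> 2"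
  then show "(\<Sum>i\<in>I. T i p \<alpha>s vs) = 0" using assms tensor_field_zero by (meson sum.neutral)
next
  fix c and v w :: 'e assume c: "c \<in> A"
  have "smooth_on (chart_im c) (\<lambda>x. \<Sum>i\<in>I. tensor_comp A c (T i) x [] [v, w])"
    using assms c by (intro smooth_on_sum open_chart_im) (auto simp: tensor_field_def)
  then show "smooth_on (chart_im c) (\<lambda>x. tensor_comp A c (\<lambda>p \<alpha>s vs. \<Sum>i\<in>I. T i p \<alpha>s vs) x [] [v, w])"
    by (simp add: tensor_comp_def Let_def)
qed (intro linear_compose_sum ballI tensor_field_linear assms, assumption)+

lemma smooth_on_vfield_comp: "vector_field A X \<Longrightarrow> c \<in> A \<Longrightarrow> smooth_on (chart_im c) (vfield_comp A c X)"
  by (simp add: vector_field_def)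

text \<open>The partial derivatives of the component function in its vector arguments are
  evaluations of the tensor, by linearity; hence the two forms agree. The first feeds the calculus
  in charts, the second shows linearity in the vectors.\<close>

lemma lie_deriv_eq:
  assumes T: "tensor_field A 0 2 T"
  shows "lie_deriv A X T p [] [v, w] = fd (tensor2_comp A (chart_at A p) T) (coord (chart_at A p) p, v, w)
    (complete_lift (vfield_comp A (chart_at A p) X) (coord (chart_at A p) p, v, w))"
    and "lie_deriv A X T p [] [v, w] =
      fd (\<lambda>y. tensor2_comp A (chart_at A p) T (y, v, w)) (coord (chart_at A p) p)
        (vfield_comp A (chart_at A p) X (coord (chart_at A p) p))
      + T p [] [fd (vfield_comp A (chart_at A p) X) (coord (chart_at A p) p) v, w]
      + T p [] [v, fd (vfield_comp A (chart_at A p) X) (coord (chart_at A p) p) w]"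
proof -
  let ?c = "chart_at A p"
  let ?x = "coord ?c p"
  let ?T = "tensor2_comp A ?c T"
  let ?X = "vfield_comp A ?c X"
  let ?DX = "fd ?X ?x"
  have x: "?x \<in> chart_im ?c" using chart_at_dom by blast
  have sum2: "(\<Sum>i<Suc (Suc 0). g i) = g 0 + g 1" for g :: "nat \<Rightarrow> real" by simp
  show eq: "lie_deriv A X T p [] [v, w] = fd (\<lambda>y. ?T (y, v, w)) ?x (?X ?x) + T p [] [?DX v, w] + T p [] [v, ?DX w]"
    by (simp add: lie_deriv_def Let_def tensor2_comp_def tensor_comp_chart_at sum2)
  have d: "?T differentiable (at (?x, v, w))"
    by (rule smooth_on_imp_differentiable[OF smooth_on_tensor2_comp[OF T chart_at_in]]) (use x in auto)
  interpret D: linear "fd ?T (?x, v, w)" by (rule linear_fd[OF d])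
  have lin: "bounded_linear (\<lambda>v. T p [] [v, w])" "bounded_linear (\<lambda>w. T p [] [v, w])" for v w
    by (intro bounded_linear_finite_dim[OF fin] tensor_field_linear[OF T])+
  have "((\<lambda>y. (y, v, w)) has_derivative (\<lambda>h. (h, 0, 0))) (at ?x)"
    "((\<lambda>v. (?x, v, w)) has_derivative (\<lambda>h. (0, h, 0))) (at v)"
    "((\<lambda>w. (?x, v, w)) has_derivative (\<lambda>h. (0, 0, h))) (at w)"
    by (auto intro!: derivative_eq_intros simp: zero_prod_def)
  note comp = this[THEN has_derivative_compose, OF has_derivative_fd[OF d]]
  have "((\<lambda>v. ?T (?x, v, w)) has_derivative (\<lambda>v. T p [] [v, w])) (at v)"
    using bounded_linear_imp_has_derivative[OF lin(1)] by (simp add: tensor2_comp_def tensor_comp_chart_at)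
  from has_derivative_unique[OF comp(2) this]
  have 2: "fd ?T (?x, v, w) (0, h, 0) = T p [] [h, w]" for h by metis
  have "((\<lambda>w. ?T (?x, v, w)) has_derivative (\<lambda>w. T p [] [v, w])) (at w)"
    using bounded_linear_imp_has_derivative[OF lin(2)] by (simp add: tensor2_comp_def tensor_comp_chart_at)
  from has_derivative_unique[OF comp(3) this]
  have 3: "fd ?T (?x, v, w) (0, 0, h) = T p [] [v, h]" for h by metis
  have 1: "fd (\<lambda>y. ?T (y, v, w)) ?x h = fd ?T (?x, v, w) (h, 0, 0)" for h
    using fd_eqI[OF comp(1)] by metis
  have "complete_lift ?X (?x, v, w) = (?X ?x, 0, 0) + ((0, ?DX v, 0) + (0, 0, ?DX w))"
    by (simp add: complete_lift_def)
  then show "lie_deriv A X T p [] [v, w] = fd ?T (?x, v, w) (complete_lift ?X (?x, v, w))"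
    unfolding eq by (simp only: D.add 1 2 3 add.assoc)
qed

text \<open>The Lie derivative at each point is computed in that point's preferred chart, and these
  choices need not vary continuously. Naturality under the transition to \<open>c\<close>, where the
  defect is identically 0, gives one formula on the whole chart and with it smoothness.\<close>

lemma tensor_comp_lie_deriv:
  assumes T: "tensor_field A 0 2 T" and X: "vector_field A X" and c: "c \<in> A" and x: "x \<in> chart_im c"
  shows "tensor_comp A c (lie_deriv A X T) x [] [v, w] =
    fd (tensor2_comp A c T) (x, v, w) (complete_lift (vfield_comp A c X) (x, v, w))"
proof -
  obtain p where p: "p \<in> chart_dom c" "x = coord c p" using x by blast
  let ?d = "chart_at A p"
  define f where "f = coord ?d \<circ> id \<circ> coord_inv c"
  define S where "S = coord c ` (chart_dom c \<inter> id -` chart_dom ?d)"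
  have S: "open S" "smooth_on S f" "x \<in> S"
    using open_local_rep[OF smooth_map_id c chart_at_in] smooth_on_local_rep[OF smooth_map_id c chart_at_in]
      p chart_at_dom by (auto simp: S_def f_def)
  have fx: "f x = coord ?d p" using coord_inv_coord[OF c p(1)] by (simp add: f_def p)
  have fdf: "fd f x = tmap c ?d id p" by (simp add: f_def tmap_def p)
  have q: "\<exists>q. y = coord c q \<and> q \<in> chart_dom c \<and> q \<in> chart_dom ?d \<and> f y = coord ?d q \<and> fd f y = tmap c ?d id q"
    if "y \<in> S" for y
    using that coord_inv_coord[OF c] by (auto simp: S_def f_def tmap_def)
  have "fd (tensor2_comp A c T) (x, v, w) (complete_lift (vfield_comp A c X) (x, v, w)) =
      fd (tensor2_comp A ?d T) (f x, fd f x v, fd f x w)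
        (complete_lift (vfield_comp A ?d X) (f x, fd f x v, fd f x w))
      - fd (tensor2_comp A ?d T) (f x, fd f x v, fd f x w) (complete_lift (\<lambda>x. 0) (x, v, w))"
  proof (rule lie_naturality[OF fin S])
    have im: "f x \<in> chart_im ?d" using fx chart_at_dom by auto
    show dT: "tensor2_comp A ?d T differentiable (at (f x, fd f x v, fd f x w))"
      by (rule smooth_on_imp_differentiable[OF smooth_on_tensor2_comp[OF T chart_at_in]]) (use im in auto)
    show "vfield_comp A c X differentiable (at x)"
      by (rule smooth_on_imp_differentiable[OF smooth_on_vfield_comp[OF X c] x])
    show "vfield_comp A ?d X differentiable (at (f x))"
      by (rule smooth_on_imp_differentiable[OF smooth_on_vfield_comp[OF X chart_at_in] im])
    fix y assume "y \<in> S"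
    then obtain q where q: "y = coord c q" "q \<in> chart_dom c" "q \<in> chart_dom ?d" "f y = coord ?d q"
      "fd f y = tmap c ?d id q" using q by blast
    show "tensor2_comp A c T (y, v, w) = tensor2_comp A ?d T (f y, fd f y v, fd f y w)" for v w
      using tensor_comp_change[OF c chart_at_in q(2,3)] by (simp add: tensor2_comp_def q(4,5)) (simp add: q(1))
    show "0 = vfield_comp A ?d X (f y) - fd f y (vfield_comp A c X y)"
      using vfield_comp_related[OF smooth_map_id c chart_at_in q(2), of p "X q" X] q(2,3) 
      by (simp add: q(4,5) tangent_map_id) (simp add: q(1) vfield_comp_coord[OF c q(2)])
  qed
  moreover have "complete_lift (\<lambda>x. 0) (x, v, w) = 0"
    by (simp add: complete_lift_def zero_prod_def)
  moreover have "linear (fd (tensor2_comp A ?d T) (f x, fd f x v, fd f x w))"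
    by (intro linear_fd smooth_on_imp_differentiable[OF smooth_on_tensor2_comp[OF T chart_at_in]])
      (use fx chart_at_dom in auto)
  moreover have "tensor_comp A c (lie_deriv A X T) x [] [v, w] = lie_deriv A X T p [] [fd f x v, fd f x w]"
    by (simp add: p(2) tensor_comp_coord[OF c p(1)] fdf[unfolded p(2)])
  ultimately show ?thesis
    by (simp add: lie_deriv_eq(1)[OF T] fx linear_0)
qed

lemma tensor_field_lie_deriv:
  assumes T: "tensor_field A 0 2 T" and X: "vector_field A X"
  shows "tensor_field A 0 2 (lie_deriv A X T)"
proof (rule tensor_field_02I)
  fix p and \<alpha>s :: "('e \<Rightarrow>\<^sub>L real) list" and vs :: "'e list" assume *: "length \<alpha>s \<noteq> 0 \<or> length vs \<noteq> 2"
  have "tensor_comp A c T y \<beta>s ws = 0" if "length \<beta>s = length \<alpha>s" "length ws = length vs" for c y \<beta>s ws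
    using that * by (simp add: tensor_comp_def Let_def tensor_field_zero[OF T])
  then show "lie_deriv A X T p \<alpha>s vs = 0" by (simp add: lie_deriv_def Let_def)
next
  fix p
  let ?c = "chart_at A p"
  let ?x = "coord ?c p"
  have x: "?x \<in> chart_im ?c" using chart_at_dom by blast
  have DX: "linear (fd (vfield_comp A ?c X) ?x)"
    by (intro linear_fd smooth_on_imp_differentiable[OF smooth_on_vfield_comp[OF X chart_at_in] x])
  have tat: "tensor_at 0 2 (T q)" for q using T by (simp add: tensor_field_def)
  have lin: "linear (\<lambda>v. tensor2_comp A ?c T (y, v, w))" "linear (\<lambda>w. tensor2_comp A ?c T (y, v, w))"
    if "y \<in> chart_im ?c" for y v w
    using linear_tensor2_comp[OF tat chart_at_in] that by auto
  have dif: "(\<lambda>y. tensor2_comp A ?c T (y, v, w)) differentiable (at ?x)" for v w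
    using has_derivative_fst_slice[OF smooth_on_imp_differentiable[OF
          smooth_on_tensor2_comp[OF T chart_at_in], of "(?x, v, w)" p]] x
    by (auto simp: differentiable_def)
  note L = linear_fd_param[OF open_chart_im[OF chart_at_in] x]
  show "linear (\<lambda>v. lie_deriv A X T p [] [v, w])" for w
    unfolding lie_deriv_eq(2)[OF T]
    by (intro linear_compose_add L[of "\<lambda>v y. tensor2_comp A ?c T (y, v, w)"] lin dif tensor_field_linear[OF T]
        linear_compose[OF DX tensor_field_linear(1)[OF T], unfolded o_def])
  show "linear (\<lambda>w. lie_deriv A X T p [] [v, w])" for v
    unfolding lie_deriv_eq(2)[OF T]
    by (intro linear_compose_add L[of "\<lambda>w y. tensor2_comp A ?c T (y, v, w)"] lin dif tensor_field_linear[OF T]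
        linear_compose[OF DX tensor_field_linear(2)[OF T], unfolded o_def])
next
  fix c and v w :: 'e assume c: "c \<in> A"
  have fin3: "finite_dim (UNIV :: ('e \<times> 'e \<times> 'e) set)" by (intro finite_dim_prod fin)
  have o: "open (chart_im c)" by (rule open_chart_im[OF c])
  then have o3: "open (chart_im c \<times> (UNIV :: ('e \<times> 'e) set))" by (intro open_Times open_UNIV)
  have in3: "smooth_on (chart_im c) (\<lambda>x. (x, v, w))"
    by (intro smooth_on_Pair[OF o] smooth_on_id smooth_on_const)
  have "smooth_on (chart_im c) (\<lambda>x. fd (tensor2_comp A c T) (x, v, w) (complete_lift (vfield_comp A c X) (x, v, w)))"
    by (intro smooth_on_fd_apply[OF fin3 o o3 smooth_on_tensor2_comp[OF T c] in3]
        smooth_on_compose[OF fin3 smooth_on_complete_lift[OF fin o smooth_on_vfield_comp[OF X c]] in3 o o3]) auto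
  then show "smooth_on (chart_im c) (\<lambda>x. tensor_comp A c (lie_deriv A X T) x [] [v, w])"
    by (rule smooth_on_cong[OF o, rotated]) (rule tensor_comp_lie_deriv[OF T X c, symmetric])
qed

end

section \<open>Formal Lie derivatives on a manifold\<close>

lemma iterated_vector_derivative_zero:
  "((\<lambda>h t. vector_derivative h (at t)) ^^ k) (\<lambda>t. 0) = (\<lambda>t::real. 0)"
  by (induction k) simp_all

text \<open>A curve is regarded as a function of time and a dummy real variable, which brings it
  under \<open>Taylor_time\<close>.\<close>

lemma Taylor_curve:
  fixes P :: "real \<Rightarrow> 'b::real_normed_vector"
  assumes I: "open I" "0 \<in> I" and P: "smooth_on I P"
  shows "small_o n (\<lambda>t. t) (at 0) (\<lambda>t. P t -
    (\<Sum>k\<le>n. t ^ k *\<^sub>R (((\<lambda>h t. vector_derivative h (at t)) ^^ k) P 0 /\<^sub>R fact k)))"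
proof -
  let ?S = "I \<times> (UNIV :: real set)"
  define h where "h = (\<lambda>p :: real \<times> real. P (fst p))"
  have o: "open ?S" by (intro open_Times I open_UNIV)
  have sm: "smooth_on ?S h"
    unfolding h_def using smooth_on_compose[OF finite_dim_real P smooth_on_fst[OF o smooth_on_id] o I(1)]
    by auto
  have z: "(0, 0) \<in> ?S" using I by simp
  have "filterlim (\<lambda>t. (t, 0::real)) (nhds (0::real, 0)) (at 0)"
    by (intro tendsto_Pair tendsto_ident_at tendsto_const)
  from small_o_compose[OF Taylor_time[OF o sm z] this]
  have "small_o n (\<lambda>t. t) (at 0) (\<lambda>t. h (t, 0) - (\<Sum>k\<le>n. (t ^ k / fact k) *\<^sub>R (time_deriv ^^ k) h (0, 0)))"
    by simp
  then show ?thesis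
    using iterated_vector_derivative_eq[OF o sm z, symmetric]
    by (simp add: h_def divide_inverse)
qed

text \<open>Kronecker's theorem: the multiples of \<open>a\<close> are dense modulo 2 pi, so every
  value of \<open>g\<close> is a limit of values equal to \<open>g 0\<close>.\<close>

lemma continuous_periodic_constant:
  fixes g :: "real \<Rightarrow> real"
  assumes cont: "\<And>\<theta>. isCont g \<theta>" and a: "\<And>\<theta>. g (\<theta> + a) = g \<theta>" and p: "\<And>\<theta>. g (\<theta> + 2 * pi) = g \<theta>"
    and irr: "a / (2 * pi) \<notin> \<rat>"
  shows "g \<theta> = g 0"
proof -
  have na: "g (\<theta> + real k * a) = g \<theta>" for \<theta> k
    by (induction k) (use a[of "\<theta> + real k * a" for k] in \<open>auto simp: algebra_simps\<close>)
  have np: "g (\<theta> + real k * (2 * pi)) = g \<theta>" for \<theta> k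
    by (induction k) (use p[of "\<theta> + real k * (2 * pi)" for k] in \<open>auto simp: algebra_simps\<close>)
  have ip: "g (\<theta> - 2 * pi * of_int m) = g \<theta>" for \<theta> m
  proof (cases "m \<ge> 0")
    case True
    then show ?thesis using np[of "\<theta> - 2 * pi * of_int m" "nat m"] by (simp add: algebra_simps)
  next
    case False
    then show ?thesis using np[of \<theta> "nat (- m)"] by (simp add: algebra_simps)
  qed
  \<comment> \<open>The position of theta on the circle of length 1, the normalisation in which the
    approximation theorem is stated.\<close>
  define \<alpha> where "\<alpha> = frac (\<theta> / (2 * pi))"
  have \<alpha>: "0 \<le> \<alpha>" "\<alpha> \<le> 1" by (simp_all add: \<alpha>_def frac_ge_0 frac_lt_1 less_imp_le)
  have frac: "2 * pi * frac x = 2 * pi * x - 2 * pi * of_int \<lfloor>x\<rfloor>" for x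
    by (simp add: frac_def algebra_simps)
  have "g (2 * pi * \<alpha>) = g \<theta>"
    unfolding \<alpha>_def frac ip by simp
  moreover have "\<bar>g (2 * pi * \<alpha>) - g 0\<bar> \<le> e" if "e > 0" for e
  proof -
    obtain d where d: "d > 0" "\<And>x. \<bar>x - 2 * pi * \<alpha>\<bar> < d \<Longrightarrow> \<bar>g x - g (2 * pi * \<alpha>)\<bar> < e"
      using cont[of "2 * pi * \<alpha>"] \<open>e > 0\<close> unfolding continuous_at_eps_delta dist_real_def by blast
    have "d / (2 * pi) > 0" using d(1) by simp
    then obtain k where k: "\<bar>frac (real k * (a / (2 * pi))) - \<alpha>\<bar> < d / (2 * pi)"
      using Kronecker_approx_1_explicit[OF irr \<alpha>] by metis
    let ?y = "2 * pi * frac (real k * (a / (2 * pi)))"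
    have "\<bar>?y - 2 * pi * \<alpha>\<bar> = 2 * pi * \<bar>frac (real k * (a / (2 * pi))) - \<alpha>\<bar>"
      by (simp add: abs_mult flip: right_diff_distrib)
    also have "\<dots> < d" using k by (simp add: field_simps)
    finally have "\<bar>g ?y - g (2 * pi * \<alpha>)\<bar> < e" by (rule d)
    moreover have "g ?y = g 0"
      unfolding frac ip using na[of 0 k] by simp
    ultimately show ?thesis by linarith
  qed
  then have "\<bar>g (2 * pi * \<alpha>) - g 0\<bar> \<le> 0" by (metis add_0 field_le_epsilon)
  ultimately show ?thesis by simp
qed

context manifold
begin

section \<open>Restriction of the parameter to a line\<close>

lemma smooth_tensor_family_line:
  fixes T :: "'g::real_normed_vector \<Rightarrow> ('m, 'e) tensor"
  assumes fing: "finite_dim (UNIV :: 'g set)" and T: "smooth_tensor_family A r s T"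
  shows "smooth_tensor_family A r s (\<lambda>t::real. T (t *\<^sub>R \<gamma>))"
  unfolding smooth_tensor_family_def
proof (intro conjI allI ballI)
  show "tensor_at r s (T (u *\<^sub>R \<gamma>) p)" for u p using T by (simp add: smooth_tensor_family_def)
  fix c \<alpha>s vs assume c: "c \<in> A"
  have o: "open (UNIV \<times> chart_im c :: (real \<times> 'e) set)" "open (UNIV \<times> chart_im c :: ('g \<times> 'e) set)"
    by (intro open_Times open_UNIV open_chart_im c)+
  have "bounded_linear (\<lambda>p::real \<times> 'e. (fst p *\<^sub>R \<gamma>, snd p))"
    by (intro bounded_linear_Pair bounded_linear_snd
        bounded_linear_compose[OF bounded_linear_scaleR_left bounded_linear_fst])
  then have sm: "smooth_on (UNIV \<times> chart_im c) (\<lambda>p::real \<times> 'e. (fst p *\<^sub>R \<gamma>, snd p))"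
    by (rule smooth_on_linear[OF _ o(1)])
  have "smooth_on (UNIV \<times> chart_im c) (\<lambda>(u, x). tensor_comp A c (T u) x \<alpha>s vs)"
    using T c by (simp add: smooth_tensor_family_def)
  from smooth_on_compose[OF finite_dim_prod[OF fing fin] this sm o]
  show "smooth_on (UNIV \<times> chart_im c) (\<lambda>(t, x). tensor_comp A c (T (t *\<^sub>R \<gamma>)) x \<alpha>s vs)"
    by (auto simp: split_def)
qed

lemma open_smooth_family:
  fixes F :: "'p::real_normed_vector \<Rightarrow> 'm \<Rightarrow> 'm"
  assumes "smooth_map_family A F" "c \<in> A" "c' \<in> A"
  shows "open {(s, x). x \<in> chart_im c \<and> F s (coord_inv c x) \<in> chart_dom c'}"
    and "smooth_on {(s, x). x \<in> chart_im c \<and> F s (coord_inv c x) \<in> chart_dom c'}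
      (\<lambda>(s, x). coord c' (F s (coord_inv c x)))"
proof -
  show "smooth_on {(s, x). x \<in> chart_im c \<and> F s (coord_inv c x) \<in> chart_dom c'}
      (\<lambda>(s, x). coord c' (F s (coord_inv c x)))"
    using assms by (simp add: smooth_map_family_def)
  have o: "open (UNIV \<times> chart_im c :: ('p \<times> 'e) set)"
    by (intro open_Times open_UNIV open_chart_im assms)
  have "continuous_on (UNIV \<times> chart_im c) (\<lambda>p. (fst p, coord_inv c (snd p)))"
    by (intro continuous_on_Pair continuous_on_fst continuous_on_id
        continuous_on_compose2[OF continuous_on_coord_inv[OF assms(2)]] continuous_on_snd) auto
  moreover have "continuous_on UNIV (\<lambda>p. F (fst p) (snd p))"
    using assms(1) by (simp add: smooth_map_family_def split_def)
  ultimately have "continuous_on (UNIV \<times> chart_im c) (\<lambda>p. F (fst p) (coord_inv c (snd p)))"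
    using continuous_on_compose2[of UNIV "\<lambda>p. F (fst p) (snd p)" "UNIV \<times> chart_im c"
        "\<lambda>p. (fst p, coord_inv c (snd p))"] by simp
  then have "open ((\<lambda>p. F (fst p) (coord_inv c (snd p))) -` chart_dom c' \<inter> (UNIV \<times> chart_im c))"
    using continuous_on_open_vimage[OF o] open_chart_dom[OF assms(3)] by blast
  moreover have "(\<lambda>p. F (fst p) (coord_inv c (snd p))) -` chart_dom c' \<inter> (UNIV \<times> chart_im c) =
      {(s, x). x \<in> chart_im c \<and> F s (coord_inv c x) \<in> chart_dom c'}" by auto
  ultimately show "open {(s, x). x \<in> chart_im c \<and> F s (coord_inv c x) \<in> chart_dom c'}" by simp
qed

lemma smooth_map_family_slice:
  fixes F :: "'p::real_normed_vector \<Rightarrow> 'm \<Rightarrow> 'm"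
  assumes fp: "finite_dim (UNIV :: 'p set)" and F: "smooth_map_family A F"
  shows "smooth_map A (F s)"
  unfolding smooth_map_def
proof (intro conjI ballI)
  have "continuous_on UNIV (\<lambda>p. F (fst p) (snd p))"
    using F by (simp add: smooth_map_family_def split_def)
  from continuous_on_compose2[OF this, of UNIV "\<lambda>m. (s, m)"]
  show "continuous_on UNIV (F s)" by (simp add: continuous_intros)
  fix c c' assume c: "c \<in> A" "c' \<in> A"
  from smooth_on_snd_slice[OF fp fin open_smooth_family[OF F c], of s]
  show "smooth_on (coord c ` (chart_dom c \<inter> F s -` chart_dom c')) (coord c' \<circ> F s \<circ> coord_inv c)"
    unfolding coord_image_eq[OF c(1)] by (simp add: vimage_def o_def)
qed

lemma smooth_map_family_line:
  fixes F :: "'g::real_normed_vector \<Rightarrow> 'm \<Rightarrow> 'm"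
  assumes fing: "finite_dim (UNIV :: 'g set)" and F: "smooth_map_family A F"
  shows "smooth_map_family A (\<lambda>t::real. F (t *\<^sub>R \<gamma>))"
  unfolding smooth_map_family_def
proof (intro conjI ballI)
  have "continuous_on UNIV (\<lambda>p. F (fst p) (snd p))"
    using F by (simp add: smooth_map_family_def split_def)
  from continuous_on_compose2[OF this, of UNIV "\<lambda>p. (fst p *\<^sub>R \<gamma>, snd p)"]
  show "continuous_on UNIV (\<lambda>(t, m). F (t *\<^sub>R \<gamma>) m)" by (simp add: continuous_intros split_def)
  fix c c' assume c: "c \<in> A" "c' \<in> A"
  let ?V = "{(s, x). x \<in> chart_im c \<and> F s (coord_inv c x) \<in> chart_dom c'}"
  let ?U = "{(t, x). x \<in> chart_im c \<and> F (t *\<^sub>R \<gamma>) (coord_inv c x) \<in> chart_dom c'}"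
  let ?L = "\<lambda>p::real \<times> 'e. (fst p *\<^sub>R \<gamma>, snd p)"
  have L: "bounded_linear ?L"
    by (intro bounded_linear_Pair bounded_linear_snd
        bounded_linear_compose[OF bounded_linear_scaleR_left bounded_linear_fst])
  have "open (?L -` ?V)"
    by (rule open_vimage[OF open_smooth_family(1)[OF F c]])
      (rule linear_continuous_on[OF L])
  moreover have "?L -` ?V = ?U" by auto
  ultimately have o: "open ?U" by simp
  from smooth_on_compose[OF finite_dim_prod[OF fing fin] open_smooth_family(2)[OF F c]
      smooth_on_linear[OF L o] o open_smooth_family(1)[OF F c]]
  show "smooth_on ?U (\<lambda>(t, x). coord c' (F (t *\<^sub>R \<gamma>) (coord_inv c x)))"
    by (auto simp: split_def)
qed

text \<open>The pullback is defined with \<open>inv\<close>, which is a right inverse as soon as the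
  tangent map is surjective; the tangent map of the inverse diffeomorphism provides the
  preimages.\<close>

lemma tangent_map_pullback_vfield:
  assumes "diffeomorphism A f"
  shows "tangent_map A f p (pullback_vfield A f X p) = X (f p)"
proof -
  have f: "bij f" "smooth_map A f" "smooth_map A (inv f)"
    using assms by (simp_all add: diffeomorphism_def)
  have ff: "f (inv f q) = q" "inv f (f q) = q" for q
    using f(1) by (simp_all add: bij_is_surj surj_f_inv_f bij_is_inj inv_f_f)
  have "tangent_map A f p (tmap (chart_at A (f p)) (chart_at A p) (inv f) (f p) v) = v" for v
    using tmap_inverse[OF f(3,2) ff(1) chart_at_in chart_at_in chart_at_dom[of "f p"], of p v]
      chart_at_dom[of p] by (simp add: tangent_map_eq_tmap ff)
  then have "surj (tangent_map A f p)" by (rule surjI)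
  then show ?thesis by (simp add: pullback_vfield_def surj_f_inv_f)
qed

text \<open>Passing to components at a point only applies fixed linear maps to the vectors, so it
  commutes with the derivatives in t that define the Taylor coefficients.\<close>

lemma tensor2_comp_taylor:
  fixes T :: "'g::real_normed_vector \<Rightarrow> ('m, 'e) tensor"
  assumes T: "smooth_tensor_family A 0 2 (\<lambda>t::real. T (t *\<^sub>R \<gamma>))" and c: "c \<in> A" and z: "z \<in> chart_im c \<times> UNIV"
  shows "tensor2_comp A c (taylor_tensor T k \<gamma>) z = coef (\<lambda>(t, z). tensor2_comp A c (T (t *\<^sub>R \<gamma>)) z) k z"
proof -
  let ?S = "UNIV \<times> (chart_im c \<times> UNIV) :: (real \<times> 'e \<times> 'e \<times> 'e) set"
  have o: "open ?S" by (intro open_Times open_UNIV open_chart_im c)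
  obtain x v w where zz: "z = (x, v, w)" by (cases z)
  have "(0, z) \<in> ?S" using z by simp
  from iterated_vector_derivative_eq[OF o smooth_on_tensor2_comp_family[OF finite_dim_real T c] this, of k]
  show ?thesis
    by (simp add: coef_def zz tensor2_comp_def taylor_tensor_def taylor_term_def tensor_comp_def Let_def)
qed

lemma tensor_field_taylor:
  fixes T :: "'g::real_normed_vector \<Rightarrow> ('m, 'e) tensor"
  assumes T: "smooth_tensor_family A 0 2 (\<lambda>t::real. T (t *\<^sub>R \<gamma>))"
  shows "tensor_field A 0 2 (taylor_tensor T k \<gamma>)"
proof (rule tensor_field_02I)
  have tat: "tensor_at 0 2 (T (t *\<^sub>R \<gamma>) p)" for t p using T by (simp add: smooth_tensor_family_def)
  show "taylor_tensor T k \<gamma> p \<alpha>s vs = 0" if "length \<alpha>s \<noteq> 0 \<or> length vs \<noteq> 2" for p \<alpha>s vs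
  proof -
    have "T (t *\<^sub>R \<gamma>) p \<alpha>s vs = 0" for t using tat[of t p] that by (auto simp: tensor_at_def)
    then show ?thesis
      by (simp add: taylor_tensor_def taylor_term_def iterated_vector_derivative_zero)
  qed
next
  fix p
  let ?c = "chart_at A p"
  let ?x = "coord ?c p"
  let ?S = "UNIV \<times> (chart_im ?c \<times> UNIV) :: (real \<times> 'e \<times> 'e \<times> 'e) set"
  let ?h = "\<lambda>(t, z). tensor2_comp A ?c (T (t *\<^sub>R \<gamma>)) z"
  have tat: "tensor_at 0 2 (T (t *\<^sub>R \<gamma>) p)" for t using T by (simp add: smooth_tensor_family_def)
  have o: "open ?S" by (intro open_Times open_UNIV open_chart_im chart_at_in)
  note sm = smooth_on_tensor2_comp_family[OF finite_dim_real T chart_at_in, of p]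
  have x: "?x \<in> chart_im ?c" using chart_at_dom by blast
  have eq: "taylor_tensor T k \<gamma> p [] [v, w] = (time_deriv ^^ k) ?h (0, ?x, v, w) /\<^sub>R fact k" for v w
    using tensor2_comp_taylor[where z="(?x, v, w)" and k=k, OF T chart_at_in[of p]] x
    by (simp add: tensor2_comp_def tensor_comp_chart_at coef_def)
  note lin = linear_tensor2_comp[of "T (t *\<^sub>R \<gamma>)" p for t, OF tat chart_at_in chart_at_dom]
  have 1: "linear (\<lambda>v. (time_deriv ^^ k) ?h (0, ?x, v, w))" for w
    by (rule linear_time_deriv[OF o sm, where I=UNIV]) (use x lin in auto)
  show "linear (\<lambda>v. taylor_tensor T k \<gamma> p [] [v, w])" for w
    unfolding eq by (rule linear_compose_scale_right[OF 1])
  have 2: "linear (\<lambda>w. (time_deriv ^^ k) ?h (0, ?x, v, w))" for v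
    by (rule linear_time_deriv[OF o sm, where I=UNIV]) (use x lin in auto)
  show "linear (\<lambda>w. taylor_tensor T k \<gamma> p [] [v, w])" for v
    unfolding eq by (rule linear_compose_scale_right[OF 2])
next
  fix c and v w :: 'e assume c: "c \<in> A"
  have fin3: "finite_dim (UNIV :: ('e \<times> 'e \<times> 'e) set)" by (intro finite_dim_prod fin)
  have o: "open (chart_im c)" by (rule open_chart_im[OF c])
  then have o3: "open (chart_im c \<times> (UNIV :: ('e \<times> 'e) set))" by (rule open_Times[OF _ open_UNIV])
  have in3: "smooth_on (chart_im c) (\<lambda>x. (x, v, w))"
    by (intro smooth_on_Pair[OF o] smooth_on_id smooth_on_const)
  have "smooth_on (chart_im c) (\<lambda>x. coef (\<lambda>(t, z). tensor2_comp A c (T (t *\<^sub>R \<gamma>)) z) k (x, v, w))"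
    by (rule smooth_on_compose[OF fin3 smooth_on_coef[OF fin3 o3
            smooth_on_tensor2_comp_family[OF finite_dim_real T c]] in3 o o3]) simp
  then show "smooth_on (chart_im c) (\<lambda>x. tensor_comp A c (taylor_tensor T k \<gamma>) x [] [v, w])"
  proof (rule smooth_on_cong[OF o, rotated])
    show "coef (\<lambda>(t, z). tensor2_comp A c (T (t *\<^sub>R \<gamma>)) z) k (x, v, w) =
        tensor_comp A c (taylor_tensor T k \<gamma>) x [] [v, w]" if "x \<in> chart_im c" for x
      using tensor2_comp_taylor[OF T c, of "(x, v, w)" k] that by (simp add: tensor2_comp_def)
  qed
qed

lemma tensor_field_formal_lie_deriv:
  fixes T :: "'g::real_normed_vector \<Rightarrow> ('m, 'e) tensor"
  assumes T: "smooth_tensor_family A 0 2 (\<lambda>t::real. T (t *\<^sub>R \<gamma>))" and R: "\<And>i. vector_field A (R i \<gamma>)"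
  shows "tensor_field A 0 2 (formal_lie_deriv A R (taylor_tensor T) n \<gamma>)"
  unfolding formal_lie_deriv_def[abs_def]
  by (intro tensor_field_sum tensor_field_lie_deriv tensor_field_taylor T R)

lemma tensor2_comp_formal_lie_deriv:
  fixes T :: "'g::real_normed_vector \<Rightarrow> ('m, 'e) tensor"
  assumes T: "smooth_tensor_family A 0 2 (\<lambda>t::real. T (t *\<^sub>R \<gamma>))" and R: "\<And>i. vector_field A (R i \<gamma>)"
    and c: "c \<in> A" and z: "z \<in> chart_im c \<times> UNIV"
  shows "tensor2_comp A c (formal_lie_deriv A R (taylor_tensor T) n \<gamma>) z =
    lie_coef (\<lambda>(t, z). tensor2_comp A c (T (t *\<^sub>R \<gamma>)) z) (\<lambda>i. vfield_comp A c (R i \<gamma>)) n z"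
proof -
  obtain x v w where zz: "z = (x, v, w)" by (cases z)
  let ?h = "\<lambda>(t, z). tensor2_comp A c (T (t *\<^sub>R \<gamma>)) z"
  have o3: "open (chart_im c \<times> (UNIV :: ('e \<times> 'e) set))" by (intro open_Times open_UNIV open_chart_im c)
  have fdeq: "fd (tensor2_comp A c (taylor_tensor T k \<gamma>)) z = fd (coef ?h k) z" for k
  proof (rule differentiable_cong_open(2)[OF o3 z, symmetric])
    show "tensor2_comp A c (taylor_tensor T k \<gamma>) differentiable (at z)"
      by (rule smooth_on_imp_differentiable[OF smooth_on_tensor2_comp[OF tensor_field_taylor[OF T] c] z])
  qed (rule tensor2_comp_taylor[OF T c])
  have "tensor2_comp A c (formal_lie_deriv A R (taylor_tensor T) n \<gamma>) z =
      (\<Sum>i\<le>n. tensor_comp A c (lie_deriv A (R i \<gamma>) (taylor_tensor T (n - i) \<gamma>)) x [] [v, w])"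
    by (simp add: tensor2_comp_def zz tensor_comp_def Let_def formal_lie_deriv_def)
  also have "\<dots> = (\<Sum>i\<le>n. fd (tensor2_comp A c (taylor_tensor T (n - i) \<gamma>)) z
      (complete_lift (vfield_comp A c (R i \<gamma>)) z))"
    using z by (simp add: zz tensor_comp_lie_deriv[OF tensor_field_taylor[OF T] R c])
  finally show ?thesis by (simp add: lie_coef_def fdeq)
qed

text \<open>The formal identity says, at each point, that the series of pulled-back terms agrees
  with the series R in every degree. Smoothness in t turns this into an o(t^n) estimate at the
  source, which the tangent maps, bounded for t near 0, push forward to the target.\<close>

lemma pullback_vfield_expansion:
  fixes F :: "'g::real_normed_vector \<Rightarrow> 'm \<Rightarrow> 'm" and R :: "nat \<Rightarrow> 'g \<Rightarrow> ('m, 'e) vfield"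
  assumes F: "smooth_map_family A (\<lambda>t::real. F (t *\<^sub>R \<gamma>))" and diffeo: "\<And>\<gamma>. diffeomorphism A (F \<gamma>)"
    and R: "\<And>i. vector_field A (R i \<gamma>)" and inv: "formal_pullback_vfield A F R = R"
    and c: "c \<in> A" "c' \<in> A" and x: "x \<in> chart_im c" "F 0 (coord_inv c x) \<in> chart_dom c'"
  defines "f \<equiv> \<lambda>(t, x). coord c' (F (t *\<^sub>R \<gamma>) (coord_inv c x))"
  shows "small_o n (\<lambda>t::real. t) (at 0) (\<lambda>t. \<Sum>i\<le>n. t ^ i *\<^sub>R
    (vfield_comp A c' (R i \<gamma>) (f (t, x)) - fd f (t, x) (0, vfield_comp A c (R i \<gamma>) x)))"
proof -
  define U where "U = {(t::real, x). x \<in> chart_im c \<and> F (t *\<^sub>R \<gamma>) (coord_inv c x) \<in> chart_dom c'}"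
  define I where "I = {t. (t, x) \<in> U}"
  define q where "q = coord_inv c x"
  \<comment> \<open>Only the map moves with t; \<open>R i\<close> stays at \<gamma>, its degree
    being carried by the factor t^i.\<close>
  define P where "P i t = pullback_vfield A (F (t *\<^sub>R \<gamma>)) (R i \<gamma>) q" for i t
  have q: "q \<in> chart_dom c" "x = coord c q"
    using coord_inv_in[OF c(1) x(1)] coord_coord_inv[OF c(1) x(1)] by (simp_all add: q_def)
  have U: "open U" "smooth_on U f"
    using open_smooth_family[OF F c] by (simp_all add: U_def f_def)
  have I: "open I" "0 \<in> I" using open_time_slice(1)[OF U(1), of x] x by (simp_all add: I_def U_def)
  have Iq: "F (t *\<^sub>R \<gamma>) q \<in> chart_dom c'" "(t, x) \<in> U" if "t \<in> I" for t
    using that by (simp_all add: I_def U_def q_def)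
  have smF: "smooth_map A (F \<delta>)" "smooth_map A (inv (F \<delta>))" and bij: "bij (F \<delta>)" for \<delta>
    using diffeo by (simp_all add: diffeomorphism_def)
  have FF: "F \<delta> (inv (F \<delta>) y) = y" "inv (F \<delta>) (F \<delta> y) = y" for \<delta> y
    using bij by (simp_all add: bij_is_surj surj_f_inv_f bij_is_inj inv_f_f)
  define D where "D t = tmap c c' (F (t *\<^sub>R \<gamma>)) q" for t
  define D' where "D' t = tmap c' c (inv (F (t *\<^sub>R \<gamma>))) (F (t *\<^sub>R \<gamma>) q)" for t
  define \<tau> where "\<tau> = tmap (chart_at A q) c id q"
  define \<tau>' where "\<tau>' = tmap c (chart_at A q) id q"
  have \<tau>: "linear \<tau>" "linear \<tau>'"
    unfolding \<tau>_def \<tau>'_def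
    using linear_tmap[OF smooth_map_id chart_at_in c(1) chart_at_dom] linear_tmap[OF smooth_map_id c(1) chart_at_in q(1)]
      q(1) chart_at_dom by auto
  have \<tau>\<tau>: "\<tau>' (\<tau> v) = v" for v
    using tmap_inverse[OF smooth_map_id smooth_map_id, of "chart_at A q" c q v] q(1) c chart_at_in chart_at_dom
    by (simp add: \<tau>_def \<tau>'_def)
  have fdf: "fd f (t, x) (0, v) = D t v" if "t \<in> I" for t v
  proof -
    have "f differentiable (at (t, x))" by (rule smooth_on_imp_differentiable[OF U(2) Iq(2)[OF that]])
    from fd_eqI[OF has_derivative_snd_slice[OF this]] show ?thesis
      by (simp add: f_def D_def tmap_def q(2)[symmetric] o_def)
  qed
  have DD: "D t (D' t v) = v" "D' t (D t v) = v" if "t \<in> I" for t v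
    using tmap_inverse[OF smF(1,2) FF(2) c q(1) Iq(1)[OF that], where v=v]
      tmap_inverse[OF smF(2,1) FF(1)[where \<delta>="t *\<^sub>R \<gamma>"] c(2,1) Iq(1)[OF that], where v=v] q(1)
    by (simp_all add: D_def D'_def FF)
  have linD: "linear (D t)" "linear (D' t)" if "t \<in> I" for t
    unfolding D_def D'_def
    using linear_tmap[OF smF(1) c q(1) Iq(1)[OF that]] linear_tmap[OF smF(2) c(2,1) Iq(1)[OF that]] q(1)
    by (simp_all add: FF)
  have smI: "smooth_on I (\<lambda>t. (t, x))" by (intro smooth_on_Pair I smooth_on_id smooth_on_const)
  have fin2: "finite_dim (UNIV :: (real \<times> 'e) set)" by (intro finite_dim_prod finite_dim_real fin)
  have smD: "smooth_on I (\<lambda>t. D t v)" for v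
  proof (rule smooth_on_cong[OF I(1) fdf])
    show "smooth_on I (\<lambda>t. fd f (t, x) (0, v))"
      by (rule smooth_on_compose[OF fin2 smooth_on_fd[OF U(2)] smI I(1) U(1) Iq(2)])
  qed
  have rel: "vfield_comp A c' (R i \<gamma>) (f (t, x)) = D t (\<tau> (P i t))" if "t \<in> I" for i t
    using vfield_comp_related[where X="R i \<gamma>" and f="F (t *\<^sub>R \<gamma>)" and p=q, OF smF(1) c q(1) Iq(1)[OF that]
        tangent_map_pullback_vfield[OF diffeo, where X="R i \<gamma>" and p=q]]
    by (simp add: D_def \<tau>_def P_def f_def q_def)
  \<comment> \<open>Through \<open>inv\<close>, smoothness in t is not visible. It appears once
    \<open>P i\<close> is written with \<open>D'\<close>, the inverse of the smooth family
    \<open>D\<close>, applied to the field along the path and followed by the fixed map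
    \<tau>'.\<close>
  have smP: "smooth_on I (P i)" for i
  proof -
    have "smooth_on I (\<lambda>t. f (t, x))"
      by (rule smooth_on_compose[OF fin2 U(2) smI I(1) U(1) Iq(2)])
    then have y: "smooth_on I (\<lambda>t. vfield_comp A c' (R i \<gamma>) (f (t, x)))"
      by (rule smooth_on_compose[OF fin smooth_on_vfield_comp[OF R c(2)] _ I(1) open_chart_im[OF c(2)]])
        (use Iq(1) in \<open>auto simp: f_def q_def\<close>)
    have "smooth_on I (\<lambda>t. D' t v)" for v
      by (rule smooth_on_inverse_family[OF fin I(1) linD DD smD])
    from smooth_on_parametric_linear[where B=D', OF fin I(1) linD(2) this y]
    have "smooth_on I (\<lambda>t. D' t (vfield_comp A c' (R i \<gamma>) (f (t, x))))" .
    then have "smooth_on I (\<lambda>t. \<tau>' (D' t (vfield_comp A c' (R i \<gamma>) (f (t, x)))))"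
      by (rule smooth_on_bounded_linear[OF bounded_linear_finite_dim[OF fin \<tau>(2)] I(1)])
    then show ?thesis
      by (rule smooth_on_cong[OF I(1), rotated]) (simp add: rel DD \<tau>\<tau>)
  qed
  define P' where "P' i k = ((\<lambda>h t. vector_derivative h (at t)) ^^ k) (P i) 0 /\<^sub>R fact k" for i k
  have "small_o n (\<lambda>t. t) (at 0) (\<lambda>t. (\<Sum>i\<le>n. t ^ i *\<^sub>R P i t) -
      (\<Sum>m\<le>n. t ^ m *\<^sub>R (\<Sum>i\<le>m. P' i (m - i))))"
    unfolding P'_def by (rule small_o_triangle) (rule Taylor_curve[OF I smP])
  \<comment> \<open>The definition of the formal pullback indexes by the order of differentiation,
    the Cauchy product by the degree of the term of R; the sum is reversed.\<close>
  moreover have "(\<Sum>i\<le>m. P' i (m - i)) = R m \<gamma> q" for m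
  proof -
    have "R m \<gamma> q = (\<Sum>i\<le>m. P' (m - i) i)"
      using fun_cong[OF fun_cong[OF fun_cong[OF inv]], of m \<gamma> q]
      by (simp add: formal_pullback_vfield_def P'_def P_def[abs_def] taylor_term_def)
    also have "\<dots> = (\<Sum>i\<le>m. P' i (m - i))"
      using sum.nat_diff_reindex[of "\<lambda>i. P' (m - i) i" "Suc m"]
      by (simp add: lessThan_Suc_atMost)
    finally show ?thesis by simp
  qed
  ultimately have so: "small_o n (\<lambda>t. t) (at 0) (\<lambda>t. (\<Sum>i\<le>n. t ^ i *\<^sub>R P i t) - (\<Sum>i\<le>n. t ^ i *\<^sub>R R i \<gamma> q))"
    by simp
  have "bounded_linear (\<lambda>v. (0::real, \<tau> v))"
    using bounded_linear_finite_dim[OF fin \<tau>(1)] by (intro bounded_linear_Pair bounded_linear_zero)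
  note so' = small_o_bounded_linear[OF this so]
  have "((\<lambda>t. (t, x)) \<longlongrightarrow> (0, x)) (at (0::real))"
    by (intro tendsto_Pair tendsto_ident_at tendsto_const)
  from small_o_fd[OF fin2 U Iq(2)[OF I(2)] this so'] show ?thesis
  proof (rule small_o_cong)
    have "\<forall>\<^sub>F t in at 0. t \<in> I" using eventually_at_in_open'[OF I] .
    then show "\<forall>\<^sub>F t in at 0. fd f (t, x) (0, \<tau> ((\<Sum>i\<le>n. t ^ i *\<^sub>R P i t) - (\<Sum>i\<le>n. t ^ i *\<^sub>R R i \<gamma> q))) =
      (\<Sum>i\<le>n. t ^ i *\<^sub>R
        (vfield_comp A c' (R i \<gamma>) (f (t, x)) - fd f (t, x) (0, vfield_comp A c (R i \<gamma>) x)))"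
    proof eventually_elim
      case (elim t)
      have "vfield_comp A c (R i \<gamma>) x = \<tau> (R i \<gamma> q)" for i
        using vfield_comp_coord[OF c(1) q(1)] by (simp add: \<tau>_def q(2))
      moreover have "(\<Sum>i\<le>n. t ^ i *\<^sub>R P i t) - (\<Sum>i\<le>n. t ^ i *\<^sub>R R i \<gamma> q) =
          (\<Sum>i\<le>n. t ^ i *\<^sub>R (P i t - R i \<gamma> q))"
        by (simp add: sum_subtractf scaleR_diff_right)
      moreover have "D t (\<tau> (\<Sum>i\<le>n. t ^ i *\<^sub>R (P i t - R i \<gamma> q))) =
          (\<Sum>i\<le>n. t ^ i *\<^sub>R (D t (\<tau> (P i t)) - D t (\<tau> (R i \<gamma> q))))"
        by (simp only: linear_sum[OF \<tau>(1)] linear_scale[OF \<tau>(1)] linear_diff[OF \<tau>(1)]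
            linear_sum[OF linD(1)[OF elim]] linear_scale[OF linD(1)[OF elim]] linear_diff[OF linD(1)[OF elim]])
      ultimately show ?case by (simp add: fdf[OF elim] rel[OF elim])
    qed
  qed
qed

text \<open>The chart result carried to the manifold: exact invariance of \<open>T\<close> under
  \<open>F\<close> supplies the relation between local components, and
  \<open>pullback_vfield_expansion\<close> the bound on the defect.\<close>

lemma leading_coefficient_invariant:
  fixes F :: "'g::real_normed_vector \<Rightarrow> 'm \<Rightarrow> 'm" and R :: "nat \<Rightarrow> 'g \<Rightarrow> ('m, 'e) vfield"
    and T :: "'g \<Rightarrow> ('m, 'e) tensor"
  assumes T: "smooth_tensor_family A 0 2 (\<lambda>t::real. T (t *\<^sub>R \<gamma>))"
    and F: "smooth_map_family A (\<lambda>t::real. F (t *\<^sub>R \<gamma>))" and diffeo: "\<And>\<gamma>. diffeomorphism A (F \<gamma>)"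
    and pull: "\<And>\<gamma>. pullback A (F \<gamma>) (T \<gamma>) = T \<gamma>"
    and R: "\<And>i. vector_field A (R i \<gamma>)" and inv: "formal_pullback_vfield A F R = R"
    and vanish: "\<And>m. m < n \<Longrightarrow> formal_lie_deriv A R (taylor_tensor T) m \<gamma> = (\<lambda>p \<alpha>s vs. 0)"
  shows "pullback A (F 0) (formal_lie_deriv A R (taylor_tensor T) n \<gamma>) p [] [v, w] =
    formal_lie_deriv A R (taylor_tensor T) n \<gamma> p [] [v, w]"
proof -
  let ?\<alpha> = "formal_lie_deriv A R (taylor_tensor T) n \<gamma>"
  \<comment> \<open>With the preferred charts at \<open>p\<close> and at its image, the space
    derivative of the local map at time 0 is exactly \<open>tangent_map\<close>.\<close>
  define c where "c = chart_at A p"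
  define c' where "c' = chart_at A (F 0 p)"
  have c: "c \<in> A" "c' \<in> A" and p: "p \<in> chart_dom c" "F 0 p \<in> chart_dom c'"
    by (simp_all add: c_def c'_def chart_at_in chart_at_dom)
  define f where "f = (\<lambda>(t::real, x). coord c' (F (t *\<^sub>R \<gamma>) (coord_inv c x)))"
  define U where "U = {(t::real, x). x \<in> chart_im c \<and> F (t *\<^sub>R \<gamma>) (coord_inv c x) \<in> chart_dom c'}"
  let ?x = "coord c p"
  have U: "open U" "smooth_on U f"
    using open_smooth_family[OF F c] by (simp_all add: U_def f_def)
  have xU: "(0, ?x) \<in> U" using p coord_inv_coord[OF c(1)] by (simp add: U_def)
  have smF: "smooth_map A (F \<delta>)" for \<delta> using diffeo by (simp add: diffeomorphism_def)
  have fdf: "fd f (t, x) (0, v) = tmap c c' (F (t *\<^sub>R \<gamma>)) (coord_inv c x) v" if "(t, x) \<in> U" for t x v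
  proof -
    have "f differentiable (at (t, x))" by (rule smooth_on_imp_differentiable[OF U(2) that])
    from fd_eqI[OF has_derivative_snd_slice[OF this]] show ?thesis
      using that coord_coord_inv[OF c(1), of x] by (simp add: f_def tmap_def o_def U_def)
  qed
  note lc = tensor2_comp_formal_lie_deriv[where R=R and \<gamma>=\<gamma>, OF T R]
  have zero: "tensor2_comp A d (\<lambda>p \<alpha>s vs. 0) z = 0" for d z
    by (simp add: tensor2_comp_def tensor_comp_def Let_def split_def)
  have "lie_coef (\<lambda>(t, z). tensor2_comp A c (T (t *\<^sub>R \<gamma>)) z) (\<lambda>i. vfield_comp A c (R i \<gamma>)) n (?x, v, w) =
      lie_coef (\<lambda>(t, z). tensor2_comp A c' (T (t *\<^sub>R \<gamma>)) z) (\<lambda>i. vfield_comp A c' (R i \<gamma>)) n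
        (f (0, ?x), fd f (0, ?x) (0, v), fd f (0, ?x) (0, w))"
  proof (rule lie_coef_invariant[OF fin open_chart_im[OF c(1)] open_chart_im[OF c(2)] U(1) xU _ U(2)
        smooth_on_tensor2_comp_family[OF finite_dim_real T c(1)] smooth_on_vfield_comp[OF R c(1)]
        smooth_on_tensor2_comp_family[OF finite_dim_real T c(2)] smooth_on_vfield_comp[OF R c(2)]])
    show "x \<in> chart_im c \<and> f (t, x) \<in> chart_im c'" if "(t, x) \<in> U" for t x
      using that by (auto simp: U_def f_def)
    show "(case (t, x, v, w) of (t, z) \<Rightarrow> tensor2_comp A c (T (t *\<^sub>R \<gamma>)) z) =
        (case (t, f (t, x), fd f (t, x) (0, v), fd f (t, x) (0, w)) of
          (t, z) \<Rightarrow> tensor2_comp A c' (T (t *\<^sub>R \<gamma>)) z)" if "(t, x) \<in> U" for t x v w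
    proof -
      let ?F = "F (t *\<^sub>R \<gamma>)" and ?q = "coord_inv c x"
      have q: "?q \<in> chart_dom c" "coord c ?q = x" "?F ?q \<in> chart_dom c'"
        using that coord_inv_in[OF c(1)] coord_coord_inv[OF c(1)] by (auto simp: U_def)
      have "T (t *\<^sub>R \<gamma>) ?q [] vs = T (t *\<^sub>R \<gamma>) (?F ?q) [] (map (tangent_map A ?F ?q) vs)" for vs
        using fun_cong[OF fun_cong[OF fun_cong[OF pull[of "t *\<^sub>R \<gamma>"]]], of ?q "[]" vs]
        by (simp add: pullback_def)
      from tensor_comp_related[of ?F c c' ?q "T (t *\<^sub>R \<gamma>)" "T (t *\<^sub>R \<gamma>)" "[v, w]",
          OF smF c q(1,3) this] show ?thesis
        by (simp add: tensor2_comp_def q(2) fdf[OF that]) (simp add: f_def)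
    qed
    show "small_o n (\<lambda>t. t) (at 0) (\<lambda>t. \<Sum>i\<le>n. t ^ i *\<^sub>R
        (vfield_comp A c' (R i \<gamma>) (f (t, x)) - fd f (t, x) (0, vfield_comp A c (R i \<gamma>) x)))"
      if "(0, x) \<in> U" for x
      unfolding f_def
      by (rule pullback_vfield_expansion[OF F diffeo R inv c]) (use that in \<open>simp_all add: U_def\<close>)
    show "lie_coef (\<lambda>(t, z). tensor2_comp A c (T (t *\<^sub>R \<gamma>)) z) (\<lambda>i. vfield_comp A c (R i \<gamma>)) m z = 0"
      if "m < n" "z \<in> chart_im c \<times> UNIV" for m z
      using lc[OF c(1) that(2), of m] vanish[OF that(1)] zero by simp
    show "lie_coef (\<lambda>(t, z). tensor2_comp A c' (T (t *\<^sub>R \<gamma>)) z) (\<lambda>i. vfield_comp A c' (R i \<gamma>)) m z = 0"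
      if "m < n" "z \<in> chart_im c' \<times> UNIV" for m z
      using lc[OF c(2) that(2), of m] vanish[OF that(1)] zero by simp
  qed
  moreover have "f (0, ?x) = coord c' (F 0 p)" using coord_inv_coord[OF c(1) p(1)] by (simp add: f_def)
  moreover have "fd f (0, ?x) (0, v) = tangent_map A (F 0) p v" for v
    using fdf[OF xU] coord_inv_coord[OF c(1) p(1)] by (simp add: tangent_map_eq_tmap c_def c'_def)
  ultimately have "tensor2_comp A c ?\<alpha> (?x, v, w) =
      tensor2_comp A c' ?\<alpha> (coord c' (F 0 p), tangent_map A (F 0) p v, tangent_map A (F 0) p w)"
    using lc[OF c(1), of "(?x, v, w)" n]
      lc[OF c(2), of "(coord c' (F 0 p), tangent_map A (F 0) p v, tangent_map A (F 0) p w)" n] p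
    by simp
  then show ?thesis
    by (simp add: tensor2_comp_def c_def c'_def tensor_comp_chart_at pullback_def)
qed

text \<open>Linearity of the flow on tensor fields; the empty sum is the form in which the main
  proof uses that the flow of the zero tensor vanishes.\<close>

lemma formal_pullback_flow_sum:
  assumes E: "formal_pullback_flow A \<Phi> R E" and T: "\<And>j. j \<in> J \<Longrightarrow> tensor_field A 0 2 (T j)"
  shows "E \<theta> i \<gamma> (\<lambda>p \<alpha>s vs. \<Sum>j\<in>J. T j p \<alpha>s vs) = (\<lambda>p \<alpha>s vs. \<Sum>j\<in>J. E \<theta> i \<gamma> (T j) p \<alpha>s vs)"
proof -
  have lin: "E \<theta> i \<gamma> (\<lambda>p \<alpha>s vs. a * S p \<alpha>s vs + b * S' p \<alpha>s vs) =
      (\<lambda>p \<alpha>s vs. a * E \<theta> i \<gamma> S p \<alpha>s vs + b * E \<theta> i \<gamma> S' p \<alpha>s vs)"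
    if "tensor_field A 0 2 S" "tensor_field A 0 2 S'" for a b S S'
    using E[unfolded formal_pullback_flow_def, THEN spec[of _ 0], THEN spec[of _ 2], THEN conjunct1] that
    by simp
  have zero: "tensor_field A 0 2 (\<lambda>p \<alpha>s vs. 0)"
    using tensor_field_sum[of "{}" "\<lambda>_. undefined"] by simp
  have z: "E \<theta> i \<gamma> (\<lambda>p \<alpha>s vs. 0) = (\<lambda>p \<alpha>s vs. 0)" using lin[OF zero zero, of 0 0] by simp
  show ?thesis
    using T
  proof (induction J rule: infinite_finite_induct)
    case (insert j J)
    have "tensor_field A 0 2 (\<lambda>p \<alpha>s vs. \<Sum>j\<in>J. T j p \<alpha>s vs)"
      using insert.prems by (intro tensor_field_sum) simp
    from lin[OF _ this, of "T j" 1 1] show ?case using insert by simp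
  qed (simp_all add: z)
qed

text \<open>The derivative of each flow coefficient is a sum over the degree of R, so the total runs
  over triples of degrees adding up to n. Grouping the degrees of R and of \<open>T\<close> first
  turns that sum into the flow applied to the formal Lie derivative.\<close>

lemma formal_pullback_flow_series_deriv:
  fixes T :: "'g::real_normed_vector \<Rightarrow> ('m, 'e) tensor"
  assumes E: "formal_pullback_flow A \<Phi> R E"
    and T: "smooth_tensor_family A 0 2 (\<lambda>t::real. T (t *\<^sub>R \<gamma>))" and R: "\<And>i. vector_field A (R i \<gamma>)"
  shows "((\<lambda>\<theta>. \<Sum>k\<le>n. E \<theta> k \<gamma> (taylor_tensor T (n - k) \<gamma>) p \<alpha>s vs) has_real_derivative
    (\<Sum>i\<le>n. E \<theta> i \<gamma> (formal_lie_deriv A R (taylor_tensor T) (n - i) \<gamma>) p \<alpha>s vs)) (at \<theta>)"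
proof -
  let ?L = "\<lambda>j k. lie_deriv A (R j \<gamma>) (taylor_tensor T k \<gamma>)"
  have tf: "tensor_field A 0 2 (?L j k)" for j k
    by (intro tensor_field_lie_deriv tensor_field_taylor T R)
  have "((\<lambda>\<theta>. \<Sum>k\<le>n. E \<theta> k \<gamma> (taylor_tensor T (n - k) \<gamma>) p \<alpha>s vs) has_real_derivative
      (\<Sum>k\<le>n. \<Sum>i\<le>k. E \<theta> i \<gamma> (?L (k - i) (n - k)) p \<alpha>s vs)) (at \<theta>)"
  proof (rule DERIV_sum)
    show "((\<lambda>\<theta>. E \<theta> k \<gamma> (taylor_tensor T (n - k) \<gamma>) p \<alpha>s vs) has_real_derivative
        (\<Sum>i\<le>k. E \<theta> i \<gamma> (?L (k - i) (n - k)) p \<alpha>s vs)) (at \<theta>)" for k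
      using E tensor_field_taylor[OF T, of "n - k"] unfolding formal_pullback_flow_def by blast
  qed
  also have "(\<Sum>k\<le>n. \<Sum>i\<le>k. E \<theta> i \<gamma> (?L (k - i) (n - k)) p \<alpha>s vs) =
      (\<Sum>k\<le>n. \<Sum>i\<le>k. E \<theta> i \<gamma> (?L (k - i) (n - (i + (k - i)))) p \<alpha>s vs)"
    by (intro sum.cong refl) simp
  also have "\<dots> = (\<Sum>(i, j)\<in>{(i, j). i + j \<le> n}. E \<theta> i \<gamma> (?L j (n - (i + j))) p \<alpha>s vs)"
    by (rule sum.triangle_reindex_eq[symmetric])
  also have "{(i, j). i + j \<le> n} = Sigma {..n} (\<lambda>i. {..n - i})" by auto
  also have "(\<Sum>(i, j)\<in>Sigma {..n} (\<lambda>i. {..n - i}). E \<theta> i \<gamma> (?L j (n - (i + j))) p \<alpha>s vs) =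
      (\<Sum>i\<le>n. \<Sum>j\<le>n - i. E \<theta> i \<gamma> (?L j (n - i - j)) p \<alpha>s vs)"
    by (simp add: sum.Sigma)
  also have "\<dots> = (\<Sum>i\<le>n. E \<theta> i \<gamma> (formal_lie_deriv A R (taylor_tensor T) (n - i) \<gamma>) p \<alpha>s vs)"
    unfolding formal_lie_deriv_def[abs_def] by (simp add: formal_pullback_flow_sum[OF E tf])
  finally show ?thesis .
qed

lemma nonresonant_pullback_invariant:
  assumes \<Phi>: "circle_action A \<Phi>" and nr: "\<not> resonant \<theta>0"
    and inv: "\<And>p v w. pullback A (\<Phi> \<theta>0) T p [] [v, w] = T p [] [v, w]"
    and cont: "\<And>p v w \<theta>. isCont (\<lambda>\<theta>. pullback A (\<Phi> \<theta>) T p [] [v, w]) \<theta>"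
  shows "pullback A (\<Phi> \<theta>) T p [] [v, w] = T p [] [v, w]"
proof -
  let ?g = "\<lambda>\<theta>. pullback A (\<Phi> \<theta>) T p [] [v, w]"
  have act: "\<Phi> 0 = id" "\<Phi> (a + b) = \<Phi> a \<circ> \<Phi> b" "\<Phi> (2 * pi) = id" for a b
    using \<Phi> by (simp_all add: circle_action_def)
  have sm: "smooth_map A (\<Phi> a)" for a
    using \<Phi> smooth_map_family_slice[OF finite_dim_real] by (simp add: circle_action_def)
  have "?g \<theta> = ?g 0"
  proof (rule continuous_periodic_constant[OF cont])
    \<comment> \<open>The composite is split so that \<theta>0 acts last: invariance is then applied
      at the point \<open>\<Phi> \<theta> p\<close> to the pushed-forward vectors.\<close>
    show "?g (\<theta> + \<theta>0) = ?g \<theta>" for \<theta>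
      using inv[of "\<Phi> \<theta> p"] tangent_map_comp[OF sm sm]
      by (simp add: add.commute[of \<theta> \<theta>0] act(2) pullback_def)
    show "?g (\<theta> + 2 * pi) = ?g \<theta>" for \<theta>
      by (simp add: act(2,3))
    show "\<theta>0 / (2 * pi) \<notin> \<rat>"
    proof
      assume "\<theta>0 / (2 * pi) \<in> \<rat>"
      moreover have "\<theta>0 = 2 * pi * (\<theta>0 / (2 * pi))" by simp
      ultimately show False using nr unfolding resonant_def by blast
    qed
  qed
  also have "\<dots> = T p [] [v, w]" by (simp add: act(1) pullback_def tangent_map_id)
  finally show ?thesis .
qed

end

theorem theorem3:
  fixes A :: "('m::{t2_space, second_countable_topology}, 'e::real_normed_vector) chart set"
    and \<Omega> :: "'g::real_normed_vector \<Rightarrow> ('m, 'e) tensor"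
    and F :: "'g \<Rightarrow> 'm \<Rightarrow> 'm"
    and \<Phi> :: "real \<Rightarrow> 'm \<Rightarrow> 'm"
    and \<theta>0 :: real
    and R :: "nat \<Rightarrow> 'g \<Rightarrow> ('m, 'e) vfield"
  assumes "smooth_manifold A"
    and "finite_dim (UNIV :: 'g set)"
    and "presymplectic_family A \<Omega>"
    and "presymplectic_nearly_periodic_map A \<Omega> F \<Phi> \<theta>0"
    and "\<not> resonant \<theta>0"
    and "roto_rate A F \<Phi> R"
  shows "formal_lie_deriv A R (taylor_tensor \<Omega>) = (\<lambda>n \<gamma> p \<alpha>s vs. 0)"
proof (intro ext)
  interpret manifold A by unfold_locales fact
  have npm: "smooth_map_family A F" "\<And>\<gamma>. diffeomorphism A (F \<gamma>)" "circle_action A \<Phi>" "F 0 = \<Phi> \<theta>0"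
    and pull: "\<And>\<gamma>. pullback A (F \<gamma>) (\<Omega> \<gamma>) = \<Omega> \<gamma>"
    using assms(4) by (simp_all add: presymplectic_nearly_periodic_map_def nearly_periodic_map_def)
  have R: "\<And>n \<gamma>. vector_field A (R n \<gamma>)" "formal_pullback_vfield A F R = R"
    using assms(6) by (simp_all add: roto_rate_def formal_vfield_def)
  obtain E where E: "formal_pullback_flow A \<Phi> R E"
    and period: "\<And>T n \<gamma>. tensor_field A 0 2 T \<Longrightarrow> E (2 * pi) n \<gamma> T = (if n = 0 then T else (\<lambda>p \<alpha>s vs. 0))"
    using assms(6) unfolding roto_rate_def by blast
  have E0: "\<And>n \<gamma>. E 0 n \<gamma> T = (if n = 0 then T else (\<lambda>p \<alpha>s vs. 0))"
    and E\<Phi>: "\<And>\<theta> \<gamma>. E \<theta> 0 \<gamma> T = pullback A (\<Phi> \<theta>) T"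
    and dE: "\<And>\<theta> n \<gamma> p \<alpha>s vs. \<exists>D. ((\<lambda>\<theta>. E \<theta> n \<gamma> T p \<alpha>s vs) has_real_derivative D) (at \<theta>)"
    if "tensor_field A 0 2 T" for T
    using E that unfolding formal_pullback_flow_def by blast+
  fix n \<gamma> p \<alpha>s and vs :: "'e list"
  have \<Omega>: "smooth_tensor_family A 0 2 (\<lambda>t::real. \<Omega> (t *\<^sub>R \<gamma>))"
    using smooth_tensor_family_line[OF assms(2)] assms(3) by (simp add: presymplectic_family_def)
  let ?\<Omega> = "\<lambda>n. taylor_tensor \<Omega> n \<gamma>" and ?\<alpha> = "\<lambda>n. formal_lie_deriv A R (taylor_tensor \<Omega>) n \<gamma>"
  note t\<Omega> = tensor_field_taylor[OF \<Omega>]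
    and t\<alpha> = tensor_field_formal_lie_deriv[where R=R and \<gamma>=\<gamma>, OF \<Omega> R(1)]
  have "?\<alpha> n = (\<lambda>p \<alpha>s vs. 0)"
  proof (induction n rule: less_induct)
    case (less n)
    have "pullback A (\<Phi> \<theta>0) (?\<alpha> n) p [] [v, w] = ?\<alpha> n p [] [v, w]" for p v w
      using leading_coefficient_invariant[where F=F, OF \<Omega> smooth_map_family_line[OF assms(2) npm(1)] npm(2)
          pull R less.IH] npm(4) by simp
    \<comment> \<open>This pullback is the degree-0 part of the flow, hence differentiable in
      \<theta> by the flow equation.\<close>
    moreover have "isCont (\<lambda>\<theta>. pullback A (\<Phi> \<theta>) (?\<alpha> n) p [] [v, w]) \<theta>" for p v w \<theta>
      using dE[OF t\<alpha>[where n=n], where n=0 and \<gamma>=\<gamma> and p=p and \<alpha>s="[]" and vs="[v, w]" and \<theta>=\<theta>] E\<Phi>[OF t\<alpha>] by (auto intro: DERIV_isCont)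
    ultimately have inv: "pullback A (\<Phi> \<theta>) (?\<alpha> n) p [] [v, w] = ?\<alpha> n p [] [v, w]" for \<theta> p v w
      by (rule nonresonant_pullback_invariant[OF npm(3) assms(5)])
    have zero: "?\<alpha> n p [] [v, w] = 0" for p v w
    proof -
      \<comment> \<open>The degree-n part of exp(theta L_R) Omega; its derivative turns out to be
        independent of theta.\<close>
      let ?\<phi> = "\<lambda>\<theta>. \<Sum>k\<le>n. E \<theta> k \<gamma> (?\<Omega> (n - k)) p [] [v, w]"
      have "(?\<phi> has_real_derivative ?\<alpha> n p [] [v, w]) (at \<theta>)" for \<theta>
      proof -
        \<comment> \<open>For i > 0 the coefficient of degree \<open>n - i\<close> is zero by
          induction; only i = 0 survives.\<close>
        have "E \<theta> i \<gamma> (?\<alpha> (n - i)) p [] [v, w] = 0" if "i \<in> {..n} - {0}" for i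
          using formal_pullback_flow_sum[OF E, where J="{} :: nat set" and \<theta>=\<theta> and i=i and \<gamma>=\<gamma>] less.IH[of "n - i"] that by simp
        then have "(\<Sum>i\<le>n. E \<theta> i \<gamma> (?\<alpha> (n - i)) p [] [v, w]) = (\<Sum>i\<in>{0}. E \<theta> i \<gamma> (?\<alpha> (n - i)) p [] [v, w])"
          by (intro sum.mono_neutral_right) auto
        also have "\<dots> = ?\<alpha> n p [] [v, w]" by (simp add: E\<Phi>[OF t\<alpha>] inv)
        finally show ?thesis
          using formal_pullback_flow_series_deriv[where R=R and \<gamma>=\<gamma>, OF E \<Omega> R(1), where n=n and p=p and \<alpha>s="[]" and vs="[v, w]" and \<theta>=\<theta>]
          by simp
      qed
      then obtain z where "?\<phi> (2 * pi) - ?\<phi> 0 = (2 * pi - 0) * ?\<alpha> n p [] [v, w]"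
        using MVT2[of 0 "2 * pi" ?\<phi> "\<lambda>_. ?\<alpha> n p [] [v, w]"] by auto
      \<comment> \<open>At both ends the flow is the identity series, which leaves only the term k =
        0, the Taylor coefficient of degree n itself.\<close>
      moreover have "?\<phi> (2 * pi) = ?\<phi> 0"
        using period[OF t\<Omega>] E0[OF t\<Omega>] by simp
      ultimately show ?thesis by simp
    qed
    show ?case
    proof (intro ext)
      fix p \<alpha>s and vs :: "'e list"
      show "?\<alpha> n p \<alpha>s vs = 0"
      proof (cases "length \<alpha>s \<noteq> 0 \<or> length vs \<noteq> 2")
        case True
        then show ?thesis by (rule tensor_field_zero[OF t\<alpha>])
      next
        case False
        then obtain v w where "\<alpha>s = []" "vs = [v, w]"
          by (metis (no_types, opaque_lifting) One_nat_def Suc_1 length_0_conv length_Suc_conv)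
        then show ?thesis using zero by simp
      qed
    qed
  qed
  then show "?\<alpha> n p \<alpha>s vs = 0" by simp
qed

end
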